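(* Let $F=F(s,u,v,t_1,t_2,\dots)$ be the generating function defined in the context, and define the operators $$L_1F=\sum_{i=2}^\infty (i-1)t_i\frac{\partial F}{\partial t_{i-1}},\qquad M_1F=\sum_{i=2}^\infty\sum_{j=1}^{i-1}\Big((i-1)t_jt_{i-j}\frac{\partial F}{\partial t_{i-1}}+j(i-j)t_{i+1}\frac{\partial^2F}{\partial t_j\partial t_{i-j}}\Big),$$ $$Q_1F=\sum_{i=2}^\infty\sum_{j=1}^{i-1} j(i-j)t_{i+1}\frac{\partial F}{\partial t_j}\cdot\frac{\partial F}{\partial t_{i-j}}.$$ Then $F$ satisfies $$\frac{\partial F}{\partial s}=\big((u+v)L_1+M_1+Q_1\big)F+uvt_1,$$ and $F$ is the unique formal power series solution of this equation with $F|_{s=0}=0$. Equivalently, the partition function $Z=e^F$ is given by $$Z(s,u,v,t_1,t_2,\dots)=e^{s((u+v)L_1+M_1+uvt_1)}\,1,$$ where $1$ is the constant function $1$ and $uvt_1$ acts as a multiplication operator.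
   Context: A Belyi graph is a connected graph $\Gamma$ in which every vertex is colored white or black, every edge joins a white vertex to a black vertex, and every edge is colored blue, green or red so that each vertex is incident to exactly one edge of each color. $\Gamma$ carries the ribbon graph structure given by the counterclockwise cyclic order blue–green–red at white vertices and red–green–blue at black vertices. Automorphisms of $\Gamma$ are graph automorphisms preserving the colors of vertices and edges. The degree $d$ of $\Gamma$ is its number of green edges. The type of $\Gamma$ is the triple $(k,l;\mathbf m)$, $\mathbf m=(m_1,m_2,\dots)$, where $k$ is the number of red–green cycles of $\Gamma$, $l$ is the number of green–blue cycles, and $m_i$ is the number of red–blue cycles of length $2i$ (consisting of $i$ red and $i$ blue edges); then $\sum_i im_i=d$ and the genus $g$ of the ribbon graph satisfies $2g-2=d-(k+l+\sum_im_i)$. (Equivalently, for the corresponding Belyi pair $(C,f)$: $k=|f^{-1}(0)|$, $l=|f^{-1}(1)|$, $m_i$ is the number of poles of $f$ of order $i$.) Let $\mathcal B_{k,l;\mathbf m}$ be the set of isomorphism classes of Belyi graphs of type $(k,l;\mathbf m)$ and $$\mathcal N_{k,l}(\mathbf m)=\sum_{\Gamma\in\mathcal B_{k,l;\mathbf m}}\frac{1}{|\mathrm{Aut}(\Gamma)|}.$$ The generating function is the formal power series $$F(s,u,v,t_1,t_2,\dots)=\sum_{d\ge1}s^d\sum_{k,l\ge1}\ \sum_{\mathbf m:\ \sum_i im_i=d}\mathcal N_{k,l}(\mathbf m)\,u^kv^l\,t_1^{m_1}t_2^{m_2}\cdots.$$ *)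

theory Defs
  imports Complex_Main "HOL-Library.Poly_Mapping" "HOL-Library.FuncSet" "HOL-Library.Groups_Big_Fun"
begin

datatype colour = Blue | Green | Red

text \<open>A (finite, edge-labelled multi-)graph with vertices and edges named by natural numbers.
  Every edge e joins the white vertex wend e to the black vertex bend e.\<close>
record bgraph =
  verts :: "nat set"
  edges :: "nat set"
  is_white :: "nat \<Rightarrow> bool"
  wend :: "nat \<Rightarrow> nat"
  bend :: "nat \<Rightarrow> nat"
  ecol :: "nat \<Rightarrow> colour"

definition adj :: "bgraph \<Rightarrow> colour set \<Rightarrow> nat \<Rightarrow> nat \<Rightarrow> bool" where
  "adj G C x y \<longleftrightarrow> (\<exists>e\<in>edges G. ecol G e \<in> C \<and>
      ((wend G e = x \<and> bend G e = y) \<or> (wend G e = y \<and> bend G e = x)))"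

definition is_belyi :: "bgraph \<Rightarrow> bool" where
  "is_belyi G \<longleftrightarrow>
     finite (verts G) \<and> finite (edges G) \<and> verts G \<noteq> {} \<and>
     (\<forall>e\<in>edges G. wend G e \<in> verts G \<and> bend G e \<in> verts G \<and>
         is_white G (wend G e) \<and> \<not> is_white G (bend G e)) \<and>
     (\<forall>x\<in>verts G. \<forall>c. \<exists>!e. e \<in> edges G \<and> ecol G e = c \<and> (wend G e = x \<or> bend G e = x)) \<and>
     (\<forall>x\<in>verts G. \<forall>y\<in>verts G. (adj G UNIV)\<^sup>*\<^sup>* x y)"

text \<open>Connected components of the subgraph formed by the edges with colours in C
  (for two colours these are exactly the two-coloured cycles).\<close>
definition components :: "bgraph \<Rightarrow> colour set \<Rightarrow> nat set set" where
  "components G C = verts G // {(x, y). x \<in> verts G \<and> y \<in> verts G \<and> (adj G C)\<^sup>*\<^sup>* x y}"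

definition bdegree :: "bgraph \<Rightarrow> nat" where
  "bdegree G = card {e \<in> edges G. ecol G e = Green}"

text \<open>Type (k, l; m): k red-green cycles, l green-blue cycles, m i red-blue cycles of length 2i
  (a red-blue cycle of length 2i has exactly 2i vertices).\<close>
definition btype :: "bgraph \<Rightarrow> nat \<times> nat \<times> (nat \<Rightarrow> nat)" where
  "btype G = (card (components G {Red, Green}), card (components G {Green, Blue}),
              (\<lambda>i. card {X \<in> components G {Red, Blue}. card X = 2 * i}))"

definition is_iso :: "bgraph \<Rightarrow> bgraph \<Rightarrow> (nat \<Rightarrow> nat) \<Rightarrow> (nat \<Rightarrow> nat) \<Rightarrow> bool" where
  "is_iso G H f h \<longleftrightarrow>
     bij_betw f (verts G) (verts H) \<and> bij_betw h (edges G) (edges H) \<and>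
     (\<forall>x\<in>verts G. is_white H (f x) = is_white G x) \<and>
     (\<forall>e\<in>edges G. wend H (h e) = f (wend G e) \<and> bend H (h e) = f (bend G e) \<and>
                   ecol H (h e) = ecol G e)"

definition isomorphic :: "bgraph \<Rightarrow> bgraph \<Rightarrow> bool" where
  "isomorphic G H \<longleftrightarrow> (\<exists>f h. is_iso G H f h)"

definition Aut :: "bgraph \<Rightarrow> ((nat \<Rightarrow> nat) \<times> (nat \<Rightarrow> nat)) set" where
  "Aut G = {(f, h). f \<in> extensional (verts G) \<and> h \<in> extensional (edges G) \<and> is_iso G G f h}"

definition belyi_of_type :: "nat \<Rightarrow> nat \<Rightarrow> (nat \<Rightarrow> nat) \<Rightarrow> bgraph set" where
  "belyi_of_type k l m = {G. is_belyi G \<and> btype G = (k, l, m)}"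

definition belyi_classes :: "nat \<Rightarrow> nat \<Rightarrow> (nat \<Rightarrow> nat) \<Rightarrow> bgraph set set" where
  "belyi_classes k l m = belyi_of_type k l m // {(G, H). isomorphic G H}"

definition Ncount :: "nat \<Rightarrow> nat \<Rightarrow> (nat \<Rightarrow> nat) \<Rightarrow> real" where
  "Ncount k l m = (\<Sum>X\<in>belyi_classes k l m. 1 / real (card (Aut (SOME G. G \<in> X))))"

text \<open>Variables; T i stands for t_i (only i \<ge> 1 is meaningful).\<close>
datatype var = S | U | V | T nat

type_synonym mono = "var \<Rightarrow>\<^sub>0 nat"
type_synonym fps = "mono \<Rightarrow> real"

definition fconst :: "real \<Rightarrow> fps" where
  "fconst c = (\<lambda>\<alpha>. if \<alpha> = 0 then c else 0)"

definition fvar :: "var \<Rightarrow> fps" where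
  "fvar x = (\<lambda>\<alpha>. if \<alpha> = Poly_Mapping.single x 1 then 1 else 0)"

definition fadd :: "fps \<Rightarrow> fps \<Rightarrow> fps" where
  "fadd F G = (\<lambda>\<alpha>. F \<alpha> + G \<alpha>)"

definition fscale :: "real \<Rightarrow> fps \<Rightarrow> fps" where
  "fscale c F = (\<lambda>\<alpha>. c * F \<alpha>)"

definition fmul :: "fps \<Rightarrow> fps \<Rightarrow> fps" where
  "fmul F G = (\<lambda>\<alpha>. \<Sum>\<beta>\<in>{\<beta>. \<forall>x. Poly_Mapping.lookup \<beta> x \<le> Poly_Mapping.lookup \<alpha> x}. F \<beta> * G (\<alpha> - \<beta>))"

definition fpow :: "fps \<Rightarrow> nat \<Rightarrow> fps" where
  "fpow F n = (fmul F ^^ n) (fconst 1)"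

definition fderiv :: "var \<Rightarrow> fps \<Rightarrow> fps" where
  "fderiv x F = (\<lambda>\<alpha>. real (Poly_Mapping.lookup \<alpha> x + 1) * F (\<alpha> + Poly_Mapping.single x 1))"

definition fsum :: "('i \<Rightarrow> fps) \<Rightarrow> fps" where
  "fsum Fs = (\<lambda>\<alpha>. Sum_any (\<lambda>i. Fs i \<alpha>))"

definition fexp :: "fps \<Rightarrow> fps" where
  "fexp F = (\<lambda>\<alpha>. Sum_any (\<lambda>n. fpow F n \<alpha> / fact n))"

definition L1 :: "fps \<Rightarrow> fps" where
  "L1 F = fsum (\<lambda>i::nat. if 2 \<le> i
      then fscale (real (i - 1)) (fmul (fvar (T i)) (fderiv (T (i - 1)) F))
      else fconst 0)"

definition M1 :: "fps \<Rightarrow> fps" where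
  "M1 F = fsum (\<lambda>(i::nat, j::nat). if 2 \<le> i \<and> 1 \<le> j \<and> j \<le> i - 1
      then fadd
        (fscale (real (i - 1)) (fmul (fmul (fvar (T j)) (fvar (T (i - j)))) (fderiv (T (i - 1)) F)))
        (fscale (real (j * (i - j))) (fmul (fvar (T (i + 1))) (fderiv (T j) (fderiv (T (i - j)) F))))
      else fconst 0)"

definition Q1 :: "fps \<Rightarrow> fps" where
  "Q1 F = fsum (\<lambda>(i::nat, j::nat). if 2 \<le> i \<and> 1 \<le> j \<and> j \<le> i - 1
      then fscale (real (j * (i - j)))
             (fmul (fvar (T (i + 1))) (fmul (fderiv (T j) F) (fderiv (T (i - j)) F)))
      else fconst 0)"

definition cj_rhs :: "fps \<Rightarrow> fps" where
  "cj_rhs F = fadd (fadd (fadd (fmul (fadd (fvar U) (fvar V)) (L1 F)) (M1 F)) (Q1 F))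
                   (fmul (fmul (fvar U) (fvar V)) (fvar (T 1)))"

definition Aop :: "fps \<Rightarrow> fps" where
  "Aop G = fadd (fadd (fmul (fadd (fvar U) (fvar V)) (L1 G)) (M1 G))
                (fmul (fmul (fmul (fvar U) (fvar V)) (fvar (T 1))) G)"

definition exp_sA_one :: fps where
  "exp_sA_one = (\<lambda>\<alpha>. Sum_any (\<lambda>n. ((\<lambda>G. fmul (fvar S) (Aop G)) ^^ n) (fconst 1) \<alpha> / fact n))"

definition belyi_F :: fps where
  "belyi_F = (\<lambda>\<alpha>.
     if Poly_Mapping.lookup \<alpha> (T 0) = 0 \<and> 1 \<le> Poly_Mapping.lookup \<alpha> S \<and> 1 \<le> Poly_Mapping.lookup \<alpha> U \<and> 1 \<le> Poly_Mapping.lookup \<alpha> V \<and>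
        Sum_any (\<lambda>i. i * Poly_Mapping.lookup \<alpha> (T i)) = Poly_Mapping.lookup \<alpha> S
     then Ncount (Poly_Mapping.lookup \<alpha> U) (Poly_Mapping.lookup \<alpha> V) (\<lambda>i. Poly_Mapping.lookup \<alpha> (T i))
     else 0)"

end

theory Submission
  imports Defs "HOL-Combinatorics.Orbits"
begin

text \<open>Numbering the green edges of a Belyi graph of degree \<open>n\<close> turns it into a pair \<open>(\<sigma>, \<tau>)\<close> of permutations
  of \<open>{0..<n}\<close> generating a transitive group: the red edge at the i-th white vertex ends in black vertex
  \<open>\<sigma> i\<close>, the blue one in \<open>\<tau> i\<close>. The three kinds of two-coloured cycles are the cycles of \<open>\<sigma>\<close>, \<open>\<tau>\<close> and
  \<open>\<tau> \<sigma>\<^sup>-\<^sup>1\<close>, and by double counting of numberings \<open>F\<close> is the exponential generating function of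
  transitive pairs. Splitting off the orbit of one point shows that \<open>e\<^sup>F\<close> is the generating function \<open>Z\<close> of all
  pairs.

  Inserting a new point \<open>d\<close> replaces \<open>(\<sigma>, \<tau>)\<close> by \<open>((d a) \<sigma>, (d b) \<tau>)\<close> and, up to conjugation, \<open>\<tau> \<sigma>\<^sup>-\<^sup>1\<close>
  by \<open>\<tau> \<sigma>\<^sup>-\<^sup>1 (d a) (d b)\<close>. The cases \<open>a = b = d\<close>, exactly one of \<open>a\<close>, \<open>b\<close> equal to \<open>d\<close>, \<open>a\<close> and \<open>b\<close> in one
  cycle, and \<open>a\<close> and \<open>b\<close> in different cycles give the term \<open>u v t\<^sub>1\<close>, the operators \<open>u L\<^sub>1\<close> and
  \<open>v L\<^sub>1\<close>, and the two parts of \<open>M\<^sub>1\<close>. Hence \<open>Z\<close> satisfies the linear evolution equation, and the quadratic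
  equation for \<open>F\<close> follows by the chain rule.\<close>

section \<open>Formal power series\<close>

text \<open>Unnormalised sums over all pairs on \<open>n\<close> points are compared: they equal
  \<open>(S A)^n 1\<close> with \<open>A\<close> the operator \<open>Aop\<close>. Differential
  operators appear because an insertion chooses points, not cycles: \<open>l\<close> times the
  derivative in \<open>t_l\<close> sums over the points on cycles of length \<open>l\<close>, and a
  second derivative sums over the points of the other cycles.

  The equality \<open>Z = e^F\<close> comes from the differential equation \<open>Z' = F' Z\<close>
  in \<open>S\<close>, not from set partitions: a coefficient of positive \<open>S\<close>-degree is
  determined by those of lower degree. The quadratic equation is
  \<open>e^F F' = Z' = A Z = e^F R\<close> with \<open>R = cj_rhs F\<close>; the constant term of
  \<open>e^F\<close> is 1, so the factor can be cancelled.

  Two features of the encoding shape the proof. Infinite sums are \<open>Sum_any\<close>, which is 0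
  on infinite support, so local finiteness has to be tracked. Subtraction of exponents is truncated,
  so relations between cycle monomials are stated additively, and a difference is formed only where
  the factor is known to occur.\<close>

abbreviation (input) "lk \<equiv> Poly_Mapping.lookup"
abbreviation (input) "sg x \<equiv> Poly_Mapping.single x (1::nat)"

section \<open>Products of series as sums over splittings of a monomial\<close>

definition below :: "mono \<Rightarrow> mono set" where
  "below \<alpha> = {\<beta>. \<forall>x. lk \<beta> x \<le> lk \<alpha> x}"

lemma finite_below [simp]: "finite (below \<alpha>)"
proof -
  let ?B = "\<Union>k\<in>Poly_Mapping.keys \<alpha>. {..lk \<alpha> k}"
  have "finite {f. \<forall>x. (x \<in> Poly_Mapping.keys \<alpha> \<longrightarrow> f x \<in> ?B) \<and> (x \<notin> Poly_Mapping.keys \<alpha> \<longrightarrow> f x = 0)}"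
    by (rule finite_set_of_finite_funs) auto
  moreover have "lk ` below \<alpha> \<subseteq> {f. \<forall>x. (x \<in> Poly_Mapping.keys \<alpha> \<longrightarrow> f x \<in> ?B) \<and> (x \<notin> Poly_Mapping.keys \<alpha> \<longrightarrow> f x = 0)}"
    by (auto simp: below_def in_keys_iff) (metis le_zero_eq)
  ultimately have "finite (lk ` below \<alpha>)" by (rule rev_finite_subset)
  thus ?thesis by (rule finite_imageD) (auto simp: inj_on_def lookup_inject)
qed

lemma below_diff_add: "\<beta> \<in> below \<alpha> \<Longrightarrow> \<beta> + (\<alpha> - \<beta>) = \<alpha>"
  by (intro poly_mapping_eqI) (auto simp: below_def lookup_add lookup_minus)

lemma below_add [simp]: "\<beta> \<in> below (\<beta> + \<gamma>)"
  by (auto simp: below_def lookup_add)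

text \<open>Splitting symmetrically into \<open>\<beta> + \<gamma>\<close> avoids the truncated
  difference of \<open>fmul_def\<close>, so that commutativity and associativity become
  reindexings.\<close>

definition splits :: "mono \<Rightarrow> (mono \<times> mono) set" where
  "splits \<alpha> = {(\<beta>, \<gamma>). \<beta> + \<gamma> = \<alpha>}"

lemma splits_eq: "splits \<alpha> = (\<lambda>\<beta>. (\<beta>, \<alpha> - \<beta>)) ` below \<alpha>"
  by (force simp: splits_def below_diff_add)

lemma finite_splits [simp]: "finite (splits \<alpha>)"
  by (simp add: splits_eq)

lemma fmul_splits: "fmul F G \<alpha> = (\<Sum>(\<beta>, \<gamma>)\<in>splits \<alpha>. F \<beta> * G \<gamma>)"
  unfolding splits_eq fmul_def below_def[symmetric]
  by (subst sum.reindex) (auto simp: inj_on_def)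

lemma fmul_commute: "fmul F G = fmul G F"
proof
  fix \<alpha>
  show "fmul F G \<alpha> = fmul G F \<alpha>"
    unfolding fmul_splits
    by (rule sum.reindex_bij_witness[of _ prod.swap prod.swap]) (auto simp: splits_def add.commute)
qed

lemma fmul_assoc: "fmul (fmul F G) H = fmul F (fmul G H)"
proof
  fix \<alpha>
  have "fmul (fmul F G) H \<alpha> = (\<Sum>(p, q)\<in>(SIGMA p:splits \<alpha>. splits (fst p)). F (fst q) * G (snd q) * H (snd p))"
    by (simp add: fmul_splits sum_distrib_right case_prod_unfold sum.Sigma)
  also have "\<dots> = (\<Sum>(p, q)\<in>(SIGMA p:splits \<alpha>. splits (snd p)). F (fst p) * (G (fst q) * H (snd q)))"
    by (rule sum.reindex_bij_witness[of _
          "\<lambda>((a, b), (c, d)). ((a + c, d), (a, c))" "\<lambda>((a, b), (c, d)). ((c, d + b), (d, b))"])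
       (auto simp: splits_def add.assoc)
  also have "\<dots> = fmul F (fmul G H) \<alpha>"
    by (simp add: fmul_splits sum_distrib_left case_prod_unfold sum.Sigma)
  finally show "fmul (fmul F G) H \<alpha> = fmul F (fmul G H) \<alpha>" .
qed

lemma fmul_left_commute: "fmul F (fmul G H) = fmul G (fmul F H)"
  by (metis fmul_assoc fmul_commute)

lemmas fmul_ac = fmul_assoc fmul_commute fmul_left_commute

lemma fmul_fadd_left: "fmul (fadd F G) H = fadd (fmul F H) (fmul G H)"
  by (auto simp: fmul_def fadd_def fun_eq_iff distrib_right sum.distrib)

lemma fmul_fadd_right: "fmul H (fadd F G) = fadd (fmul H F) (fmul H G)"
  by (auto simp: fmul_def fadd_def fun_eq_iff distrib_left sum.distrib)

lemma fmul_fscale_left: "fmul (fscale c F) G = fscale c (fmul F G)"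
  by (auto simp: fmul_def fscale_def fun_eq_iff sum_distrib_left mult.assoc)

lemma fmul_fscale_right: "fmul F (fscale c G) = fscale c (fmul F G)"
  by (metis fmul_commute fmul_fscale_left)

lemma fscale_fadd: "fscale c (fadd F G) = fadd (fscale c F) (fscale c G)"
  by (auto simp: fscale_def fadd_def algebra_simps)

lemma fscale_fscale: "fscale c (fscale d F) = fscale (c * d) F"
  by (auto simp: fscale_def)

lemma fconst_0: "fconst 0 = (\<lambda>_. 0)"
  by (auto simp: fconst_def)

lemma fmul_0 [simp]: "fmul (\<lambda>_. 0) G = (\<lambda>_. 0)" "fmul G (\<lambda>_. 0) = (\<lambda>_. 0)"
  by (auto simp: fmul_def)

definition fmon :: "mono \<Rightarrow> fps" where
  "fmon \<beta> = (\<lambda>\<alpha>. if \<alpha> = \<beta> then 1 else 0)"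

lemma fvar_eq_fmon: "fvar x = fmon (sg x)"
  by (auto simp: fvar_def fmon_def)

lemma fconst_1: "fconst 1 = fmon 0"
  by (auto simp: fconst_def fmon_def)

lemma fmul_fmon: "fmul (fmon \<beta>) G \<alpha> = (if \<beta> \<in> below \<alpha> then G (\<alpha> - \<beta>) else 0)"
proof -
  have "fmul (fmon \<beta>) G \<alpha> = (\<Sum>\<gamma>\<in>below \<alpha>. if \<gamma> = \<beta> then G (\<alpha> - \<gamma>) else 0)"
    unfolding fmul_def below_def[symmetric] by (intro sum.cong) (auto simp: fmon_def)
  thus ?thesis by simp
qed

lemma fmul_fmon_add [simp]: "fmul (fmon \<beta>) G (\<beta> + \<alpha>) = G \<alpha>" "fmul (fmon \<beta>) G (\<alpha> + \<beta>) = G \<alpha>"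
  by (auto simp: fmul_fmon) (metis below_add add.commute)

lemma fmul_fmon_fmon: "fmul (fmon \<beta>) (fmon \<gamma>) = fmon (\<beta> + \<gamma>)"
proof
  fix \<alpha>
  show "fmul (fmon \<beta>) (fmon \<gamma>) \<alpha> = fmon (\<beta> + \<gamma>) \<alpha>"
  proof (cases "\<beta> \<in> below \<alpha>")
    case True
    have "\<alpha> - \<beta> = \<gamma> \<longleftrightarrow> \<alpha> = \<beta> + \<gamma>" using below_diff_add[OF True] by auto
    thus ?thesis using True by (simp add: fmul_fmon) (simp add: fmon_def)
  next
    case False
    hence "\<alpha> \<noteq> \<beta> + \<gamma>" by auto
    thus ?thesis using False by (simp add: fmul_fmon) (simp add: fmon_def)
  qed
qed

lemma fmul_1 [simp]: "fmul (fmon 0) G = G" "fmul G (fmon 0) = G"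
proof -
  show "fmul (fmon 0) G = G" using fmul_fmon_add(1)[of 0 G] by (simp add: fun_eq_iff)
  thus "fmul G (fmon 0) = G" by (simp add: fmul_commute)
qed

section \<open>Partial derivatives\<close>

lemma mono_minus_add: "lk \<beta> x \<noteq> 0 \<Longrightarrow> \<beta> - sg x + sg x = (\<beta> :: mono)"
  by (intro poly_mapping_eqI) (auto simp: lookup_add lookup_minus lookup_single when_def)

lemma fadd_commute: "fadd F G = fadd G F"
  by (auto simp: fadd_def)

text \<open>If \<open>x\<close> does not occur in \<open>\<beta>\<close>, truncated subtraction
  leaves \<open>\<beta>\<close> unchanged, but both sides are 0 in that case.\<close>

lemma fderiv_fmon: "fderiv x (fmon \<beta>) = fscale (real (lk \<beta> x)) (fmon (\<beta> - sg x))"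
proof
  fix \<alpha>
  show "fderiv x (fmon \<beta>) \<alpha> = fscale (real (lk \<beta> x)) (fmon (\<beta> - sg x)) \<alpha>"
  proof (cases "\<alpha> + sg x = \<beta>")
    case True
    hence "lk \<beta> x = lk \<alpha> x + 1" "\<alpha> = \<beta> - sg x" by (auto simp: lookup_add)
    thus ?thesis using True by (simp add: fderiv_def fscale_def fmon_def)
  next
    case False
    hence "lk \<beta> x = 0 \<or> \<alpha> \<noteq> \<beta> - sg x" using mono_minus_add by blast
    thus ?thesis using False by (auto simp: fderiv_def fscale_def fmon_def)
  qed
qed

lemma fderiv_fadd: "fderiv x (fadd F G) = fadd (fderiv x F) (fderiv x G)"
  by (auto simp: fderiv_def fadd_def algebra_simps)

lemma fderiv_fscale: "fderiv x (fscale c F) = fscale c (fderiv x F)"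
  by (auto simp: fderiv_def fscale_def)

lemma fderiv_0 [simp]: "fderiv x (\<lambda>_. 0) = (\<lambda>_. 0)"
  by (auto simp: fderiv_def)

text \<open>In a splitting of \<open>\<alpha> + sg x\<close> the exponent of \<open>x\<close> is the
  sum of its exponents in the two parts. Weighting by one of them gives the product in which that
  factor is differentiated.\<close>

lemma fderiv_fmul: "fderiv x (fmul F G) = fadd (fmul (fderiv x F) G) (fmul F (fderiv x G))"
proof
  fix \<alpha>
  let ?e = "sg x"
  have shift: "(\<Sum>(\<beta>, \<gamma>)\<in>splits (\<alpha> + ?e). real (lk \<beta> x) * (F \<beta> * G \<gamma>)) = fmul (fderiv x F) G \<alpha>" for F G
  proof -
    have "(\<Sum>(\<beta>, \<gamma>)\<in>splits (\<alpha> + ?e). real (lk \<beta> x) * (F \<beta> * G \<gamma>))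
        = (\<Sum>(\<beta>, \<gamma>)\<in>{p \<in> splits (\<alpha> + ?e). lk (fst p) x \<noteq> 0}. real (lk \<beta> x) * (F \<beta> * G \<gamma>))"
      by (rule sum.mono_neutral_right) auto
    also have "{p \<in> splits (\<alpha> + ?e). lk (fst p) x \<noteq> 0} = (\<lambda>(\<beta>, \<gamma>). (\<beta> + ?e, \<gamma>)) ` splits \<alpha>" (is "?A = ?B")
    proof (intro equalityI subsetI)
      fix p assume "p \<in> ?A"
      then obtain b c where p: "p = (b, c)" "b + c = \<alpha> + ?e" "lk b x \<noteq> 0"
        by (auto simp: splits_def)
      define b' where "b' = b - ?e"
      have b: "b = b' + ?e" using mono_minus_add[OF p(3)] by (simp add: b'_def)
      have "(b' + c) + ?e = \<alpha> + ?e" using p(2) by (simp add: b ac_simps)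
      hence "(b', c) \<in> splits \<alpha>" by (simp add: splits_def)
      thus "p \<in> ?B" using p(1) b by force
    next
      fix p assume "p \<in> ?B"
      then obtain b c where p: "p = (b + ?e, c)" "b + c = \<alpha>" by (auto simp: splits_def)
      have "b + ?e + c = \<alpha> + ?e" unfolding p(2)[symmetric] by (simp add: ac_simps)
      thus "p \<in> ?A" by (simp add: p splits_def lookup_add)
    qed
    also have "(\<Sum>(\<beta>, \<gamma>)\<in>?B. real (lk \<beta> x) * (F \<beta> * G \<gamma>))
        = (\<Sum>(\<beta>, \<gamma>)\<in>splits \<alpha>. real (lk \<beta> x + 1) * F (\<beta> + ?e) * G \<gamma>)"
      by (subst sum.reindex) (auto simp: inj_on_def lookup_add mult.assoc intro!: sum.cong)
    finally show ?thesis by (simp add: fmul_splits fderiv_def)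
  qed
  have "fderiv x (fmul F G) \<alpha> = real (lk (\<alpha> + ?e) x) * (\<Sum>(\<beta>, \<gamma>)\<in>splits (\<alpha> + ?e). F \<beta> * G \<gamma>)"
    by (simp add: fderiv_def fmul_splits lookup_add)
  also have "\<dots> = (\<Sum>(\<beta>, \<gamma>)\<in>splits (\<alpha> + ?e). real (lk \<beta> x) * (F \<beta> * G \<gamma>) + real (lk \<gamma> x) * (G \<gamma> * F \<beta>))"
    unfolding sum_distrib_left
  proof (rule sum.cong, goal_cases)
    case (2 p)
    obtain b c where p: "p = (b, c)" by force
    have bc: "\<alpha> + ?e = b + c" using 2 by (simp add: splits_def p)
    show ?case unfolding p bc by (simp add: lookup_add algebra_simps)
  qed simp
  also have "\<dots> = fmul (fderiv x F) G \<alpha> + (\<Sum>(\<beta>, \<gamma>)\<in>splits (\<alpha> + ?e). real (lk \<gamma> x) * (G \<gamma> * F \<beta>))"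
    by (simp add: case_prod_unfold sum.distrib flip: shift)
  also have "(\<Sum>(\<beta>, \<gamma>)\<in>splits (\<alpha> + ?e). real (lk \<gamma> x) * (G \<gamma> * F \<beta>))
           = (\<Sum>(\<beta>, \<gamma>)\<in>splits (\<alpha> + ?e). real (lk \<beta> x) * (G \<beta> * F \<gamma>))"
    by (rule sum.reindex_bij_witness[of _ prod.swap prod.swap]) (auto simp: splits_def add.commute)
  finally show "fderiv x (fmul F G) \<alpha> = fadd (fmul (fderiv x F) G) (fmul F (fderiv x G)) \<alpha>"
    unfolding shift fadd_def fmul_commute[of "fderiv x G" F] .
qed

section \<open>Locally finite infinite sums\<close>

text \<open>Without this condition \<open>fsum\<close> silently returns 0.\<close>
definition locfin :: "('i \<Rightarrow> fps) \<Rightarrow> bool" where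
  "locfin Fs \<longleftrightarrow> (\<forall>\<alpha>. finite {i. Fs i \<alpha> \<noteq> 0})"

lemma locfinI: "(\<And>\<alpha>. finite {i. Fs i \<alpha> \<noteq> 0}) \<Longrightarrow> locfin Fs"
  by (simp add: locfin_def)

lemma fsum_eq_sum:
  assumes "finite I" "\<And>i. i \<notin> I \<Longrightarrow> Fs i \<alpha> = 0"
  shows "fsum Fs \<alpha> = (\<Sum>i\<in>I. Fs i \<alpha>)"
  unfolding fsum_def using assms by (intro Sum_any.expand_superset) auto

lemma locfin_fmul_below: "{i. fmul F (Fs i) \<alpha> \<noteq> 0} \<subseteq> (\<Union>\<beta>\<in>below \<alpha>. {i. Fs i (\<alpha> - \<beta>) \<noteq> 0})"
  unfolding fmul_def below_def[symmetric] using sum.not_neutral_contains_not_neutral by fastforce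

text \<open>A coefficient of the product involves finitely many divisors of \<open>\<alpha>\<close>,
  each with finitely many nonzero summands. One finite index set serves them all, and the sums can
  be swapped.\<close>

lemma fmul_fsum:
  assumes "locfin Fs"
  shows "fmul F (fsum Fs) = fsum (\<lambda>i. fmul F (Fs i))"
proof
  fix \<alpha>
  let ?I = "\<Union>\<beta>\<in>below \<alpha>. {i. Fs i (\<alpha> - \<beta>) \<noteq> 0}"
  have fin: "finite ?I" using assms by (auto simp: locfin_def)
  have "fsum Fs (\<alpha> - \<beta>) = (\<Sum>i\<in>?I. Fs i (\<alpha> - \<beta>))" if "\<beta> \<in> below \<alpha>" for \<beta>
    using fin that by (intro fsum_eq_sum) auto
  hence "fmul F (fsum Fs) \<alpha> = (\<Sum>\<beta>\<in>below \<alpha>. \<Sum>i\<in>?I. F \<beta> * Fs i (\<alpha> - \<beta>))"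
    unfolding fmul_def below_def[symmetric] by (simp add: sum_distrib_left)
  also have "\<dots> = (\<Sum>i\<in>?I. fmul F (Fs i) \<alpha>)"
    by (subst sum.swap) (simp add: fmul_def below_def)
  also have "\<dots> = fsum (\<lambda>i. fmul F (Fs i)) \<alpha>"
    using fin locfin_fmul_below[of F Fs \<alpha>] by (intro fsum_eq_sum[symmetric]) auto
  finally show "fmul F (fsum Fs) \<alpha> = fsum (\<lambda>i. fmul F (Fs i)) \<alpha>" .
qed

lemma fsum_fadd:
  assumes "locfin Fs" "locfin Gs"
  shows "fsum (\<lambda>i. fadd (Fs i) (Gs i)) = fadd (fsum Fs) (fsum Gs)"
  using assms by (auto simp: fsum_def fadd_def locfin_def fun_eq_iff intro!: Sum_any.distrib)

text \<open>A nonzero constant leaves the supports unchanged, so the default value of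
  \<open>Sum_any\<close> occurs on both sides or on neither.\<close>

lemma fsum_fscale: "fsum (\<lambda>i. fscale c (Fs i)) = fscale c (fsum Fs)"
proof (cases "c = 0")
  case False
  show ?thesis
  proof
    fix \<alpha>
    have eq: "{i. c * Fs i \<alpha> \<noteq> 0} = {i. Fs i \<alpha> \<noteq> 0}" using False by auto
    show "fsum (\<lambda>i. fscale c (Fs i)) \<alpha> = fscale c (fsum Fs) \<alpha>"
      unfolding fsum_def fscale_def Sum_any.expand_set eq by (simp add: sum_distrib_left)
  qed
qed (auto simp: fsum_def fscale_def)

lemma locfin_subset:
  assumes "\<And>\<alpha>. finite (I \<alpha>)" "\<And>\<alpha> i. Fs i \<alpha> \<noteq> 0 \<Longrightarrow> i \<in> I \<alpha>"
  shows "locfin Fs"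
  by (intro locfinI finite_subset[OF _ assms(1)]) (use assms(2) in auto)

lemma locfin_fadd: "locfin Fs \<Longrightarrow> locfin Gs \<Longrightarrow> locfin (\<lambda>i. fadd (Fs i) (Gs i))"
  by (rule locfin_subset[of "\<lambda>\<alpha>. {i. Fs i \<alpha> \<noteq> 0} \<union> {i. Gs i \<alpha> \<noteq> 0}"]) (auto simp: locfin_def fadd_def)

lemma fmul_fvar_nonzero: "fmul (fvar x) G \<alpha> \<noteq> 0 \<Longrightarrow> x \<in> Poly_Mapping.keys \<alpha>"
  by (auto simp: fvar_eq_fmon fmul_fmon below_def in_keys_iff lookup_single when_def split: if_splits)

text \<open>Every summand of the operators carries some factor \<open>T i\<close>, so only indices
  controlled by this bound contribute to the coefficient at \<open>\<alpha>\<close>. The inserted 0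
  covers monomials without such a variable.\<close>

definition tmax :: "mono \<Rightarrow> nat" where
  "tmax \<alpha> = Max (insert 0 {i. T i \<in> Poly_Mapping.keys \<alpha>})"

lemma tmax: "T i \<in> Poly_Mapping.keys \<alpha> \<Longrightarrow> i \<le> tmax \<alpha>"
proof -
  have "finite (T -` Poly_Mapping.keys \<alpha>)" by (intro finite_vimageI) (auto simp: inj_on_def)
  hence "finite {i. T i \<in> Poly_Mapping.keys \<alpha>}" by (simp add: vimage_def)
  thus "T i \<in> Poly_Mapping.keys \<alpha> \<Longrightarrow> i \<le> tmax \<alpha>" unfolding tmax_def by (intro Max_ge) auto
qed

section \<open>Summands of the operators, and linearity\<close>

definition L1_term :: "fps \<Rightarrow> nat \<Rightarrow> fps" where
  "L1_term F i = (if 2 \<le> i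
      then fscale (real (i - 1)) (fmul (fvar (T i)) (fderiv (T (i - 1)) F))
      else fconst 0)"

text \<open>\<open>M1\<close> is separated by meaning: here a cycle of length \<open>i - 1\<close>,
  enlarged by the new point, falls apart into lengths \<open>j\<close> and \<open>i - j\<close>; in
  \<open>M1_join_term\<close> cycles of lengths \<open>j\<close> and \<open>i - j\<close> fuse with
  the new point into one of length \<open>i + 1\<close>.\<close>

definition M1_split_term :: "fps \<Rightarrow> nat \<times> nat \<Rightarrow> fps" where
  "M1_split_term F = (\<lambda>(i, j). if 2 \<le> i \<and> 1 \<le> j \<and> j \<le> i - 1
      then fscale (real (i - 1)) (fmul (fmul (fvar (T j)) (fvar (T (i - j)))) (fderiv (T (i - 1)) F))
      else fconst 0)"

definition M1_join_term :: "fps \<Rightarrow> nat \<times> nat \<Rightarrow> fps" where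
  "M1_join_term F = (\<lambda>(i, j). if 2 \<le> i \<and> 1 \<le> j \<and> j \<le> i - 1
      then fscale (real (j * (i - j))) (fmul (fvar (T (i + 1))) (fderiv (T j) (fderiv (T (i - j)) F)))
      else fconst 0)"

definition Q1_term :: "fps \<Rightarrow> nat \<times> nat \<Rightarrow> fps" where
  "Q1_term F = (\<lambda>(i, j). if 2 \<le> i \<and> 1 \<le> j \<and> j \<le> i - 1
      then fscale (real (j * (i - j)))
             (fmul (fvar (T (i + 1))) (fmul (fderiv (T j) F) (fderiv (T (i - j)) F)))
      else fconst 0)"

lemma locfin_L1_term: "locfin (L1_term F)"
  by (rule locfin_subset[of "\<lambda>\<alpha>. {..tmax \<alpha>}"])
     (auto simp: L1_term_def fconst_0 fscale_def split: if_splits dest!: fmul_fvar_nonzero tmax)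

lemma locfin_M1_split_term: "locfin (M1_split_term F)"
\<comment> \<open>Both \<open>T j\<close> and \<open>T (i - j)\<close> divide the monomial, which
  bounds \<open>i\<close> by twice \<open>tmax\<close>.\<close>
proof (rule locfin_subset[of "\<lambda>\<alpha>. {..2 * tmax \<alpha>} \<times> {..tmax \<alpha>}"])
  fix \<alpha> and p :: "nat \<times> nat" assume a: "M1_split_term F p \<alpha> \<noteq> 0"
  obtain i j where p: "p = (i, j)" by force
  from a p have ij: "2 \<le> i" "1 \<le> j" "j \<le> i - 1"
    and nz: "fmul (fvar (T j)) (fmul (fvar (T (i - j))) (fderiv (T (i - 1)) F)) \<alpha> \<noteq> 0"
    by (auto simp: M1_split_term_def fconst_0 fscale_def fmul_assoc split: if_splits)
  have "j \<le> tmax \<alpha>" using nz by (auto dest!: fmul_fvar_nonzero tmax)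
  moreover have "i - j \<le> tmax \<alpha>" using nz
    by (subst (asm) fmul_left_commute) (auto dest!: fmul_fvar_nonzero tmax)
  ultimately show "p \<in> {..2 * tmax \<alpha>} \<times> {..tmax \<alpha>}" using p by auto
qed auto

lemma locfin_M1_join_term: "locfin (M1_join_term F)"
  by (rule locfin_subset[of "\<lambda>\<alpha>. {..tmax \<alpha>} \<times> {..tmax \<alpha>}"])
     (auto simp: M1_join_term_def fconst_0 fscale_def split: if_splits dest!: fmul_fvar_nonzero tmax)

lemma locfin_Q1_term: "locfin (Q1_term F)"
  by (rule locfin_subset[of "\<lambda>\<alpha>. {..tmax \<alpha>} \<times> {..tmax \<alpha>}"])
     (auto simp: Q1_term_def fconst_0 fscale_def split: if_splits dest!: fmul_fvar_nonzero tmax)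

lemma L1_eq: "L1 F = fsum (L1_term F)"
  by (simp add: L1_def L1_term_def[abs_def])

lemma Q1_eq: "Q1 F = fsum (Q1_term F)"
  by (simp add: Q1_def Q1_term_def[abs_def])

lemma M1_eq: "M1 F = fadd (fsum (M1_split_term F)) (fsum (M1_join_term F))"
proof -
  have "M1 F = fsum (\<lambda>p. fadd (M1_split_term F p) (M1_join_term F p))"
    unfolding M1_def
    by (rule arg_cong[where f=fsum]) (auto simp: fun_eq_iff M1_split_term_def M1_join_term_def fadd_def fconst_0)
  thus ?thesis by (simp add: fsum_fadd locfin_M1_split_term locfin_M1_join_term)
qed

lemmas term_defs = L1_term_def M1_split_term_def M1_join_term_def Q1_term_def

lemma Aop_fadd: "Aop (fadd F G) = fadd (Aop F) (Aop G)"
proof -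
  have "L1_term (fadd F G) = (\<lambda>i. fadd (L1_term F i) (L1_term G i))"
       "M1_split_term (fadd F G) = (\<lambda>i. fadd (M1_split_term F i) (M1_split_term G i))"
       "M1_join_term (fadd F G) = (\<lambda>i. fadd (M1_join_term F i) (M1_join_term G i))"
    by (auto simp: fun_eq_iff term_defs fderiv_fadd fmul_fadd_right fscale_fadd)
       (auto simp: fadd_def fconst_0)
  thus ?thesis
    unfolding Aop_def L1_eq M1_eq
    by (simp add: fsum_fadd locfin_L1_term locfin_M1_split_term locfin_M1_join_term fmul_fadd_right)
       (simp add: fadd_def algebra_simps)
qed

lemma Aop_fscale: "Aop (fscale c F) = fscale c (Aop F)"
proof -
  have "L1_term (fscale c F) = (\<lambda>i. fscale c (L1_term F i))"
       "M1_split_term (fscale c F) = (\<lambda>i. fscale c (M1_split_term F i))"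
       "M1_join_term (fscale c F) = (\<lambda>i. fscale c (M1_join_term F i))"
    by (auto simp: fun_eq_iff term_defs fderiv_fscale fmul_fscale_right fscale_fscale mult_ac)
       (auto simp: fscale_def fconst_0)
  thus ?thesis
    unfolding Aop_def L1_eq M1_eq
    by (simp add: fsum_fscale fmul_fscale_right fscale_fadd)
qed

lemma Aop_sum:
  assumes "finite I"
  shows "Aop (\<lambda>\<alpha>. \<Sum>i\<in>I. Fs i \<alpha>) = (\<lambda>\<alpha>. \<Sum>i\<in>I. Aop (Fs i) \<alpha>)"
  using assms
proof induction
  case empty
  \<comment> \<open>Homogeneity with the constant 0 shows that the zero series goes to zero.\<close>
  have "Aop (fscale 0 (\<lambda>_. 0)) = fscale 0 (Aop (\<lambda>_. 0))" by (rule Aop_fscale)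
  thus ?case by (simp add: fscale_def)
next
  case (insert i I)
  have "(\<lambda>\<alpha>. \<Sum>i\<in>insert i I. Fs i \<alpha>) = fadd (Fs i) (\<lambda>\<alpha>. \<Sum>i\<in>I. Fs i \<alpha>)"
    using insert.hyps by (simp add: fadd_def)
  thus ?case using insert by (simp add: Aop_fadd) (simp add: fadd_def)
qed

lemma fmul_sum_right:
  "fmul F (\<lambda>\<alpha>. \<Sum>i\<in>I. Fs i \<alpha>) = (\<lambda>\<alpha>. \<Sum>i\<in>I. fmul F (Fs i) \<alpha>)"
  unfolding fmul_def by (subst sum.swap) (simp add: sum_distrib_left)

lemma fmul_sum_left:
  "fmul (\<lambda>\<alpha>. \<Sum>i\<in>I. Fs i \<alpha>) F = (\<lambda>\<alpha>. \<Sum>i\<in>I. fmul (Fs i) F \<alpha>)"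
  unfolding fmul_def by (subst sum.swap) (simp add: sum_distrib_right)

lemma Sum_any_Suc:
  assumes "g 0 = (0::real)"
  shows "Sum_any g = Sum_any (\<lambda>n. g (Suc n))"
proof -
  have "{n. g n \<noteq> 0} = Suc ` {n. g (Suc n) \<noteq> 0}"
    using assms by (auto simp: image_iff) (metis not0_implies_Suc)
  thus ?thesis by (simp add: Sum_any.expand_set sum.reindex)
qed

text \<open>The summands that are nonzero at \<open>\<alpha>\<close> after differentiation are those
  nonzero at \<open>\<alpha> + sg x\<close> before, so the default of \<open>Sum_any\<close> occurs
  on both sides together.\<close>

lemma fderiv_fsum: "fderiv x (fsum Fs) = fsum (\<lambda>i. fderiv x (Fs i))"
proof
  fix \<alpha>
  have "{i. fderiv x (Fs i) \<alpha> \<noteq> 0} = {i. Fs i (\<alpha> + sg x) \<noteq> 0}" by (auto simp: fderiv_def)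
  thus "fderiv x (fsum Fs) \<alpha> = fsum (\<lambda>i. fderiv x (Fs i)) \<alpha>"
    by (simp add: fsum_def Sum_any.expand_set) (simp add: fderiv_def sum_distrib_left)
qed

section \<open>Powers and the exponential series\<close>

lemma fpow_0: "fpow F 0 = fmon 0"
  by (simp add: fpow_def fconst_1)

lemma fpow_Suc: "fpow F (Suc n) = fmul F (fpow F n)"
  by (simp add: fpow_def)

lemma fderiv_fmon_0: "fderiv x (fmon 0) = (\<lambda>_. 0)"
  by (auto simp: fderiv_fmon fscale_def)

lemma fderiv_fpow_Suc:
  "fderiv x (fpow F (Suc n)) = fscale (real (Suc n)) (fmul (fderiv x F) (fpow F n))"
proof (induction n)
  case 0
  show ?case by (auto simp: fpow_Suc fpow_0 fscale_def)
next
  case (Suc n)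
  have "fderiv x (fpow F (Suc (Suc n))) =
      fadd (fmul (fderiv x F) (fpow F (Suc n)))
           (fmul F (fscale (real (Suc n)) (fmul (fderiv x F) (fpow F n))))"
    by (subst fpow_Suc, subst fderiv_fmul, subst Suc.IH) simp
  also have "fmul F (fscale (real (Suc n)) (fmul (fderiv x F) (fpow F n)))
      = fscale (real (Suc n)) (fmul (fderiv x F) (fpow F (Suc n)))"
    by (simp add: fmul_fscale_right fpow_Suc fmul_left_commute)
  finally show ?case by (auto simp: fadd_def fscale_def algebra_simps)
qed

text \<open>Every term of \<open>F\<close> contains \<open>S\<close>, so the \<open>n\<close>-th
  power starts in \<open>S\<close>-degree \<open>n\<close>; this makes the exponential locally
  finite.\<close>

lemma fpow_eq_0:
  assumes "\<And>\<alpha>. lk \<alpha> S = 0 \<Longrightarrow> F \<alpha> = 0" "lk \<alpha> S < n"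
  shows "fpow F n \<alpha> = 0"
  using assms(2)
proof (induction n arbitrary: \<alpha>)
  case (Suc n)
  have "F \<beta> * fpow F n \<gamma> = 0" if "(\<beta>, \<gamma>) \<in> splits \<alpha>" for \<beta> \<gamma>
  proof (cases "lk \<beta> S = 0")
    case False
    hence "lk \<gamma> S < n" using that Suc.prems by (auto simp: splits_def lookup_add)
    thus ?thesis using Suc.IH by simp
  qed (simp add: assms(1))
  thus ?case by (auto simp: fpow_Suc fmul_splits intro!: sum.neutral)
qed simp

lemma fexp_eq_fsum: "fexp F = fsum (\<lambda>n. fscale (1 / fact n) (fpow F n))"
  by (simp add: fexp_def fsum_def fscale_def)

lemma locfin_fexp:
  assumes "\<And>\<alpha>. lk \<alpha> S = 0 \<Longrightarrow> F \<alpha> = 0"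
  shows "locfin (\<lambda>n. fscale (1 / fact n) (fpow F n))"
proof (rule locfin_subset[of "\<lambda>\<alpha>. {..lk \<alpha> S}"])
  fix \<alpha> n assume "fscale (1 / fact n) (fpow F n) \<alpha> \<noteq> 0"
  thus "n \<in> {..lk \<alpha> S}"
    using fpow_eq_0[of F, OF assms] by (auto simp: fscale_def intro: leI)
qed simp

lemma fexp_S_0:
  assumes "\<And>\<alpha>. lk \<alpha> S = 0 \<Longrightarrow> F \<alpha> = 0" "lk \<alpha> S = 0"
  shows "fexp F \<alpha> = fmon 0 \<alpha>"
proof -
  have "fexp F \<alpha> = (\<Sum>n\<in>{0}. fscale (1 / fact n) (fpow F n) \<alpha>)"
    unfolding fexp_eq_fsum using assms
    by (intro fsum_eq_sum) (auto simp: fscale_def intro!: fpow_eq_0)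
  thus ?thesis by (simp add: fpow_0 fscale_def)
qed

lemma fderiv_fexp:
  assumes "\<And>\<alpha>. lk \<alpha> S = 0 \<Longrightarrow> F \<alpha> = 0"
  shows "fderiv x (fexp F) = fmul (fderiv x F) (fexp F)"
proof -
  have "fderiv x (fexp F) = fsum (\<lambda>n. fscale (1 / fact n) (fderiv x (fpow F n)))"
    by (simp add: fexp_eq_fsum fderiv_fsum fderiv_fscale)
  \<comment> \<open>The term \<open>n = 0\<close> is the derivative of a constant. Dropping it
    shifts the index, and the factor \<open>Suc n\<close> of the power rule cancels against
    \<open>fact (Suc n)\<close>.\<close>
  also have "\<dots> = fsum (\<lambda>n. fscale (1 / fact (Suc n)) (fderiv x (fpow F (Suc n))))"
    unfolding fsum_def by (rule ext, rule Sum_any_Suc) (simp add: fpow_0 fderiv_fmon_0 fscale_def)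
  also have "\<dots> = fsum (\<lambda>n. fmul (fderiv x F) (fscale (1 / fact n) (fpow F n)))"
    by (simp add: fderiv_fpow_Suc fscale_fscale fmul_fscale_right del: of_nat_Suc)
  also have "\<dots> = fmul (fderiv x F) (fexp F)"
    by (simp add: fexp_eq_fsum fmul_fsum locfin_fexp assms)
  finally show ?thesis .
qed

text \<open>A first derivative of \<open>Z = fexp F\<close> is \<open>Z\<close> times that of
  \<open>F\<close>, so first-order terms act on the exponent. A second derivative gives
  \<open>Z (F_xy + F_x F_y)\<close>, and the products \<open>F_x F_y\<close> add up to
  \<open>Q1\<close>.\<close>

lemma Aop_fexp:
  assumes "\<And>\<alpha>. lk \<alpha> S = 0 \<Longrightarrow> F \<alpha> = 0"
  shows "Aop (fexp F) = fmul (fexp F) (cj_rhs F)"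
proof -
  let ?Z = "fexp F"
  note d = fderiv_fexp[of F, OF assms]
  have "L1_term ?Z = (\<lambda>i. fmul ?Z (L1_term F i))"
    by (auto simp: fun_eq_iff L1_term_def d fmul_ac fmul_fscale_right fconst_0)
  hence L: "L1 ?Z = fmul ?Z (L1 F)" by (simp add: L1_eq fmul_fsum locfin_L1_term)
  have "M1_split_term ?Z = (\<lambda>i. fmul ?Z (M1_split_term F i))"
    by (auto simp: fun_eq_iff M1_split_term_def d fmul_ac fmul_fscale_right fconst_0)
  hence M: "fsum (M1_split_term ?Z) = fmul ?Z (fsum (M1_split_term F))"
    by (simp add: fmul_fsum locfin_M1_split_term)
  have "M1_join_term ?Z = (\<lambda>i. fmul ?Z (fadd (M1_join_term F i) (Q1_term F i)))"
  proof
    fix p :: "nat \<times> nat"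
    obtain i j where p: "p = (i, j)" by force
    have dd: "fderiv x (fderiv y ?Z) = fmul ?Z (fadd (fderiv x (fderiv y F)) (fmul (fderiv x F) (fderiv y F)))" for x y
      by (simp add: d fderiv_fmul fmul_fadd_left fmul_fadd_right fmul_ac fadd_commute)
    show "M1_join_term ?Z p = fmul ?Z (fadd (M1_join_term F p) (Q1_term F p))"
    proof (cases "2 \<le> i \<and> 1 \<le> j \<and> j \<le> i - 1")
      case True
      thus ?thesis unfolding p M1_join_term_def Q1_term_def
        by (simp add: dd fscale_fadd[symmetric] fmul_fadd_right[symmetric] fmul_fscale_right
            fmul_left_commute[of ?Z] del: of_nat_mult)
    next
      case False
      hence "M1_join_term G p = fconst 0" "Q1_term G p = fconst 0" for G
        unfolding p M1_join_term_def Q1_term_def by auto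
      moreover have "fadd (\<lambda>_. 0) (\<lambda>_. 0) = (\<lambda>_. 0)" by (simp add: fadd_def)
      ultimately show ?thesis by (simp add: fconst_0)
    qed
  qed
  hence J: "fsum (M1_join_term ?Z) = fmul ?Z (fadd (fsum (M1_join_term F)) (fsum (Q1_term F)))"
    by (simp add: fmul_fsum[symmetric] fsum_fadd locfin_fadd locfin_M1_join_term locfin_Q1_term)
  have 1: "fmul (fadd (fvar U) (fvar V)) (fmul ?Z (L1 F)) = fmul ?Z (fmul (fadd (fvar U) (fvar V)) (L1 F))"
    by (rule fmul_left_commute)
  have 2: "fmul (fmul (fmul (fvar U) (fvar V)) (fvar (T 1))) ?Z = fmul ?Z (fmul (fmul (fvar U) (fvar V)) (fvar (T 1)))"
    by (rule fmul_commute)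
  show ?thesis
    unfolding Aop_def cj_rhs_def M1_eq L M J Q1_eq 1 2 fmul_fadd_right
    by (auto simp: fadd_def fun_eq_iff)
qed

text \<open>In the coefficient at \<open>\<alpha>\<close> the summand \<open>\<beta> = 0\<close>
  isolates \<open>Z 0 * F \<alpha>\<close>; all others involve proper quotients of
  \<open>\<alpha>\<close>, which have fewer divisors.\<close>

lemma fmul_left_cancel:
  assumes "Z 0 \<noteq> 0" "fmul Z F = fmul Z G"
  shows "F = G"
proof
  fix \<alpha>
  show "F \<alpha> = G \<alpha>"
  proof (induction "card (below \<alpha>)" arbitrary: \<alpha> rule: less_induct)
    case less
    have 0: "0 \<in> below \<alpha>" by (simp add: below_def)
    have "F (\<alpha> - \<beta>) = G (\<alpha> - \<beta>)" if "\<beta> \<in> below \<alpha> - {0}" for \<beta>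
    proof (rule less, rule psubset_card_mono)
      have "\<exists>x. lk \<beta> x \<noteq> 0"
      proof (rule ccontr)
        assume "\<not> (\<exists>x. lk \<beta> x \<noteq> 0)"
        hence "\<beta> = 0" by (intro poly_mapping_eqI) simp
        thus False using that by simp
      qed
      then obtain x where "lk \<beta> x \<noteq> 0" ..
      moreover have "lk \<beta> x \<le> lk \<alpha> x" using that by (simp add: below_def)
      ultimately have "\<not> lk \<alpha> x \<le> lk (\<alpha> - \<beta>) x" by (simp add: lookup_minus)
      hence "\<alpha> \<notin> below (\<alpha> - \<beta>)" unfolding below_def by blast
      moreover have "\<alpha> \<in> below \<alpha>" by (simp add: below_def)
      moreover have "below (\<alpha> - \<beta>) \<subseteq> below \<alpha>"
        unfolding below_def lookup_minus by (auto intro: order_trans diff_le_self)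
      ultimately show "below (\<alpha> - \<beta>) \<subset> below \<alpha>" by blast
    qed simp
    moreover have "(\<Sum>\<beta>\<in>below \<alpha>. Z \<beta> * F (\<alpha> - \<beta>)) = (\<Sum>\<beta>\<in>below \<alpha>. Z \<beta> * G (\<alpha> - \<beta>))"
      using fun_cong[OF assms(2), of \<alpha>] by (simp add: fmul_def below_def)
    ultimately have "Z 0 * F \<alpha> = Z 0 * G \<alpha>"
      using 0 by (simp add: sum.remove[of "below \<alpha>" 0])
    thus ?case using assms(1) by simp
  qed
qed

section \<open>Equality modulo powers of \<open>S\<close>, and uniqueness for evolution
  equations\<close>

definition agree :: "nat \<Rightarrow> fps \<Rightarrow> fps \<Rightarrow> bool" where
  "agree n F G \<longleftrightarrow> (\<forall>\<alpha>. lk \<alpha> S \<le> n \<longrightarrow> F \<alpha> = G \<alpha>)"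

lemma agree_refl: "agree n F F"
  by (simp add: agree_def)

lemma agree_fadd: "agree n F F' \<Longrightarrow> agree n G G' \<Longrightarrow> agree n (fadd F G) (fadd F' G')"
  by (simp add: agree_def fadd_def)

lemma agree_fscale: "agree n F F' \<Longrightarrow> agree n (fscale c F) (fscale c F')"
  by (simp add: agree_def fscale_def)

lemma agree_fmul:
  assumes "agree n F F'" "agree n G G'"
  shows "agree n (fmul F G) (fmul F' G')"
  unfolding agree_def
proof (intro allI impI)
  fix \<alpha> assume a: "lk \<alpha> S \<le> n"
  show "fmul F G \<alpha> = fmul F' G' \<alpha>" unfolding fmul_splits
    using assms a by (intro sum.cong) (auto simp: splits_def agree_def lookup_add)
qed

lemma agree_fderiv: "agree n F F' \<Longrightarrow> x \<noteq> S \<Longrightarrow> agree n (fderiv x F) (fderiv x F')"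
  by (simp add: agree_def fderiv_def lookup_add lookup_single)

lemma agree_fsum: "(\<And>i. agree n (Fs i) (Gs i)) \<Longrightarrow> agree n (fsum Fs) (fsum Gs)"
  by (simp add: agree_def fsum_def)

lemma agree_operators:
  assumes "agree n F G"
  shows "agree n (L1 F) (L1 G)" "agree n (M1 F) (M1 G)" "agree n (Q1 F) (Q1 G)"
  unfolding L1_eq M1_eq Q1_eq using assms
  by (auto intro!: agree_fsum agree_fadd simp: term_defs
           intro!: agree_fscale agree_fmul agree_fderiv agree_refl)

lemma agree_cj_rhs: "agree n F G \<Longrightarrow> agree n (cj_rhs F) (cj_rhs G)"
  unfolding cj_rhs_def by (intro agree_fadd agree_fmul agree_operators agree_refl)

lemma agree_Aop: "agree n F G \<Longrightarrow> agree n (Aop F) (Aop G)"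
  unfolding Aop_def by (intro agree_fadd agree_fmul agree_operators agree_refl)

text \<open>The derivative in \<open>S\<close> determines the coefficients of degree
  \<open>n + 1\<close> from the right-hand side in degree \<open>n\<close>, and by
  \<open>loc\<close> that depends only on degrees up to \<open>n\<close>. An abstract
  \<open>\<Phi>\<close> covers both the quadratic equation for \<open>F\<close> and the linear
  equation \<open>Z' = F' Z\<close>.\<close>

lemma evolution_unique:
  assumes F: "fderiv S F = \<Phi> F" and G: "fderiv S G = \<Phi> G"
    and loc: "\<And>n. agree n F G \<Longrightarrow> agree n (\<Phi> F) (\<Phi> G)"
    and init: "\<And>\<alpha>. lk \<alpha> S = 0 \<Longrightarrow> F \<alpha> = G \<alpha>"
  shows "F = G"
proof -
  have "agree n F G" for n
  proof (induction n)
    case 0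
    show ?case using init by (simp add: agree_def)
  next
    case (Suc n)
    show ?case unfolding agree_def
    proof (intro allI impI)
      fix \<alpha> assume a: "lk \<alpha> S \<le> Suc n"
      show "F \<alpha> = G \<alpha>"
      proof (cases "lk \<alpha> S = 0")
        case False
        define \<beta> where "\<beta> = \<alpha> - sg S"
        have \<alpha>: "\<alpha> = \<beta> + sg S" using mono_minus_add[OF False] by (simp add: \<beta>_def)
        have "lk \<beta> S \<le> n" using a by (simp add: \<alpha> lookup_add)
        hence "fderiv S F \<beta> = fderiv S G \<beta>"
          using loc[OF Suc.IH] by (simp add: F G agree_def)
        thus ?thesis by (simp add: fderiv_def \<alpha>)
      qed (simp add: init)
    qed
  qed
  thus ?thesis by (auto simp: agree_def fun_eq_iff)
qed

section \<open>Orbits under multiplication by a transposition\<close>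

text \<open>Measures orbits by their cardinality instead of \<open>funpow_dist1\<close>, since cycle
  lengths are what the monomials record.\<close>

lemma funpow_orbit_bij:
  assumes "permutation f"
  shows "bij_betw (\<lambda>n. (f ^^ n) x) {0..<card (orbit f x)} (orbit f x)"
    and "(f ^^ card (orbit f x)) x = x" and "0 < card (orbit f x)"
proof -
  let ?n = "funpow_dist1 f x x"
  have x: "x \<in> orbit f x" by (rule permutation_self_in_orbit[OF assms])
  have bij: "bij_betw (\<lambda>n. (f ^^ n) x) {0..<?n} (orbit f x)"
    using inj_on_funpow_dist1[OF x] orbit_conv_funpow_dist1[OF x] by (simp add: bij_betw_def)
  have n: "card (orbit f x) = ?n" using bij_betw_same_card[OF bij] by simp
  show "bij_betw (\<lambda>n. (f ^^ n) x) {0..<card (orbit f x)} (orbit f x)" unfolding n by (rule bij)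
  show "(f ^^ card (orbit f x)) x = x" unfolding n by (rule funpow_dist1_prop[OF x])
  show "0 < card (orbit f x)" unfolding n by simp
qed

lemma in_orbit_funpow:
  assumes "permutation f" "y \<in> orbit f x"
  obtains j where "j < card (orbit f x)" "(f ^^ j) x = y"
proof -
  have "y \<in> (\<lambda>n. (f ^^ n) x) ` {0..<card (orbit f x)}"
    using funpow_orbit_bij(1)[OF assms(1), of x] assms(2) by (simp add: bij_betw_def)
  thus ?thesis using that by auto
qed

lemma orbit_of_cycle:
  assumes "0 < n" "\<And>i. i < n \<Longrightarrow> f (c i) = c (Suc i)" "c n = c 0"
  shows "orbit f (c 0) = c ` {..<n}"
proof -
  have pow: "(f ^^ i) (c 0) = c i" if "i \<le> n" for i
    using that by (induction i) (auto simp: assms(2))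
  show ?thesis
    using orbit_altdef_bounded[of n f "c 0"] pow assms(1,3) by (auto simp: image_iff) (metis less_imp_le)
qed

lemma orbit_eqI_permutation: "permutation f \<Longrightarrow> y \<in> orbit f x \<Longrightarrow> orbit f y = orbit f x"
  by (rule orbit_cyclic_eq3) (rule cyclic_on_orbit')

lemma orbit_disjoint: "permutation f \<Longrightarrow> orbit f x \<inter> orbit f y \<noteq> {} \<Longrightarrow> orbit f x = orbit f y"
  using orbit_eqI_permutation by (metis disjoint_iff)

lemma orbit_transpose_other:
  assumes "permutation f" "x \<notin> orbit f z" "y \<notin> orbit f z"
  shows "orbit (f \<circ> Transposition.transpose x y) z = orbit f z"
  using assms(2,3)
  by (intro orbit_cong permutation_self_in_orbit assms(1)) (auto simp: transpose_def)

text \<open>On the cycle \<open>x, f x, ..., f^j x = y, ...\<close> of length \<open>n\<close> the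
  map \<open>g\<close> sends \<open>y\<close> to \<open>f x\<close> and \<open>x\<close> to
  \<open>f y\<close> and otherwise follows \<open>f\<close>. So the arc from \<open>f x\<close> to
  \<open>y\<close>, of length \<open>j\<close>, and the arc from \<open>f y\<close> to
  \<open>x\<close>, of length \<open>n - j\<close>, close up separately.\<close>

lemma orbit_transpose_split:
  assumes f: "permutation f" and xy: "x \<noteq> y" and j: "(f ^^ j) x = y" "j < card (orbit f x)"
  defines "g \<equiv> f \<circ> Transposition.transpose x y"
  shows "orbit g x \<union> orbit g y = orbit f x" "orbit g x \<inter> orbit g y = {}"
        "card (orbit g y) = j" "card (orbit g x) = card (orbit f x) - j"
proof -
  let ?n = "card (orbit f x)"
  have n: "(f ^^ ?n) x = x" and bij: "bij_betw (\<lambda>n. (f ^^ n) x) {0..<?n} (orbit f x)"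
    using funpow_orbit_bij[OF f] by auto
  have g_perm: "permutation g"
    unfolding g_def by (intro permutation_compose f permutation_swap_id)
  have inj: "(f ^^ i) x = (f ^^ k) x \<Longrightarrow> i < ?n \<Longrightarrow> k < ?n \<Longrightarrow> i = k" for i k
    using bij by (auto simp: bij_betw_def inj_on_def)
  have j0: "0 < j" using j xy by (cases j) auto
  have g1: "g ((f ^^ i) x) = (f ^^ Suc i) x" if "0 < i" "i < ?n" "i \<noteq> j" for i
  proof -
    have "(f ^^ i) x \<noteq> x" using inj[of i 0] that by auto
    moreover have "(f ^^ i) x \<noteq> y" using inj[of i j] that j by auto
    ultimately show ?thesis by (simp add: g_def)
  qed
  have gy: "g y = f x" and gx: "g x = (f ^^ Suc j) x" using j by (simp_all add: g_def)
  \<comment> \<open>The arc from \<open>f x\<close> to \<open>y\<close>, made periodic by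
    \<open>mod\<close> so that it closes up as \<open>orbit_of_cycle\<close> requires.\<close>
  define c where "c = (\<lambda>i. (f ^^ (Suc (i mod j))) x)"
  have "orbit g (c 0) = c ` {..<j}"
  proof (rule orbit_of_cycle)
    fix i assume i: "i < j"
    show "g (c i) = c (Suc i)"
    proof (cases "Suc i = j")
      case True
      thus ?thesis using i j gy by (simp add: c_def) (metis funpow.simps(2) o_apply)
    next
      case False
      thus ?thesis using i j g1[of "Suc i"] by (simp add: c_def)
    qed
  qed (use j0 in \<open>auto simp: c_def\<close>)
  also have "c ` {..<j} = (\<lambda>n. (f ^^ n) x) ` {0<..j}"
  proof -
    have "c ` {..<j} = (\<lambda>n. (f ^^ n) x) ` (Suc ` {..<j})"
      unfolding image_image by (rule image_cong) (auto simp: c_def)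
    also have "Suc ` {..<j} = {0<..j}" by (auto simp: image_Suc_lessThan)
    finally show ?thesis .
  qed
  also have "c 0 = g y" using j0 by (simp add: c_def gy)
  finally have Oy: "orbit g y = (\<lambda>n. (f ^^ n) x) ` {0<..j}"
    using permutation_orbit_step[OF g_perm] by simp
  \<comment> \<open>The complementary arc, from \<open>f y\<close> to
    \<open>f^n x = x\<close>.\<close>
  define c' where "c' = (\<lambda>i. (f ^^ (Suc j + i mod (?n - j))) x)"
  have "orbit g (c' 0) = c' ` {..<?n - j}"
  proof (rule orbit_of_cycle)
    fix i assume i: "i < ?n - j"
    show "g (c' i) = c' (Suc i)"
    proof (cases "Suc i = ?n - j")
      case True
      hence "?n = Suc j + i" using i by simp
      moreover have "c' i = (f ^^ (Suc j + i)) x" "c' (Suc i) = (f ^^ Suc j) x"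
        using True i by (simp_all add: c'_def del: funpow.simps)
      ultimately have "c' i = (f ^^ ?n) x" "c' (Suc i) = (f ^^ Suc j) x" by simp_all
      thus ?thesis using n gx by simp
    next
      case False
      hence "c' i = (f ^^ (Suc j + i)) x" "c' (Suc i) = (f ^^ Suc (Suc j + i)) x"
        using i by (simp_all add: c'_def del: funpow.simps)
      thus ?thesis using i False g1[of "Suc j + i"] by simp
    qed
  qed (use j in \<open>auto simp: c'_def\<close>)
  also have "c' ` {..<?n - j} = (\<lambda>n. (f ^^ n) x) ` {j<..?n}"
  proof -
    have "c' ` {..<?n - j} = (\<lambda>n. (f ^^ n) x) ` ((\<lambda>i. Suc j + i) ` {..<?n - j})"
      unfolding image_image by (rule image_cong) (auto simp: c'_def)
    also have "(\<lambda>i. Suc j + i) ` {..<?n - j} = {j<..?n}"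
    proof -
      have "(\<lambda>i. Suc j + i) ` {0..<?n - j} = {Suc j..<Suc ?n}"
        using j(2) by (subst image_add_atLeastLessThan) simp
      thus ?thesis by (simp only: lessThan_atLeast0 atLeastLessThanSuc_atLeastAtMost atLeastSucAtMost_greaterThanAtMost)
    qed
    finally show ?thesis .
  qed
  also have "c' 0 = g x" using j by (simp add: c'_def gx)
  finally have Ox: "orbit g x = (\<lambda>n. (f ^^ n) x) ` {j<..?n}"
    using permutation_orbit_step[OF g_perm] by simp
  \<comment> \<open>The two arcs use the exponents 1 to \<open>n\<close>, with \<open>n\<close>
    instead of 0 standing for \<open>x\<close>; injectivity is transferred by reduction modulo
    \<open>n\<close>.\<close>
  have inj': "inj_on (\<lambda>n. (f ^^ n) x) {0<..?n}"
  proof (rule inj_onI)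
    fix i k assume a: "i \<in> {0<..?n}" "k \<in> {0<..?n}" "(f ^^ i) x = (f ^^ k) x"
    have "(f ^^ (i mod ?n)) x = (f ^^ (k mod ?n)) x" using a n by (simp add: funpow_mod_eq)
    hence "i mod ?n = k mod ?n" using a by (intro inj) auto
    thus "i = k" using a by (cases "i = ?n"; cases "k = ?n") auto
  qed
  have im: "(\<lambda>n. (f ^^ n) x) ` {0<..?n} = orbit f x"
  proof -
    have "{0<..?n} = insert ?n {0<..<?n}" "{0..<?n} = insert 0 {0<..<?n}"
      using j0 j by auto
    thus ?thesis using bij_betw_imp_surj_on[OF bij] n by simp
  qed
  have s: "{0<..?n} = {j<..?n} \<union> {0<..j}" using j by auto
  show "orbit g x \<union> orbit g y = orbit f x" using im unfolding s Ox Oy image_Un .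
  have sub: "{j<..?n} \<subseteq> {0<..?n}" "{0<..j} \<subseteq> {0<..?n}" "{j<..?n} \<inter> {0<..j} = {}"
    using j by auto
  show "orbit g x \<inter> orbit g y = {}" unfolding Ox Oy
    using inj_on_image_Int[OF inj' sub(1,2)] sub(3) by simp
  have "inj_on (\<lambda>n. (f ^^ n) x) {0<..j}" "inj_on (\<lambda>n. (f ^^ n) x) {j<..?n}"
    using inj' j by (auto elim!: inj_on_subset)
  thus "card (orbit g y) = j" "card (orbit g x) = ?n - j" by (simp_all add: Ox Oy card_image)
qed

text \<open>Composing with the transposition once more gives back \<open>f\<close>, so this is the
  splitting of a cycle of \<open>g\<close> read backwards. It remains to see that \<open>y\<close>
  lies on the \<open>g\<close>-cycle of \<open>x\<close>: from \<open>x\<close> the map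
  \<open>g\<close> enters the other cycle at \<open>f y\<close> and follows it up to
  \<open>y\<close>.\<close>

lemma orbit_transpose_merge:
  assumes f: "permutation f" and y: "y \<notin> orbit f x"
  defines "g \<equiv> f \<circ> Transposition.transpose x y"
  shows "orbit g x = orbit f x \<union> orbit f y" "orbit g y = orbit g x" "orbit f x \<inter> orbit f y = {}"
proof -
  have xy: "x \<noteq> y" using y permutation_self_in_orbit[OF f] by auto
  show disj: "orbit f x \<inter> orbit f y = {}"
    using orbit_disjoint[OF f] y permutation_self_in_orbit[OF f] by blast
  have g_perm: "permutation g"
    unfolding g_def by (intro permutation_compose f permutation_swap_id)
  let ?b = "card (orbit f y)"
  have pow: "(g ^^ k) x = (f ^^ k) y" if "0 < k" "k \<le> ?b" for k
    using that
  proof (induction k)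
    case (Suc k)
    show ?case
    proof (cases "k = 0")
      case False
      have "(f ^^ k) y \<in> orbit f y" using False by (auto simp: orbit_altdef)
      hence "(f ^^ k) y \<noteq> x" using disj permutation_self_in_orbit[OF f] by auto
      moreover have "(f ^^ k) y \<noteq> y"
      proof
        assume "(f ^^ k) y = y"
        hence "(f ^^ k) y = (f ^^ 0) y" by simp
        moreover have "inj_on (\<lambda>n. (f ^^ n) y) {0..<?b}"
          using funpow_orbit_bij(1)[OF f] by (simp add: bij_betw_def)
        ultimately have "k = 0"
          using Suc.prems inj_on_eq_iff[of "\<lambda>n. (f ^^ n) y" "{0..<?b}" k 0] by simp
        thus False using False by simp
      qed
      ultimately have "g ((f ^^ k) y) = f ((f ^^ k) y)" by (simp add: g_def)
      moreover have "(g ^^ k) x = (f ^^ k) y" using Suc False by simp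
      ultimately show ?thesis by simp
    qed (simp add: g_def)
  qed simp
  have "y \<in> orbit g x"
  proof -
    have "(g ^^ ?b) x = y" using pow[of ?b] funpow_orbit_bij(2,3)[OF f, of y] by simp
    moreover have "(g ^^ ?b) x \<in> orbit g x"
      unfolding orbit_altdef[of g] using funpow_orbit_bij(3)[OF f, of y] by blast
    ultimately show ?thesis by simp
  qed
  then obtain j where j: "j < card (orbit g x)" "(g ^^ j) x = y"
    by (rule in_orbit_funpow[OF g_perm])
  have "g \<circ> Transposition.transpose x y = f"
    by (simp add: g_def comp_assoc)
  thus "orbit g x = orbit f x \<union> orbit f y" using orbit_transpose_split(1)[OF g_perm xy j(2,1)] by simp
  show "orbit g y = orbit g x" by (rule orbit_eqI_permutation[OF g_perm \<open>y \<in> orbit g x\<close>])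
qed

text \<open>Fixed points count as cycles of length 1, since their orbit is a singleton.\<close>

definition orbs :: "('a \<Rightarrow> 'a) \<Rightarrow> 'a set \<Rightarrow> 'a set set" where
  "orbs f X = orbit f ` X"

lemma finite_orbs [simp]: "finite X \<Longrightarrow> finite (orbs f X)"
  by (simp add: orbs_def)

lemma orbs_remove:
  assumes "permutation f" "x \<in> X" "y \<in> X"
  shows "orbs f X = insert (orbit f x) (insert (orbit f y) (orbs f {z \<in> X. z \<notin> orbit f x \<union> orbit f y}))"
    (is "_ = ?B")
proof (intro equalityI subsetI)
  fix A assume "A \<in> orbs f X"
  then obtain z where z: "z \<in> X" "A = orbit f z" by (auto simp: orbs_def)
  show "A \<in> ?B"
  proof (cases "z \<in> orbit f x \<union> orbit f y")
    case True
    hence "A = orbit f x \<or> A = orbit f y" unfolding z(2) using orbit_eqI_permutation[OF assms(1)] by blast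
    thus ?thesis by blast
  next
    case False
    hence "A \<in> orbs f {z \<in> X. z \<notin> orbit f x \<union> orbit f y}"
      unfolding z(2) orbs_def using z(1) by (intro imageI) simp
    thus ?thesis by blast
  qed
next
  fix A assume "A \<in> ?B"
  thus "A \<in> orbs f X" using assms(2,3) by (fastforce simp: orbs_def)
qed

text \<open>The weight \<open>h\<close> is arbitrary because two instances are needed: the constant
  1 counts cycles, and \<open>tm (card A)\<close> yields the cycle monomial. The additive form makes
  sense in a monoid without subtraction.\<close>

lemma sum_orbs_transpose_merge:
  fixes h :: "'a set \<Rightarrow> 'b::comm_monoid_add"
  assumes f: "permutation f" and X: "finite X" "x \<in> X" "y \<in> X" and y: "y \<notin> orbit f x"
  defines "g \<equiv> f \<circ> Transposition.transpose x y"
  shows "sum h (orbs g X) + h (orbit f x) + h (orbit f y) = sum h (orbs f X) + h (orbit f x \<union> orbit f y)"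
proof -
  note m = orbit_transpose_merge[OF f y, folded g_def]
  have g_perm: "permutation g"
    unfolding g_def by (intro permutation_compose f permutation_swap_id)
  let ?X' = "{z \<in> X. z \<notin> orbit f x \<union> orbit f y}"
  have "orbit g z = orbit f z" if "z \<in> ?X'" for z
    unfolding g_def
  proof (rule orbit_transpose_other[OF f])
    have "z \<in> orbit f w" if "w \<in> orbit f z" for w
      using orbit_eqI_permutation[OF f that] permutation_self_in_orbit[OF f, of z] by simp
    thus "x \<notin> orbit f z" "y \<notin> orbit f z" using that by blast+
  qed
  hence "orbs g ?X' = orbs f ?X'" unfolding orbs_def by (rule image_cong[OF refl])
  hence g: "orbs g X = insert (orbit f x \<union> orbit f y) (orbs f ?X')"
    using orbs_remove[OF g_perm X(2,3)] m by simp
  have f': "orbs f X = insert (orbit f x) (insert (orbit f y) (orbs f ?X'))"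
    by (rule orbs_remove[OF f X(2,3)])
  have 1: "orbit f x \<notin> insert (orbit f y) (orbs f ?X')" "orbit f y \<notin> orbs f ?X'"
  proof -
    have "orbit f x \<noteq> orbit f z" "orbit f y \<noteq> orbit f z" if "z \<in> ?X'" for z
      using that permutation_self_in_orbit[OF f, of z] by blast+
    moreover have "orbit f x \<noteq> orbit f y" using y permutation_self_in_orbit[OF f, of y] by blast
    ultimately show "orbit f x \<notin> insert (orbit f y) (orbs f ?X')" "orbit f y \<notin> orbs f ?X'"
      unfolding orbs_def by blast+
  qed
  have 2: "orbit f x \<union> orbit f y \<notin> orbs f ?X'"
  proof -
    have "orbit f x \<union> orbit f y \<noteq> orbit f z" if "z \<in> ?X'" for z
      using that permutation_self_in_orbit[OF f, of z] by blast
    thus ?thesis unfolding orbs_def by blast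
  qed
  show ?thesis unfolding g f' using 1 2 X(1) by (simp add: ac_simps)
qed

text \<open>The merging identity applied to \<open>g\<close>, whose product with the transposition
  is \<open>f\<close>.\<close>

lemma sum_orbs_transpose_split:
  fixes h :: "'a set \<Rightarrow> 'b::comm_monoid_add"
  assumes f: "permutation f" and X: "finite X" "x \<in> X" "y \<in> X"
    and xy: "x \<noteq> y" and j: "(f ^^ j) x = y" "j < card (orbit f x)"
  defines "g \<equiv> f \<circ> Transposition.transpose x y"
  shows "sum h (orbs g X) + h (orbit f x) = sum h (orbs f X) + h (orbit g x) + h (orbit g y)"
proof -
  note s = orbit_transpose_split[OF f xy j, folded g_def]
  have g_perm: "permutation g"
    unfolding g_def by (intro permutation_compose f permutation_swap_id)
  have y: "y \<notin> orbit g x" using s(2) permutation_self_in_orbit[OF g_perm] by auto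
  have "g \<circ> Transposition.transpose x y = f"
    by (simp add: g_def comp_assoc)
  thus ?thesis using sum_orbs_transpose_merge[OF g_perm X y, of h] s(1) by simp
qed

lemma permutes_permutation: "f permutes X \<Longrightarrow> finite X \<Longrightarrow> permutation f"
  by (auto simp: permutation_permutes)

lemma orbit_fixed: "f x = x \<Longrightarrow> orbit f x = {x}"
  by (simp add: orbit_eq_singleton_iff)

lemma sum_orbs_insert_fixed:
  assumes "f permutes X" "finite X" "d \<notin> X"
  shows "sum h (orbs f (insert d X)) = h {d} + sum h (orbs f X)"
proof -
  have "orbit f d = {d}" using assms by (intro orbit_fixed) (simp add: permutes_not_in)
  moreover have "{d} \<notin> orbs f X"
    using permutes_orbit_subset[OF assms(1)] assms(3) by (auto simp: orbs_def)
  ultimately show ?thesis using assms(2) by (simp add: orbs_def)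
qed

text \<open>An injection that intertwines the two maps carries cycles to cycles; it will be a
  conjugating transposition.\<close>

lemma sum_orbs_image:
  assumes "permutation f" "inj_on c X" "\<And>x. x \<in> X \<Longrightarrow> orbit f x \<subseteq> X"
    "\<And>x. x \<in> X \<Longrightarrow> f' (c x) = c (f x)"
  shows "sum h (orbs f' (c ` X)) = sum (\<lambda>A. h (c ` A)) (orbs f X)"
proof -
  have "orbit f' (c x) = c ` orbit f x" if "x \<in> X" for x
    by (rule orbit_inverse[symmetric]) (use assms that permutation_self_in_orbit in \<open>auto\<close>)
  hence "orbs f' (c ` X) = image c ` orbs f X"
    by (auto simp: orbs_def image_image)
  moreover have "inj_on (image c) (orbs f X)"
    using assms(3) by (intro inj_on_subset[OF inj_on_image_Pow[OF assms(2)]]) (auto simp: orbs_def)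
  ultimately show ?thesis by (simp add: sum.reindex)
qed

lemma orbs_inv: "permutation f \<Longrightarrow> orbs (inv f) X = orbs f X"
  by (simp add: orbs_def orbit_inv_eq)

section \<open>Inserting a point into a pair of permutations\<close>

abbreviation (input) "tsp \<equiv> Transposition.transpose"

abbreviation (input) "tm i \<equiv> sg (T i)"

lemma fscale_apply: "fscale c F \<alpha> = c * F \<alpha>"
  by (simp add: fscale_def)

lemma fadd_apply: "fadd F G \<alpha> = F \<alpha> + G \<alpha>"
  by (simp add: fadd_def)

section \<open>Weights of pairs of permutations\<close>

definition cyc_mono :: "('a \<Rightarrow> 'a) \<Rightarrow> 'a set \<Rightarrow> mono" where
  "cyc_mono f X = (\<Sum>A\<in>orbs f X. tm (card A))"

text \<open>The exponents are the degree and the type of the graph that the pair encodes, as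
  \<open>btype_eq\<close> shows.\<close>

definition wt :: "'a set \<Rightarrow> ('a \<Rightarrow> 'a) \<Rightarrow> ('a \<Rightarrow> 'a) \<Rightarrow> mono" where
  "wt X \<sigma> \<tau> = Poly_Mapping.single S (card X) + Poly_Mapping.single U (card (orbs \<sigma> X))
     + Poly_Mapping.single V (card (orbs \<tau> X)) + cyc_mono (\<tau> \<circ> inv \<sigma>) X"

definition all_pairs :: "'a set \<Rightarrow> fps" where
  "all_pairs X = (\<lambda>\<alpha>. \<Sum>\<sigma> | \<sigma> permutes X. \<Sum>\<tau> | \<tau> permutes X. fmon (wt X \<sigma> \<tau>) \<alpha>)"

lemma lookup_cyc_mono_T:
  assumes "finite X"
  shows "lk (cyc_mono f X) (T i) = card {A \<in> orbs f X. card A = i}"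
proof -
  have "lk (cyc_mono f X) (T i) = (\<Sum>A\<in>orbs f X. if card A = i then 1 else 0)"
    by (auto simp: cyc_mono_def lookup_sum lookup_single when_def intro!: sum.cong)
  also have "\<dots> = card {A \<in> orbs f X. card A = i}"
    using assms by (simp add: sum.If_cases Int_def)
  finally show ?thesis .
qed

lemma lookup_cyc_mono_other: "(\<And>i. x \<noteq> T i) \<Longrightarrow> lk (cyc_mono f X) x = 0"
  unfolding cyc_mono_def lookup_sum
  by (rule sum.neutral) (metis lookup_single_not_eq)

lemma lookup_wt:
  assumes "finite X"
  shows "lk (wt X \<sigma> \<tau>) S = card X" "lk (wt X \<sigma> \<tau>) U = card (orbs \<sigma> X)"
    "lk (wt X \<sigma> \<tau>) V = card (orbs \<tau> X)"
    "lk (wt X \<sigma> \<tau>) (T i) = card {A \<in> orbs (\<tau> \<circ> inv \<sigma>) X. card A = i}"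
  using assms by (simp_all add: wt_def lookup_add lookup_single lookup_cyc_mono_other lookup_cyc_mono_T)

text \<open>The merging identity is about composition on the right, so it is applied to the inverse
  of \<open>f\<close>, which has the same orbits. For \<open>a = d\<close> the transposition is the
  identity and \<open>d\<close> is a new cycle of its own.\<close>

lemma card_orbs_insert:
  assumes "f permutes X" "finite X" "d \<notin> X" "a \<in> insert d X"
  shows "card (orbs (tsp d a \<circ> f) (insert d X)) = card (orbs f X) + (if a = d then 1 else 0)"
proof -
  have f: "permutation f" by (rule permutes_permutation[OF assms(1,2)])
  have ins: "card (orbs f (insert d X)) = card (orbs f X) + 1"
    using sum_orbs_insert_fixed[OF assms(1-3), of "\<lambda>_. 1 :: nat"] by simp
  show ?thesis
  proof (cases "a = d")
    case False
    let ?f = "inv f"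
    have f': "permutation ?f" by (rule permutation_inverse[OF f])
    have "inv (tsp d a \<circ> f) = ?f \<circ> tsp d a"
      using f by (subst o_inv_distrib) (auto simp: permutation_bijective)
    moreover have "permutation (tsp d a \<circ> f)"
      by (intro permutation_compose f permutation_swap_id)
    ultimately have 1: "orbs (tsp d a \<circ> f) (insert d X) = orbs (?f \<circ> tsp d a) (insert d X)"
      by (metis orbs_inv)
    have "orbit ?f d = {d}"
      using assms(1,3) by (intro orbit_fixed) (rule permutes_not_in[OF permutes_inv])
    hence "a \<notin> orbit ?f d" using False by simp
    from sum_orbs_transpose_merge[OF f' _ _ assms(4) this, of "\<lambda>_. 1 :: nat"]
    show ?thesis using False ins assms(2) by (simp add: 1 orbs_inv[OF f])
  qed (simp add: ins)
qed

text \<open>Conjugation by \<open>tsp d b\<close> preserves cycle lengths and moves this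
  transposition to the right end, where the splitting and merging identities apply.\<close>

lemma cyc_mono_transpose_conj:
  assumes "f permutes X" "finite X" "a \<in> insert d X" "b \<in> insert d X"
  shows "cyc_mono (tsp d b \<circ> f \<circ> tsp d a) (insert d X) = cyc_mono (f \<circ> tsp d a \<circ> tsp d b) (insert d X)"
proof -
  let ?X = "insert d X" and ?c = "tsp d b" and ?g = "f \<circ> tsp d a \<circ> tsp d b"
  have "f permutes ?X" by (rule permutes_imp_permutes_insert[OF assms(1)])
  hence g: "?g permutes ?X"
    using assms(3,4) by (intro permutes_compose permutes_swap_id) auto
  have c: "?c permutes ?X" using assms(4) by (intro permutes_swap_id) auto
  have "cyc_mono (?c \<circ> f \<circ> tsp d a) (?c ` ?X) = (\<Sum>A\<in>orbs ?g ?X. tm (card (?c ` A)))"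
    unfolding cyc_mono_def
  proof (rule sum_orbs_image)
    show "permutation ?g" by (rule permutes_permutation[OF g]) (use assms(2) in simp)
    show "inj_on ?c ?X" by (rule inj_on_subset[OF permutes_inj[OF c]]) simp
    show "orbit ?g x \<subseteq> ?X" if "x \<in> ?X" for x by (rule permutes_orbit_subset[OF g that])
    show "(?c \<circ> f \<circ> tsp d a) (?c x) = ?c (?g x)" for x by simp
  qed
  also have "\<dots> = cyc_mono ?g ?X"
    unfolding cyc_mono_def
    by (intro sum.cong refl) (simp add: card_image inj_on_subset[OF permutes_inj[OF c]])
  finally show ?thesis using permutes_image[OF c] by simp
qed

section \<open>The cycle monomial after inserting one point\<close>

context
  fixes f :: "'a \<Rightarrow> 'a" and X d
  assumes f: "f permutes X" and X: "finite X" and d: "d \<notin> X"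
begin

private abbreviation "len a \<equiv> card (orbit f a)"

lemma orbit_new_point: "orbit f d = {d}"
  using f d by (intro orbit_fixed) (simp add: permutes_not_in)

lemma orbit_subset_carrier: "a \<in> X \<Longrightarrow> orbit f a \<subseteq> X"
  using f by (rule permutes_orbit_subset)

lemma card_orbit_bounds: "a \<in> X \<Longrightarrow> 1 \<le> len a \<and> len a \<le> card X"
  using orbit_subset_carrier X funpow_orbit_bij(3)[OF permutes_permutation[OF f X], of a]
  by (auto intro: card_mono simp: Suc_le_eq)

lemma cyc_mono_fixed: "cyc_mono f (insert d X) = cyc_mono f X + tm 1"
  unfolding cyc_mono_def by (subst sum_orbs_insert_fixed[OF f X d]) (simp add: add.commute)

text \<open>The point \<open>d\<close> starts as a cycle of length 1, and \<open>tsp d a\<close>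
  merges it into the cycle of \<open>a\<close>, which becomes longer by one.\<close>

lemma cyc_mono_insert:
  assumes "a \<in> X"
  shows "cyc_mono (f \<circ> tsp d a) (insert d X) + tm (len a) = cyc_mono f X + tm (len a + 1)"
proof -
  have a: "a \<notin> orbit f d" using assms d by (auto simp: orbit_new_point)
  have "d \<notin> orbit f a" using orbit_subset_carrier[OF assms] d by auto
  moreover have "finite (orbit f a)" using orbit_subset_carrier[OF assms] X by (rule finite_subset)
  ultimately have "card (orbit f d \<union> orbit f a) = len a + 1" by (simp add: orbit_new_point)
  moreover have "cyc_mono (f \<circ> tsp d a) (insert d X) + tm (card (orbit f d)) + tm (len a)
      = cyc_mono f (insert d X) + tm (card (orbit f d \<union> orbit f a))"
    unfolding cyc_mono_def
    by (rule sum_orbs_transpose_merge) (use permutes_permutation[OF f X] X assms a in auto)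
  ultimately have "(cyc_mono (f \<circ> tsp d a) (insert d X) + tm (len a)) + tm 1
      = (cyc_mono f X + tm (len a + 1)) + tm 1"
    by (simp add: orbit_new_point cyc_mono_fixed add_ac)
  thus ?thesis by (simp only: add_right_cancel)
qed

lemma orbit_insert:
  assumes "a \<in> X"
  shows "orbit (f \<circ> tsp d a) d = insert d (orbit f a)" "orbit (f \<circ> tsp d a) a = insert d (orbit f a)"
    "b \<in> X \<Longrightarrow> b \<notin> orbit f a \<Longrightarrow> orbit (f \<circ> tsp d a) b = orbit f b"
proof -
  have a: "a \<notin> orbit f d" using assms d by (auto simp: orbit_new_point)
  show 1: "orbit (f \<circ> tsp d a) d = insert d (orbit f a)"
    using orbit_transpose_merge(1)[OF permutes_permutation[OF f X] a] by (simp add: orbit_new_point)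
  show "orbit (f \<circ> tsp d a) a = insert d (orbit f a)"
    using orbit_transpose_merge(2)[OF permutes_permutation[OF f X] a] by (simp add: 1)
  assume b: "b \<in> X" "b \<notin> orbit f a"
  show "orbit (f \<circ> tsp d a) b = orbit f b"
  proof (rule orbit_transpose_other[OF permutes_permutation[OF f X]])
    show "d \<notin> orbit f b" using orbit_subset_carrier[OF b(1)] d by auto
    show "a \<notin> orbit f b"
      using b(2) orbit_eqI_permutation[OF permutes_permutation[OF f X], of a b]
        permutation_self_in_orbit[OF permutes_permutation[OF f X], of b] by auto
  qed
qed

text \<open>Two mergings: \<open>d\<close> enters the cycle of \<open>a\<close>, then the enlarged
  cycle absorbs that of \<open>b\<close>. The intermediate length \<open>len a + 1\<close> appears
  on both sides and cancels.\<close>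

lemma cyc_mono_join:
  assumes "a \<in> X" "b \<in> X" "b \<notin> orbit f a"
  shows "cyc_mono (f \<circ> tsp d a \<circ> tsp d b) (insert d X) + (tm (len a) + tm (len b))
    = cyc_mono f X + tm (len a + len b + 1)"
proof -
  let ?g = "f \<circ> tsp d a"
  have g: "permutation ?g" by (intro permutation_compose permutes_permutation[OF f X] permutation_swap_id)
  have dX: "d \<notin> orbit f a" "d \<notin> orbit f b" using orbit_subset_carrier assms d by auto
  have fin: "finite (orbit f a)" "finite (orbit f b)"
    using orbit_subset_carrier assms X by (auto intro: finite_subset)
  have disj: "orbit f a \<inter> orbit f b = {}"
    using orbit_disjoint[OF permutes_permutation[OF f X], of a b] assms(3)
      permutation_self_in_orbit[OF permutes_permutation[OF f X], of b] by auto
  have b: "b \<notin> orbit ?g d" using orbit_insert(1)[OF assms(1)] assms d by auto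
  have "card (orbit ?g d) = len a + 1" using dX fin by (simp add: orbit_insert(1)[OF assms(1)])
  moreover have "card (orbit ?g d \<union> orbit ?g b) = len a + len b + 1"
    using dX fin disj
    by (simp add: orbit_insert(1)[OF assms(1)] orbit_insert(3)[OF assms] card_Un_disjoint)
  moreover have "cyc_mono (?g \<circ> tsp d b) (insert d X) + tm (card (orbit ?g d)) + tm (card (orbit ?g b))
      = cyc_mono ?g (insert d X) + tm (card (orbit ?g d \<union> orbit ?g b))"
    unfolding cyc_mono_def
    by (rule sum_orbs_transpose_merge) (use g X assms b in auto)
  ultimately have "cyc_mono (?g \<circ> tsp d b) (insert d X) + (tm (len a) + tm (len b)) + tm (len a + 1)
      = (cyc_mono ?g (insert d X) + tm (len a)) + tm (len a + len b + 1)"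
    by (simp add: orbit_insert(3)[OF assms] add_ac)
  also have "cyc_mono ?g (insert d X) + tm (len a) = cyc_mono f X + tm (len a + 1)"
    by (rule cyc_mono_insert[OF assms(1)])
  finally have "(cyc_mono (?g \<circ> tsp d b) (insert d X) + (tm (len a) + tm (len b))) + tm (len a + 1)
      = (cyc_mono f X + tm (len a + len b + 1)) + tm (len a + 1)"
    by (simp only: add_ac)
  thus ?thesis by (simp only: add_right_cancel)
qed

text \<open>After \<open>d\<close> has entered the cycle of \<open>a\<close>, let \<open>c j\<close>
  be the \<open>j\<close>-th successor of \<open>d\<close> on the enlarged cycle. The transposition
  of \<open>d\<close> and \<open>c j\<close> cuts off the \<open>j\<close> points ending in
  \<open>c j\<close> and leaves \<open>len a + 1 - j\<close> points with \<open>d\<close>; as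
  \<open>j\<close> varies, \<open>c j\<close> runs once through the old cycle.\<close>

lemma cyc_mono_cut:
  assumes "a \<in> X"
  obtains c where "bij_betw c {1..len a} (orbit f a)"
    "\<And>j. j \<in> {1..len a} \<Longrightarrow>
       cyc_mono (f \<circ> tsp d a \<circ> tsp d (c j)) (insert d X) + tm (len a)
     = cyc_mono f X + (tm j + tm (len a + 1 - j))"
proof
  let ?g = "f \<circ> tsp d a"
  have g: "permutation ?g" by (intro permutation_compose permutes_permutation[OF f X] permutation_swap_id)
  have dX: "d \<notin> orbit f a" using orbit_subset_carrier assms d by auto
  have fin: "finite (orbit f a)" using orbit_subset_carrier assms X by (auto intro: finite_subset)
  have n: "card (orbit ?g d) = len a + 1" using dX fin by (simp add: orbit_insert(1)[OF assms])
  define c where "c = (\<lambda>j. (?g ^^ j) d)"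
  have bij: "bij_betw c {0..<len a + 1} (insert d (orbit f a))"
    using funpow_orbit_bij(1)[OF g, of d] unfolding n unfolding orbit_insert(1)[OF assms] c_def .
  have "bij_betw c ({0..<len a + 1} - {0}) (insert d (orbit f a) - {c 0})"
    using bij by (rule bij_betw_DiffI) (auto simp: c_def)
  moreover have "{0..<len a + 1} - {0} = {1..len a}" by auto
  moreover have "insert d (orbit f a) - {c 0} = orbit f a" using dX by (simp add: c_def)
  ultimately show cbij: "bij_betw c {1..len a} (orbit f a)" by simp
  fix j assume j: "j \<in> {1..len a}"
  have cX: "c j \<in> orbit f a" using cbij j by (auto simp: bij_betw_def)
  hence cj: "c j \<in> insert d X" "d \<noteq> c j" using orbit_subset_carrier[OF assms] dX by auto
  have jn: "j < card (orbit ?g d)" using j n by simp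
  have pj: "(?g ^^ j) d = c j" by (simp add: c_def)
  let ?h = "?g \<circ> tsp d (c j)"
  have "cyc_mono ?h (insert d X) + tm (card (orbit ?g d))
      = cyc_mono ?g (insert d X) + tm (card (orbit ?h d)) + tm (card (orbit ?h (c j)))"
    unfolding cyc_mono_def
    by (rule sum_orbs_transpose_split[OF g _ _ cj(1) cj(2) pj jn]) (use X in auto)
  moreover have "card (orbit ?h (c j)) = j" "card (orbit ?h d) = len a + 1 - j"
    using orbit_transpose_split(3,4)[OF g cj(2) pj jn] n by auto
  ultimately have "(cyc_mono ?h (insert d X) + tm (len a)) + tm (len a + 1)
      = (cyc_mono ?g (insert d X) + tm (len a)) + (tm j + tm (len a + 1 - j))"
    unfolding n by (simp add: add_ac)
  also have "cyc_mono ?g (insert d X) + tm (len a) = cyc_mono f X + tm (len a + 1)"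
    by (rule cyc_mono_insert[OF assms])
  finally have "(cyc_mono ?h (insert d X) + tm (len a)) + tm (len a + 1)
      = (cyc_mono f X + (tm j + tm (len a + 1 - j))) + tm (len a + 1)"
    by (simp only: add_ac)
  thus "cyc_mono ?h (insert d X) + tm (len a) = cyc_mono f X + (tm j + tm (len a + 1 - j))"
    by (simp only: add_right_cancel)
qed

section \<open>Sums over points as differential operators\<close>

lemma sum_orbit:
  fixes h :: "'a set \<Rightarrow> real"
  shows "(\<Sum>a\<in>X. h (orbit f a)) = (\<Sum>A\<in>orbs f X. real (card A) * h A)"
proof -
  have "(\<Sum>a\<in>X. h (orbit f a)) = (\<Sum>A\<in>orbs f X. \<Sum>a\<in>{a \<in> X. orbit f a = A}. h (orbit f a))"
    using X by (intro sum.group[symmetric]) (auto simp: orbs_def)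
  also have "\<dots> = (\<Sum>A\<in>orbs f X. real (card A) * h A)"
  proof (rule sum.cong[OF refl])
    fix A assume "A \<in> orbs f X"
    then obtain x where x: "x \<in> X" "A = orbit f x" by (auto simp: orbs_def)
    have "{a \<in> X. orbit f a = A} = A"
      unfolding x(2) using orbit_eqI_permutation[OF permutes_permutation[OF f X]] orbit_subset_carrier[OF x(1)]
        permutation_self_in_orbit[OF permutes_permutation[OF f X]] by blast
    moreover have "(\<Sum>a\<in>{a \<in> X. orbit f a = A}. h (orbit f a)) = (\<Sum>a\<in>{a \<in> X. orbit f a = A}. h A)"
      by (rule sum.cong) auto
    ultimately show "(\<Sum>a\<in>{a \<in> X. orbit f a = A}. h (orbit f a)) = real (card A) * h A" by simp
  qed
  finally show ?thesis .
qed

lemma sum_card_orbs: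
  fixes h :: "nat \<Rightarrow> real"
  assumes "\<O> \<subseteq> orbs f X"
  shows "(\<Sum>A\<in>\<O>. h (card A)) = (\<Sum>i\<in>{1..card X}. real (card {A \<in> \<O>. card A = i}) * h i)"
proof -
  have "finite \<O>" by (rule finite_subset[OF assms]) (simp add: X)
  moreover have "card ` \<O> \<subseteq> {1..card X}" using assms card_orbit_bounds by (fastforce simp: orbs_def)
  ultimately have "(\<Sum>A\<in>\<O>. h (card A)) = (\<Sum>i\<in>{1..card X}. \<Sum>A\<in>{A \<in> \<O>. card A = i}. h (card A))"
    by (intro sum.group[symmetric]) auto
  also have "\<dots> = (\<Sum>i\<in>{1..card X}. real (card {A \<in> \<O>. card A = i}) * h i)"
    by (intro sum.cong refl) simp
  finally show ?thesis .
qed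

text \<open>The factor \<open>i * m_i\<close> counts the points on cycles of length
  \<open>i\<close>; it is also what \<open>i\<close> times the derivative in \<open>T i\<close>
  extracts from a monomial with exponent \<open>m_i\<close>.\<close>

lemma sum_len:
  fixes h :: "nat \<Rightarrow> real"
  shows "(\<Sum>a\<in>X. h (len a)) = (\<Sum>i\<in>{1..card X}. real i * real (card {A \<in> orbs f X. card A = i}) * h i)"
  by (subst sum_orbit, subst sum_card_orbs[OF order_refl, of "\<lambda>i. real i * h i"]) (simp add: mult_ac)

text \<open>Ordered pairs of points on different cycles: for equal lengths one cycle is already
  taken by \<open>a\<close>, which gives \<open>m_i (m_i - 1)\<close>, the coefficient of a repeated
  derivative.\<close>

lemma sum_len_pairs:
  fixes h :: "nat \<Rightarrow> nat \<Rightarrow> real"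
  defines "m \<equiv> \<lambda>i. card {A \<in> orbs f X. card A = i}"
  shows "(\<Sum>a\<in>X. \<Sum>b\<in>X - orbit f a. h (len a) (len b)) =
    (\<Sum>i\<in>{1..card X}. \<Sum>j\<in>{1..card X}. real (i * j) * real (m i * (m j - (if i = j then 1 else 0))) * h i j)"
proof -
  have inner: "(\<Sum>b\<in>X - A. g (len b)) =
      (\<Sum>j\<in>{1..card X}. real (m j - (if card A = j then 1 else 0)) * (real j * g j))"
    if A: "A \<in> orbs f X" for A and g :: "nat \<Rightarrow> real"
  proof -
    obtain x where x: "x \<in> X" "A = orbit f x" using A by (auto simp: orbs_def)
    have eqA: "orbit f b = A \<longleftrightarrow> b \<in> A" for b
      unfolding x(2) using orbit_eqI_permutation[OF permutes_permutation[OF f X], of b x]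
        permutation_self_in_orbit[OF permutes_permutation[OF f X], of b] by auto
    have "(\<Sum>b\<in>X - A. g (len b)) = (\<Sum>b\<in>X. if orbit f b = A then 0 else g (len b))"
      using X by (simp add: eqA sum.If_cases Diff_eq)
    also have "\<dots> = (\<Sum>B\<in>orbs f X. real (card B) * (if B = A then 0 else g (card B)))"
      by (rule sum_orbit)
    also have "\<dots> = (\<Sum>B\<in>orbs f X - {A}. real (card B) * g (card B))"
      using X by (intro sum.mono_neutral_cong_right) auto
    also have "\<dots> = (\<Sum>j\<in>{1..card X}. real (card {B \<in> orbs f X - {A}. card B = j}) * (real j * g j))"
      by (subst sum_card_orbs[of "orbs f X - {A}" "\<lambda>j. real j * g j"]) auto
    also have "\<dots> = (\<Sum>j\<in>{1..card X}. real (m j - (if card A = j then 1 else 0)) * (real j * g j))"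
    proof (intro sum.cong refl arg_cong2[where f="(*)"] arg_cong[where f=real])
      fix j
      have "{B \<in> orbs f X - {A}. card B = j} = {B \<in> orbs f X. card B = j} - (if card A = j then {A} else {})"
        by auto
      thus "card {B \<in> orbs f X - {A}. card B = j} = m j - (if card A = j then 1 else 0)"
        using A X by (auto simp: m_def card_Diff_singleton)
    qed
    finally show ?thesis .
  qed
  have "(\<Sum>a\<in>X. \<Sum>b\<in>X - orbit f a. h (len a) (len b)) =
    (\<Sum>a\<in>X. \<Sum>j\<in>{1..card X}. real (m j - (if len a = j then 1 else 0)) * (real j * h (len a) j))"
    by (intro sum.cong refl inner) (auto simp: orbs_def)
  also have "\<dots> = (\<Sum>i\<in>{1..card X}. real i * real (m i) *
      (\<Sum>j\<in>{1..card X}. real (m j - (if i = j then 1 else 0)) * (real j * h i j)))"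
    unfolding m_def by (rule sum_len)
  finally show ?thesis by (simp add: sum_distrib_left mult_ac)
qed


context
  fixes \<beta> :: mono
  assumes \<beta>: "\<And>i. lk \<beta> (T i) = card {A \<in> orbs f X. card A = i}"
begin

lemma multiplicity_eq_0: "i \<notin> {1..card X} \<Longrightarrow> lk \<beta> (T i) = 0"
proof -
  assume i: "i \<notin> {1..card X}"
  have "card A \<in> {1..card X}" if "A \<in> orbs f X" for A
    using that card_orbit_bounds by (auto simp: orbs_def)
  hence "{A \<in> orbs f X. card A = i} = {}" using i by auto
  thus ?thesis unfolding \<beta> by (simp only: card.empty)
qed

text \<open>The coefficient \<open>i - 1\<close> and the derivative in \<open>T (i - 1)\<close> run
  over the points on cycles of length \<open>i - 1\<close>; the factor \<open>T i\<close> puts the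
  cycle back with one more point. \<open>\<beta>\<close> may carry powers of \<open>S\<close>,
  \<open>U\<close>, \<open>V\<close>, which pass through unchanged.\<close>

lemma L1_fmon: "L1 (fmon \<beta>) = (\<lambda>\<alpha>. \<Sum>a\<in>X. fmon (tm (len a + 1) + (\<beta> - tm (len a))) \<alpha>)"
proof
  fix \<alpha>
  have L: "L1_term (fmon \<beta>) (Suc l) \<alpha> = real l * real (lk \<beta> (T l)) * fmon (tm (l + 1) + (\<beta> - tm l)) \<alpha>"
    if "1 \<le> l" for l
    using that by (simp add: L1_term_def fderiv_fmon fmul_fscale_right fvar_eq_fmon fmul_fmon_fmon fscale_apply)
  have "L1 (fmon \<beta>) \<alpha> = (\<Sum>i\<in>Suc ` {1..card X}. L1_term (fmon \<beta>) i \<alpha>)"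
    unfolding L1_eq
  proof (rule fsum_eq_sum)
    fix i assume i: "i \<notin> Suc ` {1..card X}"
    show "L1_term (fmon \<beta>) i \<alpha> = 0"
    proof (cases "2 \<le> i")
      case True
      then obtain l where l: "i = Suc l" "1 \<le> l" by (cases i) auto
      have "lk \<beta> (T l) = 0" using i l by (intro multiplicity_eq_0) auto
      thus ?thesis unfolding l(1) L[OF l(2)] by simp
    qed (simp add: L1_term_def fconst_0)
  qed simp
  also have "\<dots> = (\<Sum>l\<in>{1..card X}. L1_term (fmon \<beta>) (Suc l) \<alpha>)"
    by (subst sum.reindex) auto
  also have "\<dots> = (\<Sum>a\<in>X. fmon (tm (len a + 1) + (\<beta> - tm (len a))) \<alpha>)"
    by (subst sum_len[of "\<lambda>l. fmon (tm (l + 1) + (\<beta> - tm l)) \<alpha>"]) (intro sum.cong refl, simp add: L \<beta>)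
  finally show "L1 (fmon \<beta>) \<alpha> = (\<Sum>a\<in>X. fmon (tm (len a + 1) + (\<beta> - tm (len a))) \<alpha>)" .
qed

text \<open>With \<open>l = i - 1\<close> the derivative selects a point on a cycle of length
  \<open>l\<close>, and the operator's inner index \<open>j\<close> is the length of one of the two
  pieces of the cycle enlarged to length \<open>l + 1\<close>.\<close>

lemma M1_split_fmon:
  "fsum (M1_split_term (fmon \<beta>)) =
    (\<lambda>\<alpha>. \<Sum>a\<in>X. \<Sum>j\<in>{1..len a}. fmon (tm j + tm (len a + 1 - j) + (\<beta> - tm (len a))) \<alpha>)"
proof
  fix \<alpha>
  let ?g = "\<lambda>l j. fmon (tm j + tm (l + 1 - j) + (\<beta> - tm l)) \<alpha>"
  let ?s = "\<lambda>(l, j). (Suc l, j :: nat)"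
  let ?I = "SIGMA l:{1..card X}. {1..l}"
  have M: "M1_split_term (fmon \<beta>) (Suc l, j) \<alpha> = real l * real (lk \<beta> (T l)) * ?g l j"
    if "1 \<le> j" "j \<le> l" for l j
    using that
    by (simp add: M1_split_term_def fderiv_fmon fmul_fscale_right fvar_eq_fmon fmul_fmon_fmon fscale_apply)
  have "fsum (M1_split_term (fmon \<beta>)) \<alpha> = (\<Sum>p\<in>?s ` ?I. M1_split_term (fmon \<beta>) p \<alpha>)"
  proof (rule fsum_eq_sum)
    fix p assume p: "p \<notin> ?s ` ?I"
    obtain i j where ij: "p = (i, j)" by force
    show "M1_split_term (fmon \<beta>) p \<alpha> = 0"
    proof (cases "2 \<le> i \<and> 1 \<le> j \<and> j \<le> i - 1")
      case True
      then obtain l where l: "i = Suc l" "1 \<le> j" "j \<le> l" by (cases i) auto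
      have "l \<notin> {1..card X}"
      proof
        assume "l \<in> {1..card X}"
        hence "(l, j) \<in> ?I" using l by simp
        hence "?s (l, j) \<in> ?s ` ?I" by (rule imageI)
        thus False using p by (simp add: ij l)
      qed
      hence "lk \<beta> (T l) = 0" by (rule multiplicity_eq_0)
      thus ?thesis unfolding ij l(1) M[OF l(2,3)] by simp
    next
      case False
      thus ?thesis unfolding ij M1_split_term_def by (auto simp: fconst_0)
    qed
  qed auto
  also have "\<dots> = (\<Sum>(l, j)\<in>?I. M1_split_term (fmon \<beta>) (Suc l, j) \<alpha>)"
    by (subst sum.reindex) (auto simp: inj_on_def case_prod_unfold)
  also have "\<dots> = (\<Sum>l\<in>{1..card X}. \<Sum>j\<in>{1..l}. M1_split_term (fmon \<beta>) (Suc l, j) \<alpha>)"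
    by (subst sum.Sigma) auto
  also have "\<dots> = (\<Sum>l\<in>{1..card X}. real l * real (lk \<beta> (T l)) * (\<Sum>j\<in>{1..l}. ?g l j))"
    by (simp add: M sum_distrib_left)
  also have "\<dots> = (\<Sum>a\<in>X. \<Sum>j\<in>{1..len a}. ?g (len a) j)"
    by (subst sum_len[of "\<lambda>l. \<Sum>j\<in>{1..l}. ?g l j"]) (simp add: \<beta>)
  finally show "fsum (M1_split_term (fmon \<beta>)) \<alpha> = (\<Sum>a\<in>X. \<Sum>j\<in>{1..len a}. ?g (len a) j)" .
qed

lemma M1_join_fmon:
  "fsum (M1_join_term (fmon \<beta>)) =
    (\<lambda>\<alpha>. \<Sum>a\<in>X. \<Sum>b\<in>X - orbit f a. fmon (tm (len a + len b + 1) + (\<beta> - tm (len a) - tm (len b))) \<alpha>)"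
proof
  fix \<alpha>
  let ?g = "\<lambda>i j. fmon (tm (i + j + 1) + (\<beta> - tm i - tm j)) \<alpha>"
  \<comment> \<open>The operator's index \<open>(i, j)\<close> is written \<open>(j + k, j)\<close>,
    which makes the two cycle lengths \<open>j\<close> and \<open>k\<close> independent.\<close>
  let ?s = "\<lambda>(j, k). (j + k, j :: nat)"
  let ?I = "{1..card X} \<times> {1..card X}"
  have M: "M1_join_term (fmon \<beta>) (j + k, j) \<alpha> =
      real (k * j) * real (lk \<beta> (T k) * (lk \<beta> (T j) - (if k = j then 1 else 0))) * ?g k j"
    if "1 \<le> j" "1 \<le> k" for j k
  proof -
    \<comment> \<open>The derivative in \<open>T k\<close> acts first, so for \<open>k = j\<close>
      the exponent met by the second one is lower by 1.\<close>
    have "lk (\<beta> - tm k) (T j) = lk \<beta> (T j) - (if k = j then 1 else 0)"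
      by (simp add: lookup_minus lookup_single)
    moreover have "2 \<le> j + k" "j \<le> j + k - 1" using that by auto
    ultimately show ?thesis using that
      by (simp add: M1_join_term_def fderiv_fmon fderiv_fscale fmul_fscale_right fvar_eq_fmon fmul_fmon_fmon
          add.commute mult_ac fscale_apply del: of_nat_diff)
  qed
  have "fsum (M1_join_term (fmon \<beta>)) \<alpha> = (\<Sum>p\<in>?s ` ?I. M1_join_term (fmon \<beta>) p \<alpha>)"
  proof (rule fsum_eq_sum)
    fix p assume p: "p \<notin> ?s ` ?I"
    obtain i j where ij: "p = (i, j)" by force
    show "M1_join_term (fmon \<beta>) p \<alpha> = 0"
    proof (cases "2 \<le> i \<and> 1 \<le> j \<and> j \<le> i - 1")
      case True
      define k where "k = i - j"
      have k: "i = j + k" "1 \<le> j" "1 \<le> k" using True by (auto simp: k_def)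
      have "j \<notin> {1..card X} \<or> k \<notin> {1..card X}"
      proof (rule ccontr)
        assume "\<not> ?thesis"
        hence "?s (j, k) \<in> ?s ` ?I" by (intro imageI) simp
        thus False using p by (simp add: ij k)
      qed
      hence "lk \<beta> (T j) = 0 \<or> lk \<beta> (T k) = 0" using multiplicity_eq_0[of j] multiplicity_eq_0[of k] by argo
      hence 0: "lk \<beta> (T k) * (lk \<beta> (T j) - (if k = j then 1 else 0)) = 0" by (elim disjE) simp_all
      show ?thesis unfolding ij k(1) M[OF k(2,3)] 0 by simp
    next
      case False
      thus ?thesis unfolding ij M1_join_term_def by (auto simp: fconst_0)
    qed
  qed auto
  also have "\<dots> = (\<Sum>(j, k)\<in>?I. M1_join_term (fmon \<beta>) (j + k, j) \<alpha>)"
    by (subst sum.reindex) (auto simp: inj_on_def case_prod_unfold)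
  also have "\<dots> = (\<Sum>k\<in>{1..card X}. \<Sum>j\<in>{1..card X}. M1_join_term (fmon \<beta>) (j + k, j) \<alpha>)"
    unfolding sum.cartesian_product[symmetric] by (rule sum.swap)
  also have "\<dots> = (\<Sum>a\<in>X. \<Sum>b\<in>X - orbit f a. ?g (len a) (len b))"
    by (subst sum_len_pairs[of ?g]) (intro sum.cong refl, simp add: M \<beta>)
  finally show "fsum (M1_join_term (fmon \<beta>)) \<alpha> = (\<Sum>a\<in>X. \<Sum>b\<in>X - orbit f a. ?g (len a) (len b))" .
qed

end

end

text \<open>\<open>M\<close> and \<open>K\<close> are the cycle monomials before and after an
  insertion, \<open>t\<close> the cycles lost and \<open>r\<close> those gained, \<open>g\<close>
  the remaining weight. The additive relation becomes one in which \<open>b\<close>, the old weight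
  without \<open>t\<close>, can be a difference.\<close>

lemma mono_exchange: "K + t = M + r \<Longrightarrow> g + M = b + t \<Longrightarrow> g + K = r + (b :: mono)"
proof -
  assume a: "K + t = M + r" "g + M = b + t"
  have "(g + K) + t = g + (K + t)" by (rule add.assoc)
  also have "\<dots> = (g + M) + r" unfolding a(1) by (simp only: add.assoc)
  also have "\<dots> = (r + b) + t" unfolding a(2) by (simp only: add_ac)
  finally show ?thesis by (simp only: add_right_cancel)
qed

text \<open>The exponents of \<open>U\<close> and \<open>V\<close> only register whether
  \<open>d\<close> becomes a fixed point of its permutation, while the exponents of the
  \<open>T i\<close> depend on the position of \<open>a\<close> and \<open>b\<close> on the cycles
  of \<open>f = \<tau> \<circ> inv \<sigma>\<close>. So each group of choices \<open>(a, b)\<close>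
  matches a single term of \<open>Aop\<close>.\<close>

lemma sum_wt_insert:
  assumes \<sigma>: "\<sigma> permutes X" and \<tau>: "\<tau> permutes X" and X: "finite X" and d: "d \<notin> X"
  shows "fmul (fvar S) (Aop (fmon (wt X \<sigma> \<tau>))) = (\<lambda>\<alpha>. \<Sum>a\<in>insert d X. \<Sum>b\<in>insert d X.
     fmon (wt (insert d X) (tsp d a \<circ> \<sigma>) (tsp d b \<circ> \<tau>)) \<alpha>)"
proof
  fix \<alpha>
  define f where "f = \<tau> \<circ> inv \<sigma>"
  define \<beta> where "\<beta> = wt X \<sigma> \<tau>"
  let ?X = "insert d X" and ?l = "\<lambda>a. card (orbit f a)"
  define W where "W = (\<lambda>a b. wt ?X (tsp d a \<circ> \<sigma>) (tsp d b \<circ> \<tau>))"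
  have f: "f permutes X" unfolding f_def by (intro permutes_compose permutes_inv \<sigma> \<tau>)
  note ctx = f X d
  have \<beta>: "lk \<beta> (T i) = card {A \<in> orbs f X. card A = i}" for i
    unfolding \<beta>_def f_def by (rule lookup_wt(4)[OF X])
  define \<gamma> where "\<gamma> = Poly_Mapping.single S (card X) + Poly_Mapping.single U (card (orbs \<sigma> X))
     + Poly_Mapping.single V (card (orbs \<tau> X))"
  have \<beta>_eq: "\<beta> = \<gamma> + cyc_mono f X" by (simp add: \<beta>_def \<gamma>_def f_def wt_def)
  have pos: "lk \<beta> (T (?l a)) \<noteq> 0" if "a \<in> X" for a
  proof -
    have "orbit f a \<in> {A \<in> orbs f X. card A = ?l a}" using that by (auto simp: orbs_def)
    thus ?thesis unfolding \<beta> using X by auto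
  qed
  have W: "W a b = sg S + (if a = d then sg U else 0) + (if b = d then sg V else 0)
      + (\<gamma> + cyc_mono (f \<circ> tsp d a \<circ> tsp d b) ?X)" if "a \<in> ?X" "b \<in> ?X" for a b
  proof -
    have "(tsp d b \<circ> \<tau>) \<circ> inv (tsp d a \<circ> \<sigma>) = tsp d b \<circ> f \<circ> tsp d a"
      using permutes_bij[OF \<sigma>] by (subst o_inv_distrib) (auto simp: f_def comp_assoc)
    moreover have "Poly_Mapping.single S (card ?X) = Poly_Mapping.single S (card X) + sg S"
      using X d by (simp add: single_add[symmetric])
    moreover have "Poly_Mapping.single U (card (orbs (tsp d a \<circ> \<sigma>) ?X))
        = Poly_Mapping.single U (card (orbs \<sigma> X)) + (if a = d then sg U else 0)"
      using card_orbs_insert[OF \<sigma> X d that(1)] by (simp add: single_add[symmetric])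
    moreover have "Poly_Mapping.single V (card (orbs (tsp d b \<circ> \<tau>) ?X))
        = Poly_Mapping.single V (card (orbs \<tau> X)) + (if b = d then sg V else 0)"
      using card_orbs_insert[OF \<tau> X d that(2)] by (simp add: single_add[symmetric])
    ultimately show ?thesis
      unfolding W_def wt_def \<gamma>_def cyc_mono_transpose_conj[OF f X that, symmetric]
      by (simp only: add_ac)
  qed
  have W_dd: "W d d = sg U + sg V + tm 1 + sg S + \<beta>"
  proof -
    have "f \<circ> tsp d d \<circ> tsp d d = f" by simp
    thus ?thesis unfolding W[OF insertI1 insertI1] \<beta>_eq
      by (simp only: cyc_mono_fixed[OF ctx] if_True refl add_ac)
  qed
  have ins: "\<gamma> + cyc_mono (f \<circ> tsp d a) ?X = tm (?l a + 1) + (\<beta> - tm (?l a))" if "a \<in> X" for a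
    by (rule mono_exchange[OF cyc_mono_insert[OF ctx that]])
       (simp only: \<beta>_eq[symmetric] mono_minus_add[OF pos[OF that]])
  have W_da: "W d a = sg S + sg U + (tm (?l a + 1) + (\<beta> - tm (?l a)))"
    and W_ad: "W a d = sg S + sg V + (tm (?l a + 1) + (\<beta> - tm (?l a)))" if a: "a \<in> X" for a
  proof -
    have "f \<circ> tsp d d \<circ> tsp d a = f \<circ> tsp d a" "f \<circ> tsp d a \<circ> tsp d d = f \<circ> tsp d a" "a \<noteq> d"
      using a d by auto
    thus "W d a = sg S + sg U + (tm (?l a + 1) + (\<beta> - tm (?l a)))"
      "W a d = sg S + sg V + (tm (?l a + 1) + (\<beta> - tm (?l a)))"
      using W[of d a] W[of a d] a by (simp_all only: ins[OF a, symmetric]) simp_all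
  qed
  have W_join: "W a b = sg S + (tm (?l a + ?l b + 1) + (\<beta> - tm (?l a) - tm (?l b)))"
    if ab: "a \<in> X" "b \<in> X - orbit f a" for a b
  proof -
    \<comment> \<open>Removing both lengths must not be truncated: if they coincide, the two
      different cycles make the exponent at least 2.\<close>
    have "lk (\<beta> - tm (?l a)) (T (?l b)) \<noteq> 0"
    proof (cases "?l a = ?l b")
      case True
      have "orbit f a \<noteq> orbit f b"
        using ab permutation_self_in_orbit[OF permutes_permutation[OF f X], of b] by auto
      hence "card {orbit f a, orbit f b} = 2" by simp
      moreover have "{orbit f a, orbit f b} \<subseteq> {A \<in> orbs f X. card A = ?l a}"
        using ab True by (auto simp: orbs_def)
      ultimately have "2 \<le> lk \<beta> (T (?l a))"
        unfolding \<beta> using X card_mono[of "{A \<in> orbs f X. card A = ?l a}" "{orbit f a, orbit f b}"] by simp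
      thus ?thesis using True by (simp add: lookup_minus lookup_single)
    next
      case False
      thus ?thesis using pos[of b] ab by (simp add: lookup_minus lookup_single)
    qed
    hence "\<beta> - tm (?l a) - tm (?l b) + tm (?l b) = \<beta> - tm (?l a)" by (rule mono_minus_add)
    hence "(\<beta> - tm (?l a) - tm (?l b)) + (tm (?l a) + tm (?l b)) = \<beta> - tm (?l a) + tm (?l a)"
      by (simp only: add.assoc[symmetric] add.commute[of "tm (?l a)"])
    hence 2: "\<beta> = (\<beta> - tm (?l a) - tm (?l b)) + (tm (?l a) + tm (?l b))"
      by (simp only: mono_minus_add[OF pos[OF ab(1)]])
    have "\<gamma> + cyc_mono (f \<circ> tsp d a \<circ> tsp d b) ?X = tm (?l a + ?l b + 1) + (\<beta> - tm (?l a) - tm (?l b))"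
    proof (rule mono_exchange[OF cyc_mono_join[OF ctx, of a b]])
      show "\<gamma> + cyc_mono f X = (\<beta> - tm (?l a) - tm (?l b)) + (tm (?l a) + tm (?l b))"
        using 2 by (simp only: \<beta>_eq[symmetric])
    qed (use ab in auto)
    thus ?thesis using W[of a b] ab d by auto
  qed
  \<comment> \<open>For fixed \<open>a\<close> the points \<open>b\<close> of its cycle are taken in
    the order of \<open>cyc_mono_cut\<close>, so each \<open>j\<close> occurs for exactly one
    \<open>b\<close>.\<close>
  have W_split: "(\<Sum>b\<in>orbit f a. fmon (W a b) \<alpha>)
      = (\<Sum>j\<in>{1..?l a}. fmon (sg S + (tm j + tm (?l a + 1 - j) + (\<beta> - tm (?l a)))) \<alpha>)"
    if a: "a \<in> X" for a
  proof -
    obtain c where c: "bij_betw c {1..?l a} (orbit f a)"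
      "\<And>j. j \<in> {1..?l a} \<Longrightarrow> cyc_mono (f \<circ> tsp d a \<circ> tsp d (c j)) ?X + tm (?l a)
        = cyc_mono f X + (tm j + tm (?l a + 1 - j))"
      using cyc_mono_cut[OF ctx a] by blast
    have "W a (c j) = sg S + (tm j + tm (?l a + 1 - j) + (\<beta> - tm (?l a)))" if j: "j \<in> {1..?l a}" for j
    proof -
      have "c j \<in> X" using c(1) j permutes_orbit_subset[OF f a] by (auto simp: bij_betw_def)
      moreover have "\<gamma> + cyc_mono (f \<circ> tsp d a \<circ> tsp d (c j)) ?X
          = (tm j + tm (?l a + 1 - j)) + (\<beta> - tm (?l a))"
        by (rule mono_exchange[OF c(2)[OF j]])
           (simp only: \<beta>_eq[symmetric] mono_minus_add[OF pos[OF a]])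
      ultimately show ?thesis using W[of a "c j"] a d by auto
    qed
    thus ?thesis using sum.reindex_bij_betw[OF c(1), of "\<lambda>b. fmon (W a b) \<alpha>"] by simp
  qed
  have "(\<Sum>a\<in>?X. \<Sum>b\<in>?X. fmon (W a b) \<alpha>) =
      fmon (W d d) \<alpha> + (\<Sum>a\<in>X. fmon (W d a) \<alpha>) + (\<Sum>a\<in>X. fmon (W a d) \<alpha>)
      + (\<Sum>a\<in>X. \<Sum>b\<in>orbit f a. fmon (W a b) \<alpha>) + (\<Sum>a\<in>X. \<Sum>b\<in>X - orbit f a. fmon (W a b) \<alpha>)"
  proof -
    have "(\<Sum>b\<in>X. fmon (W a b) \<alpha>) = (\<Sum>b\<in>orbit f a. fmon (W a b) \<alpha>) + (\<Sum>b\<in>X - orbit f a. fmon (W a b) \<alpha>)"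
      if "a \<in> X" for a
      using sum.subset_diff[OF permutes_orbit_subset[OF f that] X, of "\<lambda>b. fmon (W a b) \<alpha>"] by (simp add: add.commute)
    thus ?thesis using X d by (simp add: sum.distrib)
  qed
  also have "\<dots> = fmul (fvar S) (Aop (fmon \<beta>)) \<alpha>"
    unfolding Aop_def L1_fmon[OF ctx \<beta>] M1_eq M1_split_fmon[OF ctx \<beta>] M1_join_fmon[OF ctx \<beta>]
    by (simp add: fmul_fadd_left fmul_fadd_right fmul_sum_right fvar_eq_fmon fmul_fmon_fmon fadd_apply fmul_fadd_right[unfolded fadd_def]
        W_dd W_da W_ad W_join W_split sum.distrib add_ac)
  finally show "fmul (fvar S) (Aop (fmon (wt X \<sigma> \<tau>))) \<alpha> = (\<Sum>a\<in>?X. \<Sum>b\<in>?X.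
     fmon (wt ?X (tsp d a \<circ> \<sigma>) (tsp d b \<circ> \<tau>)) \<alpha>)"
    by (simp add: W_def \<beta>_def)
qed

text \<open>A permutation of \<open>insert d X\<close> is \<open>tsp d a \<circ> \<sigma>\<close>
  for a unique \<open>\<sigma>\<close> permuting \<open>X\<close> and a unique \<open>a\<close>, its
  value at \<open>d\<close>. Doing this for both permutations leaves a sum of one-step insertions,
  and \<open>Aop\<close> is linear.\<close>

lemma all_pairs_insert:
  assumes "finite X" "d \<notin> X"
  shows "all_pairs (insert d X) = fmul (fvar S) (Aop (all_pairs X))"
proof
  fix \<alpha>
  let ?P = "{\<sigma>. \<sigma> permutes X}" and ?X = "insert d X"
  have fin: "finite ?P" using assms(1) by (rule finite_permutations)
  have "all_pairs ?X \<alpha> = (\<Sum>a\<in>?X. \<Sum>\<sigma>\<in>?P. \<Sum>b\<in>?X. \<Sum>\<tau>\<in>?P. fmon (wt ?X (tsp d a \<circ> \<sigma>) (tsp d b \<circ> \<tau>)) \<alpha>)"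
    unfolding all_pairs_def by (simp only: sum_over_permutations_insert[OF assms])
  also have "\<dots> = (\<Sum>\<sigma>\<in>?P. \<Sum>a\<in>?X. \<Sum>b\<in>?X. \<Sum>\<tau>\<in>?P. fmon (wt ?X (tsp d a \<circ> \<sigma>) (tsp d b \<circ> \<tau>)) \<alpha>)"
    by (rule sum.swap)
  also have "\<dots> = (\<Sum>\<sigma>\<in>?P. \<Sum>a\<in>?X. \<Sum>\<tau>\<in>?P. \<Sum>b\<in>?X. fmon (wt ?X (tsp d a \<circ> \<sigma>) (tsp d b \<circ> \<tau>)) \<alpha>)"
    by (intro sum.cong refl sum.swap)
  also have "\<dots> = (\<Sum>\<sigma>\<in>?P. \<Sum>\<tau>\<in>?P. \<Sum>a\<in>?X. \<Sum>b\<in>?X. fmon (wt ?X (tsp d a \<circ> \<sigma>) (tsp d b \<circ> \<tau>)) \<alpha>)"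
    by (intro sum.cong refl sum.swap)
  also have "\<dots> = (\<Sum>\<sigma>\<in>?P. \<Sum>\<tau>\<in>?P. fmul (fvar S) (Aop (fmon (wt X \<sigma> \<tau>))) \<alpha>)"
    by (intro sum.cong refl) (simp add: sum_wt_insert[OF _ _ assms])
  also have "\<dots> = fmul (fvar S) (Aop (all_pairs X)) \<alpha>"
    unfolding all_pairs_def by (simp add: Aop_sum fin fmul_sum_right)
  finally show "all_pairs ?X \<alpha> = fmul (fvar S) (Aop (all_pairs X)) \<alpha>" .
qed

lemma all_pairs_empty: "all_pairs {} = fmon 0"
  by (simp add: all_pairs_def wt_def orbs_def cyc_mono_def)

lemma all_pairs_funpow:
  "all_pairs {..<n :: nat} = ((\<lambda>G. fmul (fvar S) (Aop G)) ^^ n) (fconst 1)"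
  by (induction n) (simp_all add: all_pairs_empty fconst_1 lessThan_Suc all_pairs_insert)

section \<open>The exponential formula\<close>

text \<open>Forward steps suffice: a permutation with finite orbits reaches its inverse images by
  iteration, so this is the orbit relation of the generated group, as \<open>conn_sym\<close>
  confirms.\<close>

definition conn :: "('a \<Rightarrow> 'a) \<Rightarrow> ('a \<Rightarrow> 'a) \<Rightarrow> 'a \<Rightarrow> 'a \<Rightarrow> bool" where
  "conn \<sigma> \<tau> = (\<lambda>x y. y = \<sigma> x \<or> y = \<tau> x)\<^sup>*\<^sup>*"

definition trans_on :: "'a set \<Rightarrow> ('a \<Rightarrow> 'a) \<Rightarrow> ('a \<Rightarrow> 'a) \<Rightarrow> bool" where
  "trans_on X \<sigma> \<tau> \<longleftrightarrow> (\<forall>x\<in>X. \<forall>y\<in>X. conn \<sigma> \<tau> x y)"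

definition perm_pairs :: "'a set \<Rightarrow> (('a \<Rightarrow> 'a) \<times> ('a \<Rightarrow> 'a)) set" where
  "perm_pairs X = {\<sigma>. \<sigma> permutes X} \<times> {\<tau>. \<tau> permutes X}"

definition trans_perm_pairs :: "'a set \<Rightarrow> (('a \<Rightarrow> 'a) \<times> ('a \<Rightarrow> 'a)) set" where
  "trans_perm_pairs X = {(\<sigma>, \<tau>) \<in> perm_pairs X. trans_on X \<sigma> \<tau>}"

definition trans_pairs :: "'a set \<Rightarrow> fps" where
  "trans_pairs X = (\<lambda>\<alpha>. \<Sum>(\<sigma>, \<tau>)\<in>trans_perm_pairs X. fmon (wt X \<sigma> \<tau>) \<alpha>)"

lemma finite_perm_pairs [simp]: "finite X \<Longrightarrow> finite (perm_pairs X)"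
  by (simp add: perm_pairs_def finite_permutations)

lemma finite_trans_perm_pairs [simp]: "finite X \<Longrightarrow> finite (trans_perm_pairs X)"
  by (rule finite_subset[of _ "perm_pairs X"]) (auto simp: trans_perm_pairs_def)

lemma all_pairs_eq: "all_pairs X \<alpha> = (\<Sum>(\<sigma>, \<tau>)\<in>perm_pairs X. fmon (wt X \<sigma> \<tau>) \<alpha>)"
  by (simp add: all_pairs_def perm_pairs_def sum.cartesian_product)

lemma conn_refl: "conn \<sigma> \<tau> x x"
  by (simp add: conn_def)

lemma conn_trans: "conn \<sigma> \<tau> x y \<Longrightarrow> conn \<sigma> \<tau> y z \<Longrightarrow> conn \<sigma> \<tau> x z"
  unfolding conn_def by (rule rtranclp_trans)

lemma conn_step: "conn \<sigma> \<tau> x (\<sigma> x)" "conn \<sigma> \<tau> x (\<tau> x)"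
  unfolding conn_def by (auto intro: r_into_rtranclp)

lemma conn_induct [consumes 1, case_names refl left right]:
  assumes "conn \<sigma> \<tau> x y" "P x" "\<And>y. conn \<sigma> \<tau> x y \<Longrightarrow> P y \<Longrightarrow> P (\<sigma> y)"
    "\<And>y. conn \<sigma> \<tau> x y \<Longrightarrow> P y \<Longrightarrow> P (\<tau> y)"
  shows "P y"
  using assms(1) unfolding conn_def
  by (induction rule: rtranclp_induct) (use assms(2-4) in \<open>auto simp: conn_def\<close>)

lemma conn_orbit: "y \<in> orbit \<sigma> x \<Longrightarrow> conn \<sigma> \<tau> x y" "y \<in> orbit \<tau> x \<Longrightarrow> conn \<sigma> \<tau> x y"
proof -
  show "y \<in> orbit \<sigma> x \<Longrightarrow> conn \<sigma> \<tau> x y"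
    by (induction rule: orbit.induct) (auto intro: conn_step conn_trans)
  show "y \<in> orbit \<tau> x \<Longrightarrow> conn \<sigma> \<tau> x y"
    by (induction rule: orbit.induct) (auto intro: conn_step conn_trans)
qed

lemma conn_sym:
  assumes "permutation \<sigma>" "permutation \<tau>" "conn \<sigma> \<tau> x y"
  shows "conn \<sigma> \<tau> y x"
  using assms(3)
proof (induction rule: conn_induct)
  case refl
  show ?case by (rule conn_refl)
next
  case (left y)
  have "y \<in> orbit \<sigma> (\<sigma> y)"
    using assms(1) permutation_self_in_orbit permutation_orbit_step by metis
  thus ?case using left conn_orbit(1) conn_trans by metis
next
  case (right y)
  have "y \<in> orbit \<tau> (\<tau> y)"
    using assms(2) permutation_self_in_orbit permutation_orbit_step by metis
  thus ?case using right conn_orbit(2) conn_trans by metis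
qed

text \<open>Walks from a point of an invariant set stay in it, hence survive a change of the maps
  outside. It passes between a pair and its restriction in both directions.\<close>

lemma conn_cong:
  assumes "conn \<sigma> \<tau> x y" "x \<in> Y" "\<And>z. z \<in> Y \<Longrightarrow> \<sigma>' z = \<sigma> z \<and> \<sigma> z \<in> Y"
    "\<And>z. z \<in> Y \<Longrightarrow> \<tau>' z = \<tau> z \<and> \<tau> z \<in> Y"
  shows "conn \<sigma>' \<tau>' x y \<and> y \<in> Y"
  using assms(1)
proof (induction rule: conn_induct)
  case refl
  show ?case using assms(2) by (simp add: conn_refl)
next
  case (left y)
  thus ?case using assms(3)[of y] conn_step(1)[of \<sigma>' \<tau>' y] by (auto intro: conn_trans)
next
  case (right y)
  thus ?case using assms(4)[of y] conn_step(2)[of \<sigma>' \<tau>' y] by (auto intro: conn_trans)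
qed

lemma sum_orbs_union:
  assumes f: "f1 permutes Y" "f2 permutes Z" and fin: "finite Y" "finite Z" and disj: "Y \<inter> Z = {}"
    and eq: "\<And>x. x \<in> Y \<Longrightarrow> f x = f1 x" "\<And>x. x \<in> Z \<Longrightarrow> f x = f2 x"
  shows "sum h (orbs f (Y \<union> Z)) = sum h (orbs f1 Y) + sum h (orbs f2 Z)"
proof -
  have "orbit f x = orbit f1 x" if "x \<in> Y" for x
    by (rule orbit_cong0[of _ Y]) (use that eq f in \<open>auto simp: permutes_in_image\<close>)
  moreover have "orbit f x = orbit f2 x" if "x \<in> Z" for x
    by (rule orbit_cong0[of _ Z]) (use that eq f in \<open>auto simp: permutes_in_image\<close>)
  ultimately have "orbs f (Y \<union> Z) = orbs f1 Y \<union> orbs f2 Z"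
    by (simp add: orbs_def image_Un)
  moreover have "orbs f1 Y \<inter> orbs f2 Z = {}"
  proof (rule ccontr)
    assume "orbs f1 Y \<inter> orbs f2 Z \<noteq> {}"
    then obtain y z where yz: "y \<in> Y" "z \<in> Z" "orbit f1 y = orbit f2 z" by (auto simp: orbs_def)
    have "orbit f1 y \<subseteq> Y" "orbit f2 z \<subseteq> Z" using yz f by (auto intro: permutes_orbit_subset[THEN subsetD])
    thus False using yz(3) disj orbit_nonempty[of f1 y] by auto
  qed
  ultimately show ?thesis using fin by (simp add: sum.union_disjoint)
qed

text \<open>Each cycle lies in one of the two blocks, so exponents add; this is why gluing pairs
  corresponds to multiplying series.\<close>

lemma wt_union:
  assumes \<sigma>: "\<sigma>1 permutes Y" "\<sigma>2 permutes Z" and \<tau>: "\<tau>1 permutes Y" "\<tau>2 permutes Z"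
    and fin: "finite Y" "finite Z" and disj: "Y \<inter> Z = {}"
  shows "wt (Y \<union> Z) (\<sigma>1 \<circ> \<sigma>2) (\<tau>1 \<circ> \<tau>2) = wt Y \<sigma>1 \<tau>1 + wt Z \<sigma>2 \<tau>2"
proof -
  have agreeY: "(f1 \<circ> f2) x = f1 x" if "f2 permutes Z" "x \<in> Y" for f1 f2 x
  proof -
    have "x \<notin> Z" using that(2) disj by auto
    thus ?thesis using permutes_not_in[OF that(1)] by simp
  qed
  have agreeZ: "(f1 \<circ> f2) x = f2 x" if "f1 permutes Y" "f2 permutes Z" "x \<in> Z" for f1 f2 x
  proof -
    have "f2 x \<notin> Y" using that(3) disj permutes_in_image[OF that(2)] by auto
    thus ?thesis using permutes_not_in[OF that(1)] by simp
  qed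
  have inv: "inv (\<sigma>1 \<circ> \<sigma>2) = inv \<sigma>2 \<circ> inv \<sigma>1"
    using permutes_bij \<sigma> by (intro o_inv_distrib)
  have "card (orbs (\<sigma>1 \<circ> \<sigma>2) (Y \<union> Z)) = card (orbs \<sigma>1 Y) + card (orbs \<sigma>2 Z)"
    using sum_orbs_union[where f = "\<sigma>1 \<circ> \<sigma>2" and h = "\<lambda>_. 1::nat",
        OF \<sigma> fin disj agreeY[OF \<sigma>(2)] agreeZ[OF \<sigma>]] by simp
  moreover have "card (orbs (\<tau>1 \<circ> \<tau>2) (Y \<union> Z)) = card (orbs \<tau>1 Y) + card (orbs \<tau>2 Z)"
    using sum_orbs_union[where f = "\<tau>1 \<circ> \<tau>2" and h = "\<lambda>_. 1::nat",
        OF \<tau> fin disj agreeY[OF \<tau>(2)] agreeZ[OF \<tau>]] by simp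
  moreover have "cyc_mono (\<tau>1 \<circ> \<tau>2 \<circ> inv (\<sigma>1 \<circ> \<sigma>2)) (Y \<union> Z) = cyc_mono (\<tau>1 \<circ> inv \<sigma>1) Y + cyc_mono (\<tau>2 \<circ> inv \<sigma>2) Z"
    unfolding cyc_mono_def
  proof (rule sum_orbs_union)
    show "(\<tau>1 \<circ> \<tau>2 \<circ> inv (\<sigma>1 \<circ> \<sigma>2)) x = (\<tau>1 \<circ> inv \<sigma>1) x" if x: "x \<in> Y" for x
    proof -
      have i: "inv \<sigma>1 x \<in> Y" using x permutes_in_image[OF permutes_inv[OF \<sigma>(1)]] by simp
      have "inv \<sigma>2 (inv \<sigma>1 x) = inv \<sigma>1 x" using i disj permutes_not_in[OF permutes_inv[OF \<sigma>(2)]] by auto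
      moreover have "\<tau>2 (inv \<sigma>1 x) = inv \<sigma>1 x" using i disj permutes_not_in[OF \<tau>(2)] by auto
      ultimately show ?thesis by (simp add: inv)
    qed
    show "(\<tau>1 \<circ> \<tau>2 \<circ> inv (\<sigma>1 \<circ> \<sigma>2)) x = (\<tau>2 \<circ> inv \<sigma>2) x" if x: "x \<in> Z" for x
    proof -
      have "inv \<sigma>1 x = x" using x disj permutes_not_in[OF permutes_inv[OF \<sigma>(1)]] by auto
      moreover have "\<tau>2 (inv \<sigma>2 x) \<in> Z"
        using x permutes_in_image[OF permutes_inv[OF \<sigma>(2)]] permutes_in_image[OF \<tau>(2)] by simp
      hence "\<tau>1 (\<tau>2 (inv \<sigma>2 x)) = \<tau>2 (inv \<sigma>2 x)" using disj permutes_not_in[OF \<tau>(1)] by auto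
      ultimately show ?thesis by (simp add: inv)
    qed
  qed (use assms in \<open>auto intro: permutes_compose permutes_inv\<close>)
  moreover have "card (Y \<union> Z) = card Y + card Z" using fin disj by (rule card_Un_disjoint)
  ultimately show ?thesis by (simp add: wt_def single_add add_ac)
qed

lemma perm_restrict_permutes:
  assumes "f permutes X" "Y \<subseteq> X" "finite Y" "f ` Y \<subseteq> Y"
  shows "perm_restrict f Y permutes Y" "f ` Y = Y"
proof -
  have inj: "inj_on f Y" by (rule inj_on_subset[OF permutes_inj[OF assms(1)]]) simp
  show "f ` Y = Y" by (rule endo_inj_surj[OF assms(3,4) inj])
  hence "bij_betw (perm_restrict f Y) Y Y"
    using inj by (auto simp: bij_betw_def perm_restrict_def inj_on_def)
  thus "perm_restrict f Y permutes Y"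
    by (rule bij_imp_permutes) (simp add: perm_restrict_def)
qed

lemma perm_restrict_decompose:
  assumes f: "f permutes X" and X: "finite X" and Y: "Y \<subseteq> X" "f ` Y \<subseteq> Y"
  shows "perm_restrict f (X - Y) permutes (X - Y)" "perm_restrict f Y \<circ> perm_restrict f (X - Y) = f"
proof -
  have fin: "finite Y" using X Y(1) finite_subset by blast
  note r = perm_restrict_permutes[OF f Y(1) fin Y(2)]
  have "f ` (X - Y) = X - Y"
    using permutes_inj[OF f] permutes_image[OF f] r(2) by (simp add: image_set_diff)
  thus 1: "perm_restrict f (X - Y) permutes (X - Y)"
    using X by (intro perm_restrict_permutes(1)[OF f]) auto
  show "perm_restrict f Y \<circ> perm_restrict f (X - Y) = f"
  proof -
    have "perm_restrict f Y \<circ> perm_restrict f (X - Y) = perm_restrict f (Y \<union> (X - Y))"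
      by (rule perm_restrict_union[OF r(1) 1]) auto
    also have "Y \<union> (X - Y) = X" using Y(1) by auto
    finally show ?thesis unfolding perm_restrict_id[OF f] .
  qed
qed

lemma perm_restrict_compose:
  assumes "f permutes Y" "g permutes Z" "Y \<inter> Z = {}"
  shows "perm_restrict (f \<circ> g) Y = f" "perm_restrict (f \<circ> g) Z = g"
proof -
  show "perm_restrict (f \<circ> g) Y = f"
  proof
    fix x
    have "g x = x" if "x \<in> Y"
    proof -
      have "x \<notin> Z" using that assms(3) by auto
      thus ?thesis by (rule permutes_not_in[OF assms(2)])
    qed
    thus "perm_restrict (f \<circ> g) Y x = f x"
      using permutes_not_in[OF assms(1), of x] by (simp add: perm_restrict_def)
  qed
  show "perm_restrict (f \<circ> g) Z = g"
  proof
    fix x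
    have "f (g x) = g x" if "x \<in> Z"
    proof -
      have "g x \<notin> Y" using that assms(3) permutes_in_image[OF assms(2)] by auto
      thus ?thesis by (rule permutes_not_in[OF assms(1)])
    qed
    thus "perm_restrict (f \<circ> g) Z x = g x"
      using permutes_not_in[OF assms(2), of x] by (simp add: perm_restrict_def)
  qed
qed

text \<open>A pair of permutations of \<open>X\<close> is a transitive pair on the orbit \<open>Y\<close> of \<open>x0\<close>
  together with an arbitrary pair on the complement of \<open>Y\<close>.\<close>
lemma all_pairs_decompose:
  assumes X: "finite X" and x0: "x0 \<in> X"
  shows "all_pairs X \<alpha> = (\<Sum>Y | Y \<subseteq> X \<and> x0 \<in> Y. fmul (trans_pairs Y) (all_pairs (X - Y)) \<alpha>)"
proof -
  let ?Ys = "{Y. Y \<subseteq> X \<and> x0 \<in> Y}"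
  let ?D = "SIGMA Y:?Ys. trans_perm_pairs Y \<times> perm_pairs (X - Y)"
  have fin: "finite Y" if "Y \<subseteq> X" for Y using that X by (rule finite_subset)
  have finYs: "finite ?Ys" using X by simp
  define glue :: "'a set \<times> (('a \<Rightarrow> 'a) \<times> ('a \<Rightarrow> 'a)) \<times> (('a \<Rightarrow> 'a) \<times> ('a \<Rightarrow> 'a)) \<Rightarrow> ('a \<Rightarrow> 'a) \<times> ('a \<Rightarrow> 'a)"
    where "glue = (\<lambda>(Y, (\<sigma>1, \<tau>1), (\<sigma>2, \<tau>2)). (\<sigma>1 \<circ> \<sigma>2, \<tau>1 \<circ> \<tau>2))"
  define orb :: "('a \<Rightarrow> 'a) \<times> ('a \<Rightarrow> 'a) \<Rightarrow> 'a set" where "orb = (\<lambda>(\<sigma>, \<tau>). {y. conn \<sigma> \<tau> x0 y})"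
  define cut :: "('a \<Rightarrow> 'a) \<times> ('a \<Rightarrow> 'a) \<Rightarrow> 'a set \<times> (('a \<Rightarrow> 'a) \<times> ('a \<Rightarrow> 'a)) \<times> (('a \<Rightarrow> 'a) \<times> ('a \<Rightarrow> 'a))"
    where "cut = (\<lambda>(\<sigma>, \<tau>). (orb (\<sigma>, \<tau>),
      (perm_restrict \<sigma> (orb (\<sigma>, \<tau>)), perm_restrict \<tau> (orb (\<sigma>, \<tau>))),
      (perm_restrict \<sigma> (X - orb (\<sigma>, \<tau>)), perm_restrict \<tau> (X - orb (\<sigma>, \<tau>)))))"
  have orb: "orb p \<in> ?Ys \<and> fst p ` orb p \<subseteq> orb p \<and> snd p ` orb p \<subseteq> orb p" if p: "p \<in> perm_pairs X" for p
  proof -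
    obtain \<sigma> \<tau> where st: "p = (\<sigma>, \<tau>)" "\<sigma> permutes X" "\<tau> permutes X"
      using p by (auto simp: perm_pairs_def)
    have "y \<in> X" if "conn \<sigma> \<tau> x0 y" for y
      using conn_cong[OF that x0, of \<sigma> \<tau>] st permutes_in_image by metis
    thus ?thesis by (auto simp: orb_def st conn_refl intro: conn_trans conn_step)
  qed
  have cut_in: "cut p \<in> ?D \<and> glue (cut p) = p" if p: "p \<in> perm_pairs X" for p
  proof -
    obtain \<sigma> \<tau> where st: "p = (\<sigma>, \<tau>)" "\<sigma> permutes X" "\<tau> permutes X"
      using p by (auto simp: perm_pairs_def)
    let ?Y = "orb (\<sigma>, \<tau>)"
    have Y: "?Y \<subseteq> X" "x0 \<in> ?Y" "\<sigma> ` ?Y \<subseteq> ?Y" "\<tau> ` ?Y \<subseteq> ?Y" using orb[OF p] by (auto simp: st)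
    note r\<sigma> = perm_restrict_permutes[OF st(2) Y(1) fin[OF Y(1)] Y(3)] perm_restrict_decompose[OF st(2) X Y(1,3)]
    note r\<tau> = perm_restrict_permutes[OF st(3) Y(1) fin[OF Y(1)] Y(4)] perm_restrict_decompose[OF st(3) X Y(1,4)]
    let ?s = "perm_restrict \<sigma> ?Y" and ?t = "perm_restrict \<tau> ?Y"
    \<comment> \<open>Walks from \<open>x0\<close> never leave its orbit, so the restricted pair is
      still transitive there.\<close>
    have to: "conn ?s ?t x0 y" if "y \<in> ?Y" for y
    proof -
      have "conn \<sigma> \<tau> x0 y" using that by (simp add: orb_def)
      moreover have "?s z = \<sigma> z \<and> \<sigma> z \<in> ?Y" "?t z = \<tau> z \<and> \<tau> z \<in> ?Y" if "z \<in> ?Y" for z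
        using that Y(3,4) by (auto simp: perm_restrict_def)
      ultimately show ?thesis using conn_cong[of \<sigma> \<tau> x0 y ?Y ?s ?t] Y(2) by blast
    qed
    have perm: "permutation ?s" "permutation ?t"
      using r\<sigma>(1) r\<tau>(1) fin[OF Y(1)] by (auto intro: permutes_permutation)
    have "trans_on ?Y ?s ?t"
      unfolding trans_on_def using to conn_sym[OF perm] conn_trans by metis
    thus ?thesis
      using Y(1,2) r\<sigma> r\<tau> by (simp add: cut_def glue_def st trans_perm_pairs_def perm_pairs_def)
  qed
  have glue_in: "glue q \<in> perm_pairs X \<and> cut (glue q) = q \<and>
      (case glue q of (\<sigma>, \<tau>) \<Rightarrow> fmon (wt X \<sigma> \<tau>) \<alpha>) =
      (case q of (Y, (\<sigma>1, \<tau>1), (\<sigma>2, \<tau>2)) \<Rightarrow> fmon (wt Y \<sigma>1 \<tau>1 + wt (X - Y) \<sigma>2 \<tau>2) \<alpha>)"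
    if q: "q \<in> ?D" for q
  proof -
    obtain Y \<sigma>1 \<tau>1 \<sigma>2 \<tau>2 where q_eq: "q = (Y, (\<sigma>1, \<tau>1), (\<sigma>2, \<tau>2))" by (metis prod.exhaust)
    have Y: "Y \<subseteq> X" "x0 \<in> Y" and p: "\<sigma>1 permutes Y" "\<tau>1 permutes Y" "\<sigma>2 permutes (X - Y)" "\<tau>2 permutes (X - Y)"
      and tr: "trans_on Y \<sigma>1 \<tau>1"
      using q by (auto simp: q_eq trans_perm_pairs_def perm_pairs_def)
    have YX: "Y \<union> (X - Y) = X" "Y \<inter> (X - Y) = {}" using Y by auto
    let ?s = "\<sigma>1 \<circ> \<sigma>2" and ?t = "\<tau>1 \<circ> \<tau>2"
    have sX: "?s permutes X" "?t permutes X"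
      using p Y(1) by (auto intro!: permutes_compose elim!: permutes_subset)
    have eqY: "?s z = \<sigma>1 z" "?t z = \<tau>1 z" "\<sigma>1 z \<in> Y" "\<tau>1 z \<in> Y" if "z \<in> Y" for z
      using that p permutes_not_in[OF p(3), of z] permutes_not_in[OF p(4), of z] by (auto simp: permutes_in_image)
    \<comment> \<open>The glued pair remembers its block as the orbit of \<open>x0\<close>, so
      gluing is injective.\<close>
    have "orb (?s, ?t) = Y"
    proof (intro equalityI subsetI)
      fix y assume "y \<in> orb (?s, ?t)"
      thus "y \<in> Y" using conn_cong[of ?s ?t x0 y Y ?s ?t] Y(2) eqY by (auto simp: orb_def)
    next
      fix y assume "y \<in> Y"
      hence "conn \<sigma>1 \<tau>1 x0 y" using tr Y(2) by (auto simp: trans_on_def)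
      thus "y \<in> orb (?s, ?t)" using conn_cong[of \<sigma>1 \<tau>1 x0 y Y ?s ?t] Y(2) eqY by (auto simp: orb_def)
    qed
    hence "cut (?s, ?t) = q"
      unfolding cut_def q_eq
      using perm_restrict_compose[OF p(1,3) YX(2)] perm_restrict_compose[OF p(2,4) YX(2)] by simp
    moreover have "wt X ?s ?t = wt Y \<sigma>1 \<tau>1 + wt (X - Y) \<sigma>2 \<tau>2"
      using wt_union[OF p(1,3,2,4) fin[OF Y(1)] _ YX(2)] X unfolding YX(1) by simp
    ultimately show ?thesis using sX by (simp add: glue_def q_eq perm_pairs_def)
  qed
  have "all_pairs X \<alpha> = (\<Sum>q\<in>?D. case q of (Y, (\<sigma>1, \<tau>1), (\<sigma>2, \<tau>2)) \<Rightarrow> fmon (wt Y \<sigma>1 \<tau>1 + wt (X - Y) \<sigma>2 \<tau>2) \<alpha>)"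
    unfolding all_pairs_eq
  proof (rule sum.reindex_bij_witness[of _ glue cut], goal_cases)
    case (1 p) thus ?case using cut_in by blast
  next
    case (2 p) thus ?case using cut_in by blast
  next
    case (3 q) thus ?case using glue_in by blast
  next
    case (4 q) thus ?case using glue_in by blast
  next
    case (5 p)
    have D: "cut p \<in> ?D" and g: "glue (cut p) = p" using cut_in[OF 5] by auto
    show ?case using glue_in[OF D] unfolding g by simp
  qed
  also have "\<dots> = (\<Sum>Y\<in>?Ys. \<Sum>(p, q)\<in>trans_perm_pairs Y \<times> perm_pairs (X - Y).
      fmon (wt Y (fst p) (snd p) + wt (X - Y) (fst q) (snd q)) \<alpha>)"
    using finYs fin X by (subst sum.Sigma) (auto simp: case_prod_unfold)
  also have "\<dots> = (\<Sum>Y\<in>?Ys. fmul (trans_pairs Y) (all_pairs (X - Y)) \<alpha>)"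
  proof (rule sum.cong[OF refl])
    fix Y assume "Y \<in> ?Ys"
    have "fmul (trans_pairs Y) (all_pairs (X - Y)) \<alpha> =
      (\<Sum>p\<in>trans_perm_pairs Y. \<Sum>q\<in>perm_pairs (X - Y).
        fmul (fmon (wt Y (fst p) (snd p))) (fmon (wt (X - Y) (fst q) (snd q))) \<alpha>)"
      unfolding trans_pairs_def all_pairs_eq[abs_def] case_prod_unfold fmul_sum_left fmul_sum_right ..
    thus "(\<Sum>(p, q)\<in>trans_perm_pairs Y \<times> perm_pairs (X - Y).
      fmon (wt Y (fst p) (snd p) + wt (X - Y) (fst q) (snd q)) \<alpha>) = fmul (trans_pairs Y) (all_pairs (X - Y)) \<alpha>"
      by (simp add: fmul_fmon_fmon sum.cartesian_product)
  qed
  finally show ?thesis .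
qed

lemma sum_subsets_containing:
  fixes g :: "nat \<Rightarrow> real"
  assumes X: "finite X" and x0: "x0 \<in> X"
  shows "(\<Sum>Y | Y \<subseteq> X \<and> x0 \<in> Y. g (card Y)) = (\<Sum>k\<le>card X - 1. real ((card X - 1) choose k) * g (Suc k))"
proof -
  let ?A = "X - {x0}"
  have fin: "finite ?A" using X by simp
  have "(\<Sum>Y | Y \<subseteq> X \<and> x0 \<in> Y. g (card Y)) = (\<Sum>B\<in>Pow ?A. g (Suc (card B)))"
  proof (rule sum.reindex_bij_witness[of _ "insert x0" "\<lambda>Y. Y - {x0}"])
    fix Y assume "Y \<in> {Y. Y \<subseteq> X \<and> x0 \<in> Y}"
    hence "finite Y" "x0 \<in> Y" using X finite_subset by auto
    hence "Suc (card (Y - {x0})) = card Y" by (metis card.remove)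
    thus "g (Suc (card (Y - {x0}))) = g (card Y)" by simp
  qed (use x0 in auto)
  also have "\<dots> = (\<Sum>k\<le>card ?A. \<Sum>B\<in>{B \<in> Pow ?A. card B = k}. g (Suc (card B)))"
    using fin by (intro sum.group[symmetric]) (auto intro: card_mono)
  also have "\<dots> = (\<Sum>k\<le>card ?A. real (card ?A choose k) * g (Suc k))"
  proof (rule sum.cong[OF refl])
    fix k
    have "(\<Sum>B\<in>{B \<in> Pow ?A. card B = k}. g (Suc (card B))) = (\<Sum>B\<in>{B \<in> Pow ?A. card B = k}. g (Suc k))"
      by (rule sum.cong) auto
    also have "\<dots> = real (card {B. B \<subseteq> ?A \<and> card B = k}) * g (Suc k)" by simp
    finally show "(\<Sum>B\<in>{B \<in> Pow ?A. card B = k}. g (Suc (card B))) = real (card ?A choose k) * g (Suc k)"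
      by (simp only: n_subsets[OF fin])
  qed
  also have "card ?A = card X - 1" using X x0 by simp
  finally show ?thesis .
qed

text \<open>\<open>n!\<close> times the part of \<open>S\<close>-degree \<open>n\<close> of
  \<open>Z\<close>; for \<open>n > 0\<close>, \<open>trans_series\<close> is the same for
  \<open>F\<close>.\<close>

definition pair_series :: "nat \<Rightarrow> fps" where "pair_series n = all_pairs {..<n}"

definition trans_series :: "nat \<Rightarrow> fps" where "trans_series n = trans_pairs {..<n}"

lemma pair_series_0: "pair_series 0 = fmon 0"
  by (simp add: pair_series_def all_pairs_empty)

lemma pair_series_Suc: "pair_series (Suc n) = fmul (fvar S) (Aop (pair_series n))"
  by (simp add: pair_series_def lessThan_Suc all_pairs_insert)

lemma all_pairs_card: "finite X \<Longrightarrow> all_pairs X = pair_series (card X)"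
  by (induction rule: finite_induct) (simp_all add: pair_series_0 all_pairs_empty all_pairs_insert pair_series_Suc)

text \<open>No bijection is transported. The sum over all pairs depends only on the cardinality, by
  the insertion recursion; in its decomposition by the block of a point, the full set contributes
  the transitive sum, and smaller blocks are covered by induction.\<close>

lemma trans_pairs_card:
  fixes X :: "nat set"
  assumes "finite X" "X \<noteq> {}"
  shows "trans_pairs X = trans_series (card X)"
  using assms
proof (induction "card X" arbitrary: X rule: less_induct)
  case (less X)
  \<comment> \<open>Apart from \<open>trans_pairs Z\<close>, everything here depends only on the
    cardinality of \<open>Z\<close>. The subtracted product is the block \<open>Y = Z\<close>, which
    the binomial sum also counts.\<close>
  have step: "pair_series (card Z) \<alpha> = trans_pairs Z \<alpha> +
      ((\<Sum>k\<le>card Z - 1. real ((card Z - 1) choose k) * fmul (trans_series (Suc k)) (pair_series (card Z - Suc k)) \<alpha>)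
        - fmul (trans_series (card Z)) (pair_series 0) \<alpha>)"
    if Z: "finite Z" "z0 \<in> Z" "card Z = card X" for Z :: "nat set" and z0 \<alpha>
  proof -
    let ?Ys = "{Y. Y \<subseteq> Z \<and> z0 \<in> Y}"
    let ?g = "\<lambda>m. fmul (trans_series m) (pair_series (card Z - m)) \<alpha>"
    have fin: "finite ?Ys" and ZYs: "Z \<in> ?Ys" using Z by auto
    have "pair_series (card Z) \<alpha> = (\<Sum>Y\<in>?Ys. fmul (trans_pairs Y) (all_pairs (Z - Y)) \<alpha>)"
      using all_pairs_decompose[OF Z(1,2)] all_pairs_card[OF Z(1)] by simp
    also have "\<dots> = trans_pairs Z \<alpha> + (\<Sum>Y\<in>?Ys - {Z}. fmul (trans_pairs Y) (all_pairs (Z - Y)) \<alpha>)"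
      using sum.remove[OF fin ZYs, of "\<lambda>Y. fmul (trans_pairs Y) (all_pairs (Z - Y)) \<alpha>"]
      by (simp add: all_pairs_empty)
    also have "(\<Sum>Y\<in>?Ys - {Z}. fmul (trans_pairs Y) (all_pairs (Z - Y)) \<alpha>) = (\<Sum>Y\<in>?Ys - {Z}. ?g (card Y))"
    proof (rule sum.cong[OF refl])
      fix Y assume Y: "Y \<in> ?Ys - {Z}"
      hence "Y \<subset> Z" by auto
      hence "card Y < card X" using psubset_card_mono[OF Z(1)] Z(3) by simp
      moreover have finY: "finite Y" using Y Z(1) finite_subset by auto
      moreover have "Y \<noteq> {}" using Y by auto
      ultimately have "trans_pairs Y = trans_series (card Y)" by (intro less.hyps)
      moreover have "all_pairs (Z - Y) = pair_series (card Z - card Y)"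
        using Y Z(1) finY by (simp add: all_pairs_card card_Diff_subset)
      ultimately show "fmul (trans_pairs Y) (all_pairs (Z - Y)) \<alpha> = ?g (card Y)" by simp
    qed
    also have "\<dots> = (\<Sum>Y\<in>?Ys. ?g (card Y)) - ?g (card Z)"
      using sum.remove[OF fin ZYs, of "\<lambda>Y. ?g (card Y)"] by simp
    also have "(\<Sum>Y\<in>?Ys. ?g (card Y)) = (\<Sum>k\<le>card Z - 1. real ((card Z - 1) choose k) * ?g (Suc k))"
      by (rule sum_subsets_containing[OF Z(1,2)])
    finally show ?thesis by simp
  qed
  obtain x where x: "x \<in> X" using less.prems by auto
  have "0 < card X" using less.prems by (simp add: card_gt_0_iff)
  hence "trans_pairs X \<alpha> = trans_pairs {..<card X} \<alpha>" for \<alpha>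
    using step[OF less.prems(1) x refl, of \<alpha>] step[of "{..<card X}" 0 \<alpha>] by simp
  thus ?case by (simp add: trans_series_def fun_eq_iff)
qed

text \<open>The block of the point 0 contains \<open>k\<close> of the other \<open>n\<close> points.
  This is the coefficient form of \<open>Z' = F' Z\<close>.\<close>

lemma pair_series_Suc_exponential:
  "pair_series (Suc n) \<alpha> = (\<Sum>k\<le>n. real (n choose k) * fmul (trans_series (Suc k)) (pair_series (n - k)) \<alpha>)"
proof -
  let ?X = "{..<Suc n}"
  let ?Ys = "{Y. Y \<subseteq> ?X \<and> 0 \<in> Y}"
  have "pair_series (Suc n) \<alpha> = (\<Sum>Y\<in>?Ys. fmul (trans_pairs Y) (all_pairs (?X - Y)) \<alpha>)"
    unfolding pair_series_def by (rule all_pairs_decompose) auto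
  also have "\<dots> = (\<Sum>Y\<in>?Ys. fmul (trans_series (card Y)) (pair_series (Suc n - card Y)) \<alpha>)"
  proof (rule sum.cong[OF refl])
    fix Y assume Y: "Y \<in> ?Ys"
    hence fin: "finite Y" "Y \<noteq> {}" using finite_subset[of Y ?X] by auto
    have "all_pairs (?X - Y) = pair_series (Suc n - card Y)"
      using Y fin by (simp add: all_pairs_card card_Diff_subset)
    thus "fmul (trans_pairs Y) (all_pairs (?X - Y)) \<alpha> = fmul (trans_series (card Y)) (pair_series (Suc n - card Y)) \<alpha>"
      by (simp add: trans_pairs_card[OF fin])
  qed
  also have "\<dots> = (\<Sum>k\<le>card ?X - 1. real ((card ?X - 1) choose k) * fmul (trans_series (Suc k)) (pair_series (Suc n - Suc k)) \<alpha>)"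
    by (rule sum_subsets_containing) auto
  finally show ?thesis by simp
qed

lemma pair_series_support: "pair_series n \<alpha> \<noteq> 0 \<Longrightarrow> lk \<alpha> S = n"
proof (rule ccontr)
  assume "pair_series n \<alpha> \<noteq> 0" "lk \<alpha> S \<noteq> n"
  moreover have "pair_series n \<alpha> = 0" if "lk \<alpha> S \<noteq> n"
    unfolding pair_series_def all_pairs_eq using that
    by (intro sum.neutral) (auto simp: fmon_def lookup_wt)
  ultimately show False by simp
qed

lemma trans_series_support: "trans_series n \<alpha> \<noteq> 0 \<Longrightarrow> lk \<alpha> S = n"
proof (rule ccontr)
  assume "trans_series n \<alpha> \<noteq> 0" "lk \<alpha> S \<noteq> n"
  moreover have "trans_series n \<alpha> = 0" if "lk \<alpha> S \<noteq> n"
    unfolding trans_series_def trans_pairs_def using that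
    by (intro sum.neutral) (auto simp: fmon_def lookup_wt)
  ultimately show False by simp
qed

section \<open>The two generating functions and their differential equations\<close>

definition Z_pairs :: fps where
  "Z_pairs = (\<lambda>\<alpha>. pair_series (lk \<alpha> S) \<alpha> / fact (lk \<alpha> S))"

text \<open>Degree 0 is excluded by hand: the pair on the empty set is vacuously transitive and
  would contribute a constant term 1.\<close>

definition F_pairs :: fps where
  "F_pairs = (\<lambda>\<alpha>. if lk \<alpha> S = 0 then 0 else trans_series (lk \<alpha> S) \<alpha> / fact (lk \<alpha> S))"

lemma exp_sA_one_eq_Z_pairs: "exp_sA_one = Z_pairs"
proof
  fix \<alpha>
  have "((\<lambda>G. fmul (fvar S) (Aop G)) ^^ n) (fconst 1) = pair_series n" for n
    by (simp add: pair_series_def all_pairs_funpow)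
  hence "exp_sA_one \<alpha> = Sum_any (\<lambda>n. pair_series n \<alpha> / fact n)" by (simp add: exp_sA_one_def)
  also have "\<dots> = (\<Sum>n\<in>{lk \<alpha> S}. pair_series n \<alpha> / fact n)"
    by (rule Sum_any.expand_superset) (auto dest: pair_series_support)
  finally show "exp_sA_one \<alpha> = Z_pairs \<alpha>" by (simp add: Z_pairs_def)
qed

lemma fderiv_S_Z_pairs: "fderiv S Z_pairs \<alpha> = pair_series (Suc (lk \<alpha> S)) (\<alpha> + sg S) / fact (lk \<alpha> S)"
  by (simp add: fderiv_def Z_pairs_def lookup_add field_simps del: of_nat_Suc)

text \<open>\<open>Aop_sum\<close> covers finite sums, so \<open>Z_pairs\<close> is first truncated
  at the \<open>S\<close>-degree of the coefficient considered, which \<open>agree_Aop\<close>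
  permits. Term by term the claim is then the recursion \<open>pair_series_Suc\<close>.\<close>

lemma fderiv_S_Z_pairs_Aop: "fderiv S Z_pairs = Aop Z_pairs"
proof
  fix \<alpha> :: mono
  define n where "n = lk \<alpha> S"
  define Zn where "Zn = (\<lambda>\<alpha>. \<Sum>m\<le>n. fscale (1 / fact m) (pair_series m) \<alpha>)"
  have "agree n Z_pairs Zn"
    unfolding agree_def
  proof (intro allI impI)
    fix \<beta> assume b: "lk \<beta> S \<le> n"
    have "Zn \<beta> = (\<Sum>m\<in>{lk \<beta> S}. fscale (1 / fact m) (pair_series m) \<beta>)"
      unfolding Zn_def using b
      by (intro sum.mono_neutral_right) (auto simp: fscale_apply dest: pair_series_support)
    thus "Z_pairs \<beta> = Zn \<beta>" by (simp add: Z_pairs_def fscale_apply)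
  qed
  hence "Aop Z_pairs \<alpha> = Aop Zn \<alpha>" using agree_Aop by (auto simp: agree_def n_def)
  also have "\<dots> = (\<Sum>m\<le>n. Aop (pair_series m) \<alpha> / fact m)"
  proof -
    have "Aop Zn = (\<lambda>\<alpha>. \<Sum>m\<le>n. Aop (fscale (1 / fact m) (pair_series m)) \<alpha>)"
      unfolding Zn_def by (rule Aop_sum) simp
    thus ?thesis by (simp add: Aop_fscale fscale_apply)
  qed
  also have "\<dots> = (\<Sum>m\<le>n. pair_series (Suc m) (\<alpha> + sg S) / fact m)"
    by (simp add: pair_series_Suc fvar_eq_fmon)
  also have "\<dots> = (\<Sum>m\<in>{n}. pair_series (Suc m) (\<alpha> + sg S) / fact m)"
  proof (rule sum.mono_neutral_right)
    show "\<forall>m\<in>{..n} - {n}. pair_series (Suc m) (\<alpha> + sg S) / fact m = 0"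
    proof
      fix m assume "m \<in> {..n} - {n}"
      hence "lk (\<alpha> + sg S) S \<noteq> Suc m" by (simp add: lookup_add n_def)
      hence "pair_series (Suc m) (\<alpha> + sg S) = 0" using pair_series_support by blast
      thus "pair_series (Suc m) (\<alpha> + sg S) / fact m = 0" by simp
    qed
  qed auto
  finally show "fderiv S Z_pairs \<alpha> = Aop Z_pairs \<alpha>" by (simp add: fderiv_S_Z_pairs n_def)
qed

lemma fderiv_S_Z_pairs_exponential: "fderiv S Z_pairs = fmul (fderiv S F_pairs) Z_pairs"
proof
  fix \<alpha> :: mono
  define n where "n = lk \<alpha> S"
  \<comment> \<open>\<open>trans_series (Suc k)\<close> divided by \<open>S\<close>, so that the
    shift by \<open>sg S\<close> can be removed from the product.\<close>
  define G where "G = (\<lambda>k \<beta>. trans_series (Suc k) (\<beta> + sg S))"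
  have trans_series_eq: "trans_series (Suc k) = fmul (fmon (sg S)) (G k)" for k
  proof
    fix \<beta>
    show "trans_series (Suc k) \<beta> = fmul (fmon (sg S)) (G k) \<beta>"
    proof (cases "lk \<beta> S = 0")
      case True
      hence "\<not> lk (sg S) S \<le> lk \<beta> S" by simp
      hence "sg S \<notin> below \<beta>" unfolding below_def by blast
      moreover have "trans_series (Suc k) \<beta> = 0" using True trans_series_support[of "Suc k" \<beta>] by auto
      ultimately show ?thesis by (simp add: fmul_fmon)
    next
      case False
      have "sg S \<in> below \<beta>" using False by (auto simp: below_def lookup_single when_def)
      thus ?thesis using mono_minus_add[OF False] by (simp only: fmul_fmon G_def if_True)
    qed
  qed
  have "fderiv S Z_pairs \<alpha> = (\<Sum>k\<le>n. real (n choose k) / fact n * fmul (G k) (pair_series (n - k)) \<alpha>)"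
    unfolding fderiv_S_Z_pairs n_def[symmetric] pair_series_Suc_exponential
    by (simp add: trans_series_eq fmul_assoc sum_divide_distrib)
  \<comment> \<open>\<open>(n choose k) / n! = 1 / (k! (n - k)!)\<close> separates the
    normalisations of the two factors.\<close>
  also have "\<dots> = (\<Sum>k\<le>n. \<Sum>(\<beta>, \<gamma>)\<in>splits \<alpha>. G k \<beta> / fact k * (pair_series (n - k) \<gamma> / fact (n - k)))"
    unfolding fmul_splits sum_distrib_left
    by (intro sum.cong refl) (auto simp: binomial_fact field_simps)
  also have "\<dots> = (\<Sum>p\<in>splits \<alpha>. \<Sum>k\<le>n. G k (fst p) / fact k * (pair_series (n - k) (snd p) / fact (n - k)))"
    by (subst sum.swap) (simp add: case_prod_unfold)
  also have "\<dots> = (\<Sum>(\<beta>, \<gamma>)\<in>splits \<alpha>. fderiv S F_pairs \<beta> * Z_pairs \<gamma>)"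
  proof (intro sum.cong refl, unfold case_prod_unfold)
    fix p assume p: "p \<in> splits \<alpha>"
    obtain b c where bc: "p = (b, c)" by force
    let ?b = "lk b S"
    have n: "?b \<le> n" "n - ?b = lk c S" using p by (auto simp: bc splits_def n_def lookup_add)
    \<comment> \<open>Only \<open>k\<close> equal to the \<open>S\<close>-degree of \<open>b\<close>
      survives, so the sum over \<open>k\<close> collapses to one product of coefficients.\<close>
    have "G k b = 0" if "k \<noteq> ?b" for k
    proof -
      have "lk (b + sg S) S \<noteq> Suc k" using that by (simp add: lookup_add)
      thus ?thesis unfolding G_def using trans_series_support by blast
    qed
    hence "(\<Sum>k\<le>n. G k b / fact k * (pair_series (n - k) c / fact (n - k)))
        = (\<Sum>k\<in>{?b}. G k b / fact k * (pair_series (n - k) c / fact (n - k)))"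
      using n(1) by (intro sum.mono_neutral_right) auto
    also have "\<dots> = fderiv S F_pairs b * Z_pairs c"
      by (simp add: n(2) Z_pairs_def G_def fderiv_def F_pairs_def lookup_add field_simps del: of_nat_Suc)
    finally show "(\<Sum>k\<le>n. G k (fst p) / fact k * (pair_series (n - k) (snd p) / fact (n - k)))
        = fderiv S F_pairs (fst p) * Z_pairs (snd p)" by (simp add: bc)
  qed
  also have "\<dots> = fmul (fderiv S F_pairs) Z_pairs \<alpha>" by (simp add: fmul_splits)
  finally show "fderiv S Z_pairs \<alpha> = fmul (fderiv S F_pairs) Z_pairs \<alpha>" .
qed

lemma F_pairs_S_0: "lk \<alpha> S = 0 \<Longrightarrow> F_pairs \<alpha> = 0"
  by (simp add: F_pairs_def)

text \<open>Both series solve the linear equation \<open>Y' = F' Y\<close> and equal 1 at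
  \<open>S = 0\<close>.\<close>

lemma fexp_F_pairs: "fexp F_pairs = Z_pairs"
proof (rule evolution_unique[where \<Phi> = "fmul (fderiv S F_pairs)"])
  show "fderiv S (fexp F_pairs) = fmul (fderiv S F_pairs) (fexp F_pairs)"
    by (rule fderiv_fexp[OF F_pairs_S_0])
  show "fderiv S Z_pairs = fmul (fderiv S F_pairs) Z_pairs"
    by (rule fderiv_S_Z_pairs_exponential)
  show "fexp F_pairs \<alpha> = Z_pairs \<alpha>" if "lk \<alpha> S = 0" for \<alpha>
    using that by (simp add: fexp_S_0[OF F_pairs_S_0] Z_pairs_def pair_series_0)
qed (intro agree_fmul agree_refl)

lemma F_pairs_evolution: "fderiv S F_pairs = cj_rhs F_pairs"
proof (rule fmul_left_cancel)
  show "fexp F_pairs 0 \<noteq> 0" by (simp add: fexp_S_0[OF F_pairs_S_0] fmon_def)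
  have "fmul (fexp F_pairs) (fderiv S F_pairs) = fderiv S (fexp F_pairs)"
    by (simp add: fderiv_fexp[OF F_pairs_S_0] fmul_commute)
  also have "\<dots> = Aop (fexp F_pairs)" by (simp add: fexp_F_pairs fderiv_S_Z_pairs_Aop)
  also have "\<dots> = fmul (fexp F_pairs) (cj_rhs F_pairs)" by (rule Aop_fexp[OF F_pairs_S_0])
  finally show "fmul (fexp F_pairs) (fderiv S F_pairs) = fmul (fexp F_pairs) (cj_rhs F_pairs)" .
qed

section \<open>Belyi graphs coded by pairs of permutations\<close>

text \<open>White and black vertices are numbered by the same green edges, hence the identity for
  green. Treating it as a third permutation allows one argument for all colours.\<close>

fun col_perm :: "(nat \<Rightarrow> nat) \<Rightarrow> (nat \<Rightarrow> nat) \<Rightarrow> colour \<Rightarrow> nat \<Rightarrow> nat" where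
  "col_perm \<sigma> \<tau> Green = id"
| "col_perm \<sigma> \<tau> Red = \<sigma>"
| "col_perm \<sigma> \<tau> Blue = \<tau>"

text \<open>The green edges are numbered by \<open>i < n\<close>; \<open>W i\<close> and \<open>B i\<close> are the ends of the i-th green
  edge, and \<open>E c i\<close> is the edge of colour \<open>c\<close> at \<open>W i\<close>.\<close>
locale coding =
  fixes n :: nat and \<sigma> \<tau> :: "nat \<Rightarrow> nat" and H :: bgraph
    and W B :: "nat \<Rightarrow> nat" and E :: "colour \<Rightarrow> nat \<Rightarrow> nat"
  assumes n_pos: "0 < n"
    and \<sigma>: "\<sigma> permutes {..<n}" and \<tau>: "\<tau> permutes {..<n}"
    and verts: "verts H = W ` {..<n} \<union> B ` {..<n}"
    and inj_W: "inj_on W {..<n}" and inj_B: "inj_on B {..<n}"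
    and edges: "edges H = (\<Union>c. E c ` {..<n})"
    and inj_E: "\<And>c. inj_on (E c) {..<n}"
    and white: "\<And>i. i < n \<Longrightarrow> is_white H (W i)" and black: "\<And>i. i < n \<Longrightarrow> \<not> is_white H (B i)"
    and wend: "\<And>c i. i < n \<Longrightarrow> wend H (E c i) = W i"
    and bend: "\<And>c i. i < n \<Longrightarrow> bend H (E c i) = B (col_perm \<sigma> \<tau> c i)"
    and ecol: "\<And>c i. i < n \<Longrightarrow> ecol H (E c i) = c"
begin

abbreviation "pm \<equiv> col_perm \<sigma> \<tau>"

lemma pm_permutes: "pm c permutes {..<n}"
  using \<sigma> \<tau> by (cases c) (auto simp: permutes_id)

lemma pm_less: "i < n \<Longrightarrow> pm c i < n" "i < n \<Longrightarrow> inv (pm c) i < n"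
  using permutes_in_image[OF pm_permutes] permutes_in_image[OF permutes_inv[OF pm_permutes]] by auto

lemma pm_inv [simp]: "pm c (inv (pm c) i) = i" "inv (pm c) (pm c i) = i"
  using permutes_inverses[OF pm_permutes] by auto

lemma W_eq_iff: "i < n \<Longrightarrow> j < n \<Longrightarrow> W i = W j \<longleftrightarrow> i = j"
  using inj_W by (auto dest: inj_onD)

lemma B_eq_iff: "i < n \<Longrightarrow> j < n \<Longrightarrow> B i = B j \<longleftrightarrow> i = j"
  using inj_B by (auto dest: inj_onD)

lemma W_neq_B: "i < n \<Longrightarrow> j < n \<Longrightarrow> W i \<noteq> B j"
  using white black by metis

lemma edge_cases: "e \<in> edges H \<longleftrightarrow> (\<exists>c i. i < n \<and> e = E c i)"
  using edges by auto

lemma adj_iff: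
  "adj H C x y \<longleftrightarrow> (\<exists>c\<in>C. \<exists>i<n. (x = W i \<and> y = B (pm c i)) \<or> (x = B (pm c i) \<and> y = W i))"
proof
  assume "adj H C x y"
  then obtain e where e: "e \<in> edges H" "ecol H e \<in> C"
    "(wend H e = x \<and> bend H e = y) \<or> (wend H e = y \<and> bend H e = x)" by (auto simp: adj_def)
  obtain c i where ci: "i < n" "e = E c i" using e(1) by (auto simp: edge_cases)
  show "\<exists>c\<in>C. \<exists>i<n. (x = W i \<and> y = B (pm c i)) \<or> (x = B (pm c i) \<and> y = W i)"
    using e ci wend bend ecol by (intro bexI[of _ c] exI[of _ i]) auto
next
  assume "\<exists>c\<in>C. \<exists>i<n. (x = W i \<and> y = B (pm c i)) \<or> (x = B (pm c i) \<and> y = W i)"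
  then obtain c i where ci: "c \<in> C" "i < n" "(x = W i \<and> y = B (pm c i)) \<or> (x = B (pm c i) \<and> y = W i)" by auto
  show "adj H C x y" unfolding adj_def
    by (rule bexI[of _ "E c i"]) (use ci wend bend ecol edge_cases in auto)
qed

lemma adj_WB: "c \<in> C \<Longrightarrow> i < n \<Longrightarrow> adj H C (W i) (B (pm c i))"
  and adj_BW: "c \<in> C \<Longrightarrow> i < n \<Longrightarrow> adj H C (B (pm c i)) (W i)"
  by (auto simp: adj_iff)

lemma reach_sym: "(adj H C)\<^sup>*\<^sup>* x y \<Longrightarrow> (adj H C)\<^sup>*\<^sup>* y x"
proof -
  have "symp (adj H C)" by (auto simp: symp_def adj_def)
  thus "(adj H C)\<^sup>*\<^sup>* x y \<Longrightarrow> (adj H C)\<^sup>*\<^sup>* y x" using symp_rtranclp by (metis sympD)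
qed

text \<open>The green edge joins \<open>W i\<close> to \<open>B i\<close>, so connectivity is a
  relation between indices, and an edge of colour \<open>c\<close> is a step of
  \<open>pm c\<close>.\<close>

lemma reach_iff_conn:
  assumes x: "x = W i \<or> x = B i" "i < n" and y: "y = W j \<or> y = B j" "j < n"
  shows "(adj H UNIV)\<^sup>*\<^sup>* x y \<longleftrightarrow> conn \<sigma> \<tau> i j"
proof
  have perm: "permutation \<sigma>" "permutation \<tau>" using \<sigma> \<tau> permutes_permutation by auto
  have "\<exists>j<n. (y = W j \<or> y = B j) \<and> conn \<sigma> \<tau> i j" if "(adj H UNIV)\<^sup>*\<^sup>* x y" for y
    using that
  proof (induction rule: rtranclp_induct)
    case base
    show ?case using x by (auto intro: conn_refl)
  next
    case (step y z)
    from step.IH obtain j where j: "j < n" "y = W j \<or> y = B j" "conn \<sigma> \<tau> i j" by blast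
    from step.hyps(2) obtain c k where k: "k < n" "(y = W k \<and> z = B (pm c k)) \<or> (y = B (pm c k) \<and> z = W k)"
      by (auto simp: adj_iff)
    have ck: "conn \<sigma> \<tau> k (pm c k)" by (cases c) (auto intro: conn_refl conn_step)
    from k(2) show ?case
    proof
      assume a: "y = W k \<and> z = B (pm c k)"
      hence "j = k" using j k W_eq_iff W_neq_B by metis
      thus ?thesis using a ck j k pm_less conn_trans by metis
    next
      \<comment> \<open>This edge is crossed against the direction of the permutation, hence the
        appeal to \<open>conn_sym\<close>.\<close>
      assume a: "y = B (pm c k) \<and> z = W k"
      hence "j = pm c k" using j k B_eq_iff W_neq_B pm_less by metis
      thus ?thesis using a ck j k conn_trans conn_sym[OF perm] by metis
    qed
  qed
  moreover assume "(adj H UNIV)\<^sup>*\<^sup>* x y"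
  ultimately obtain j' where "j' < n" "y = W j' \<or> y = B j'" "conn \<sigma> \<tau> i j'" by blast
  moreover from this have "j' = j" using y W_eq_iff B_eq_iff W_neq_B by metis
  ultimately show "conn \<sigma> \<tau> i j" by simp
next
  have WB: "(adj H UNIV)\<^sup>*\<^sup>* (W k) (B k)" if "k < n" for k
    using adj_WB[of Green UNIV k] that by auto
  have step: "(adj H UNIV)\<^sup>*\<^sup>* (W k) (W (pm c k))" if "k < n" for k c
  proof -
    have "(adj H UNIV)\<^sup>*\<^sup>* (W k) (B (pm c k))" using adj_WB[of c UNIV k] that by auto
    also have "(adj H UNIV)\<^sup>*\<^sup>* (B (pm c k)) (W (pm c k))" using WB pm_less that reach_sym by blast
    finally show ?thesis .
  qed
  assume "conn \<sigma> \<tau> i j"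
  hence "(adj H UNIV)\<^sup>*\<^sup>* (W i) (W j) \<and> j < n"
  proof (induction rule: conn_induct)
    case refl
    show ?case using x by simp
  next
    case (left y)
    thus ?case using step[of y Red] pm_less(1)[of y Red] by auto
  next
    case (right y)
    thus ?case using step[of y Blue] pm_less(1)[of y Blue] by auto
  qed
  moreover have "(adj H UNIV)\<^sup>*\<^sup>* x (W i)" using x WB reach_sym by blast
  moreover have "(adj H UNIV)\<^sup>*\<^sup>* (W j) y" using y WB by blast
  ultimately show "(adj H UNIV)\<^sup>*\<^sup>* x y" by (meson rtranclp_trans)
qed

lemma is_belyi_iff: "is_belyi H \<longleftrightarrow> trans_on {..<n} \<sigma> \<tau>"
proof
  assume "is_belyi H"
  hence "\<forall>x\<in>verts H. \<forall>y\<in>verts H. (adj H UNIV)\<^sup>*\<^sup>* x y" by (simp add: is_belyi_def)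
  hence "(adj H UNIV)\<^sup>*\<^sup>* (W i) (W j)" if "i < n" "j < n" for i j
    using that verts by auto
  hence "conn \<sigma> \<tau> i j" if "i < n" "j < n" for i j
    using that reach_iff_conn[of "W i" i "W j" j] by simp
  thus "trans_on {..<n} \<sigma> \<tau>" by (simp add: trans_on_def)
next
  assume tr: "trans_on {..<n} \<sigma> \<tau>"
  have "finite (verts H)" by (simp add: verts)
  moreover have "finite (edges H)"
  proof -
    have "UNIV = {Blue, Green, Red}" using colour.exhaust by auto
    hence "finite (UNIV :: colour set)" by (metis finite.emptyI finite_insert)
    thus ?thesis by (simp add: edges)
  qed
  moreover have "verts H \<noteq> {}" using n_pos by (auto simp: verts)
  moreover have "\<forall>e\<in>edges H. wend H e \<in> verts H \<and> bend H e \<in> verts H \<and>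
         is_white H (wend H e) \<and> \<not> is_white H (bend H e)"
    using wend bend white black pm_less by (auto simp: edge_cases verts)
  moreover have "\<exists>!e. e \<in> edges H \<and> ecol H e = c \<and> (wend H e = x \<or> bend H e = x)"
    if x: "x \<in> verts H" for x c
  proof -
    from x consider i where "i < n" "x = W i" | i where "i < n" "x = B i" by (auto simp: verts)
    thus ?thesis
    proof cases
      case (1 i)
      show ?thesis
      proof (rule ex1I[of _ "E c i"])
        show "E c i \<in> edges H \<and> ecol H (E c i) = c \<and> (wend H (E c i) = x \<or> bend H (E c i) = x)"
          using 1 wend ecol by (auto simp: edge_cases)
        fix e assume e: "e \<in> edges H \<and> ecol H e = c \<and> (wend H e = x \<or> bend H e = x)"
        then obtain c' k where k: "k < n" "e = E c' k" by (auto simp: edge_cases)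
        hence "c' = c" using e ecol by auto
        moreover have "k = i" using e k 1 wend bend W_eq_iff W_neq_B pm_less by metis
        ultimately show "e = E c i" using k by simp
      qed
    next
      case (2 i)
      \<comment> \<open>The edge of colour \<open>c\<close> at \<open>B i\<close> starts at the
        white vertex that \<open>pm c\<close> sends to \<open>i\<close>.\<close>
      let ?j = "inv (pm c) i"
      have j: "?j < n" using pm_less 2 by simp
      show ?thesis
      proof (rule ex1I[of _ "E c ?j"])
        show "E c ?j \<in> edges H \<and> ecol H (E c ?j) = c \<and> (wend H (E c ?j) = x \<or> bend H (E c ?j) = x)"
          using 2 j bend ecol by (auto simp: edge_cases)
        fix e assume e: "e \<in> edges H \<and> ecol H e = c \<and> (wend H e = x \<or> bend H e = x)"
        then obtain c' k where k: "k < n" "e = E c' k" by (auto simp: edge_cases)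
        hence c': "c' = c" using e ecol by auto
        have "pm c k = i" using e k 2 wend bend B_eq_iff W_neq_B pm_less c' by metis
        hence "k = ?j" by auto
        thus "e = E c ?j" using k c' by simp
      qed
    qed
  qed
  moreover have "\<forall>x\<in>verts H. \<forall>y\<in>verts H. (adj H UNIV)\<^sup>*\<^sup>* x y"
  proof (intro ballI)
    fix x y assume "x \<in> verts H" "y \<in> verts H"
    then obtain i j where ij: "x = W i \<or> x = B i" "i < n" "y = W j \<or> y = B j" "j < n"
      unfolding verts by blast
    thus "(adj H UNIV)\<^sup>*\<^sup>* x y" using tr by (subst reach_iff_conn[OF ij]) (auto simp: trans_on_def)
  qed
  ultimately show "is_belyi H" unfolding is_belyi_def by blast
qed

text \<open>For an orbit \<open>A\<close> of \<open>pm d \<circ> inv (pm c)\<close> this is the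
  vertex set of one two-coloured cycle: every black vertex comes with its white neighbour along
  colour \<open>c\<close>.\<close>

definition two_col :: "colour \<Rightarrow> colour \<Rightarrow> nat set \<Rightarrow> nat set" where
  "two_col c d A = B ` A \<union> W ` inv (pm c) ` A"

text \<open>From black index \<open>k\<close> colour \<open>c\<close> leads to white index
  \<open>inv (pm c) k\<close>, and from there colour \<open>d\<close> leads to black index
  \<open>pm d (inv (pm c) k)\<close>. Going round the two-coloured cycle thus runs through an
  orbit.\<close>

lemma component_of_black:
  assumes "j < n"
  shows "{y \<in> verts H. (adj H {c, d})\<^sup>*\<^sup>* (B j) y} = two_col c d (orbit (pm d \<circ> inv (pm c)) j)"
proof -
  let ?f = "pm d \<circ> inv (pm c)" and ?R = "(adj H {c, d})\<^sup>*\<^sup>*"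
  let ?O = "orbit ?f j"
  have f: "?f permutes {..<n}" by (intro permutes_compose permutes_inv pm_permutes)
  have fp: "permutation ?f" by (rule permutes_permutation[OF f]) simp
  have O: "?O \<subseteq> {..<n}" using permutes_orbit_subset[OF f] assms by auto
  \<comment> \<open>A walk may also go round the cycle backwards, so the orbit must be closed under
    preimages as well.\<close>
  have closed: "k \<in> ?O" if "?f k \<in> ?O" for k
  proof -
    have "orbit ?f k = ?O"
      using orbit_eqI_permutation[OF fp that] permutation_orbit_step[OF fp, of k] by simp
    thus ?thesis using permutation_self_in_orbit[OF fp, of k] by simp
  qed
  have step: "?R (B k) (W (inv (pm c) k)) \<and> ?R (W (inv (pm c) k)) (B (?f k))" if "k < n" for k
    using adj_BW[of c "{c, d}" "inv (pm c) k"] adj_WB[of d "{c, d}" "inv (pm c) k"] pm_less(2)[OF that]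
    by auto
  have reachB: "?R (B j) (B k)" if "k \<in> ?O" for k
    using that
  proof (induction rule: orbit.induct)
    case base
    show ?case using step[OF assms] by (meson rtranclp_trans)
  next
    case (step k)
    thus ?case using \<open>\<And>k. k < n \<Longrightarrow> ?R (B k) (W (inv (pm c) k)) \<and> ?R (W (inv (pm c) k)) (B (?f k))\<close>[of k] O
      by (meson rtranclp_trans subsetD lessThan_iff)
  qed
  have reachW: "?R (B j) (W (inv (pm c) k))" if "k \<in> ?O" for k
    using reachB[OF that] step[of k] that O by (meson rtranclp_trans subsetD lessThan_iff)
  have stay: "y \<in> two_col c d ?O" if "?R (B j) y" for y
    using that
  proof (induction rule: rtranclp_induct)
    case base
    show ?case unfolding two_col_def using permutation_self_in_orbit[OF fp, of j] by blast
  next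
    case (step y z)
    from step.hyps(2) obtain e k where k: "e \<in> {c, d}" "k < n"
        "(y = W k \<and> z = B (pm e k)) \<or> (y = B (pm e k) \<and> z = W k)"
      unfolding adj_iff by blast
    from k(3) show ?case
    proof
      assume a: "y = W k \<and> z = B (pm e k)"
      have "W k \<in> W ` inv (pm c) ` ?O"
      proof -
        have "W k \<notin> B ` ?O" using W_neq_B[OF k(2)] O by auto
        moreover have "W k \<in> two_col c d ?O" using step.IH a by metis
        ultimately show ?thesis unfolding two_col_def by blast
      qed
      then obtain m where m: "m \<in> ?O" "W k = W (inv (pm c) m)" by auto
      hence km: "k = inv (pm c) m" using W_eq_iff[OF k(2)] pm_less(2) O by auto
      have "pm e k \<in> ?O"
      proof (cases "e = c")
        case True thus ?thesis using m km by simp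
      next
        case False
        hence "pm e k = ?f m" using k(1) km by simp
        thus ?thesis using orbit.step[OF m(1)] by simp
      qed
      thus ?thesis unfolding two_col_def using a by blast
    next
      assume a: "y = B (pm e k) \<and> z = W k"
      have "B (pm e k) \<notin> W ` inv (pm c) ` ?O"
        using W_neq_B[OF _ pm_less(1)[OF k(2)], of _ e] pm_less(2) O by fastforce
      moreover have "B (pm e k) \<in> two_col c d ?O" using step.IH a by metis
      ultimately have "B (pm e k) \<in> B ` ?O" unfolding two_col_def by blast
      then obtain m where "m \<in> ?O" "B (pm e k) = B m" by auto
      hence m: "pm e k \<in> ?O" using B_eq_iff[OF pm_less(1)[OF k(2)], of m e] O by auto
      have "pm c k \<in> ?O"
      proof (cases "e = c")
        case True thus ?thesis using m by simp
      next
        case False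
        hence "?f (pm c k) = pm e k" using k(1) by simp
        thus ?thesis using closed m by simp
      qed
      hence "inv (pm c) (pm c k) \<in> inv (pm c) ` ?O" by (rule imageI)
      hence "k \<in> inv (pm c) ` ?O" by simp
      thus ?thesis unfolding two_col_def using a by blast
    qed
  qed
  show ?thesis
  proof (intro equalityI subsetI)
    fix y assume "y \<in> {y \<in> verts H. ?R (B j) y}"
    thus "y \<in> two_col c d ?O" using stay by simp
  next
    fix y assume y: "y \<in> two_col c d ?O"
    have "inv (pm c) ` ?O \<subseteq> {..<n}" using O pm_less(2) by auto
    hence "two_col c d ?O \<subseteq> verts H"
      unfolding two_col_def verts using image_mono[OF O, of B] image_mono[of "inv (pm c) ` ?O" "{..<n}" W] by blast
    hence "y \<in> verts H" using y by (rule subsetD)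
    moreover have "?R (B j) y" using y reachB reachW unfolding two_col_def by blast
    ultimately show "y \<in> {y \<in> verts H. ?R (B j) y}" by simp
  qed
qed

lemma components_eq:
  "components H {c, d} = two_col c d ` orbs (pm d \<circ> inv (pm c)) {..<n}"
proof -
  let ?R = "(adj H {c, d})\<^sup>*\<^sup>*" and ?f = "pm d \<circ> inv (pm c)"
  let ?cl = "\<lambda>x. {y \<in> verts H. ?R x y}"
  have cl: "{(x, y). x \<in> verts H \<and> y \<in> verts H \<and> ?R x y} `` {x} = ?cl x" if "x \<in> verts H" for x
    using that by auto
  \<comment> \<open>A white vertex lies in the component of its black neighbour along
    \<open>c\<close>, so black representatives suffice.\<close>
  have W: "?cl (W i) = ?cl (B (pm c i))" if "i < n" for i
  proof -
    have "?R (W i) (B (pm c i))" using adj_WB[of c "{c, d}" i] that by auto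
    hence "?R (W i) y \<longleftrightarrow> ?R (B (pm c i)) y" for y by (meson reach_sym rtranclp_trans)
    thus ?thesis by simp
  qed
  have "components H {c, d} = ?cl ` verts H"
    unfolding components_def quotient_def using cl by auto
  also have "\<dots> = (\<lambda>i. ?cl (B i)) ` {..<n}"
  proof -
    have "?cl (W i) \<in> (\<lambda>i. ?cl (B i)) ` {..<n}" if "i < n" for i
      using W[OF that] pm_less(1)[OF that, of c] by blast
    thus ?thesis unfolding verts by blast
  qed
  also have "\<dots> = (\<lambda>i. two_col c d (orbit ?f i)) ` {..<n}"
    by (rule image_cong[OF refl]) (use component_of_black in simp)
  finally show ?thesis by (simp add: orbs_def image_image)
qed

lemma two_col_props:
  assumes "A \<subseteq> {..<n}"
  shows "card (two_col c d A) = 2 * card A" "A' \<subseteq> {..<n} \<Longrightarrow> two_col c d A = two_col c d A' \<Longrightarrow> A = A'"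
proof -
  have fin: "finite A" using assms finite_subset by blast
  have sub: "inv (pm c) ` A \<subseteq> {..<n}" if "A \<subseteq> {..<n}" for A using pm_less(2) that by auto
  have disj: "B ` A \<inter> W ` inv (pm c) ` A' = {}" if "A \<subseteq> {..<n}" "A' \<subseteq> {..<n}" for A A'
  proof -
    have "W ` inv (pm c) ` A' \<subseteq> W ` {..<n}" by (rule image_mono[OF sub[OF that(2)]])
    moreover have "W ` {..<n} \<inter> B ` {..<n} = {}" using W_neq_B by auto
    ultimately show ?thesis using that(1) by blast
  qed
  have "card (two_col c d A) = card (B ` A) + card (W ` inv (pm c) ` A)"
    unfolding two_col_def using fin disj[OF assms assms] by (intro card_Un_disjoint) auto
  also have "card (B ` A) = card A" by (rule card_image[OF inj_on_subset[OF inj_B assms]])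
  also have "card (W ` inv (pm c) ` A) = card (inv (pm c) ` A)"
    by (rule card_image[OF inj_on_subset[OF inj_W sub[OF assms]]])
  also have "\<dots> = card A"
    by (rule card_image[OF inj_on_subset[OF permutes_inj[OF permutes_inv[OF pm_permutes]] subset_UNIV]])
  finally show "card (two_col c d A) = 2 * card A" by simp
  assume A': "A' \<subseteq> {..<n}" and eq: "two_col c d A = two_col c d A'"
  have "B ` A = B ` A'" using eq disj[OF assms A'] disj[OF A' assms] unfolding two_col_def by blast
  thus "A = A'" using inj_on_image_eq_iff[OF inj_B assms A'] by simp
qed

lemma card_components:
  "card (components H {c, d}) = card (orbs (pm d \<circ> inv (pm c)) {..<n})"
  "card {X \<in> components H {c, d}. card X = 2 * i} = card {A \<in> orbs (pm d \<circ> inv (pm c)) {..<n}. card A = i}"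
proof -
  let ?f = "pm d \<circ> inv (pm c)"
  have f: "?f permutes {..<n}" by (intro permutes_compose permutes_inv pm_permutes)
  have sub: "A \<subseteq> {..<n}" if "A \<in> orbs ?f {..<n}" for A
    using that permutes_orbit_subset[OF f] by (auto simp: orbs_def)
  have inj: "inj_on (two_col c d) (orbs ?f {..<n})"
    by (rule inj_onI) (use two_col_props(2) sub in blast)
  show "card (components H {c, d}) = card (orbs ?f {..<n})"
    unfolding components_eq by (rule card_image[OF inj])
  have "{X \<in> components H {c, d}. card X = 2 * i} = two_col c d ` {A \<in> orbs ?f {..<n}. card A = i}"
    unfolding components_eq using two_col_props(1) sub by auto
  thus "card {X \<in> components H {c, d}. card X = 2 * i} = card {A \<in> orbs ?f {..<n}. card A = i}"
    using card_image[OF inj_on_subset[OF inj, of "{A \<in> orbs ?f {..<n}. card A = i}"]] by auto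
qed

lemma btype_eq: "btype H = (card (orbs \<sigma> {..<n}), card (orbs \<tau> {..<n}),
    (\<lambda>i. card {A \<in> orbs (\<tau> \<circ> inv \<sigma>) {..<n}. card A = i}))"
  unfolding btype_def
  \<comment> \<open>With green as first colour \<open>pm d \<circ> inv id\<close> is the permutation
    of \<open>d\<close> itself; red before blue gives
    \<open>\<tau> \<circ> inv \<sigma>\<close>.\<close>
  using card_components(1)[of Green Red] card_components(1)[of Green Blue] card_components(2)[of Red Blue]
  by (simp add: insert_commute)

end

text \<open>The ends of the green edges fix \<open>W\<close> and \<open>B\<close>; an edge is fixed
  by its colour and white end; the black ends then fix the permutations. This is the injectivity in
  the double count.\<close>

lemma coding_unique:
  assumes "coding n \<sigma> \<tau> H W B E" "coding n \<sigma>' \<tau>' H W' B' E'"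
    and eq: "\<And>i. i < n \<Longrightarrow> E Green i = E' Green i" and i: "i < n"
  shows "W i = W' i" "B i = B' i" "E c i = E' c i" "col_perm \<sigma> \<tau> c i = col_perm \<sigma>' \<tau>' c i"
proof -
  interpret a: coding n \<sigma> \<tau> H W B E by (rule assms)
  interpret b: coding n \<sigma>' \<tau>' H W' B' E' by (rule assms)
  have W: "W j = W' j" if "j < n" for j using a.wend[OF that, of Green] b.wend[OF that, of Green] eq[OF that] by simp
  have B: "B j = B' j" if "j < n" for j using a.bend[OF that, of Green] b.bend[OF that, of Green] eq[OF that] by simp
  have "E c i \<in> edges H" using i by (auto simp: a.edge_cases)
  then obtain c' k where k: "k < n" "E c i = E' c' k" by (auto simp: b.edge_cases)
  have "c' = c" using a.ecol[OF i, of c] b.ecol[OF k(1), of c'] k(2) by simp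
  moreover have "k = i" using a.wend[OF i, of c] b.wend[OF k(1), of c'] k W i b.W_eq_iff by metis
  ultimately show E: "E c i = E' c i" using k(2) by simp
  show "W i = W' i" "B i = B' i" using W B i by auto
  show "col_perm \<sigma> \<tau> c i = col_perm \<sigma>' \<tau>' c i"
    using a.bend[OF i, of c] b.bend[OF i, of c] E B a.pm_less(1)[OF i, of c] b.pm_less(1)[OF i, of c] b.B_eq_iff
    by metis
qed

section \<open>Counting isomorphism classes\<close>

fun col_index :: "colour \<Rightarrow> nat" where
  "col_index Green = 0"
| "col_index Red = 1"
| "col_index Blue = 2"

definition col_of :: "nat \<Rightarrow> colour" where
  "col_of k = (if k = 0 then Green else if k = 1 then Red else Blue)"

definition edge_index :: "nat \<Rightarrow> colour \<Rightarrow> nat \<Rightarrow> nat" where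
  "edge_index n c i = col_index c * n + i"

text \<open>Edges come in one block of length \<open>n\<close> per colour, so \<open>div\<close> and
  \<open>mod\<close> recover colour and white end. The green block is first, so edge
  \<open>i < n\<close> joins \<open>i\<close> to \<open>n + i\<close>.\<close>

definition std_graph :: "nat \<Rightarrow> (nat \<Rightarrow> nat) \<Rightarrow> (nat \<Rightarrow> nat) \<Rightarrow> bgraph" where
  "std_graph n \<sigma> \<tau> = \<lparr>verts = {..<2 * n}, edges = {..<3 * n}, is_white = (\<lambda>x. x < n),
     wend = (\<lambda>e. e mod n), bend = (\<lambda>e. n + col_perm \<sigma> \<tau> (col_of (e div n)) (e mod n)),
     ecol = (\<lambda>e. col_of (e div n))\<rparr>"

lemma col_of_col_index [simp]: "col_of (col_index c) = c"
  by (cases c) (auto simp: col_of_def)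

lemma col_index_col_of: "k < 3 \<Longrightarrow> col_index (col_of k) = k"
  by (auto simp: col_of_def)

lemma edge_index_div_mod [simp]:
  "i < n \<Longrightarrow> edge_index n c i div n = col_index c" "i < n \<Longrightarrow> edge_index n c i mod n = i"
  by (auto simp: edge_index_def)

lemma std_graph_edges: "{..<3 * n} = (\<Union>c. edge_index n c ` {..<n})"
proof (intro equalityI subsetI)
  fix e assume "e \<in> {..<3 * n}"
  hence e: "e < 3 * n" and n: "0 < n" by auto
  have "e div n < 3" using e by (simp add: less_mult_imp_div_less)
  hence "e = edge_index n (col_of (e div n)) (e mod n)" by (simp add: edge_index_def col_index_col_of)
  moreover have "e mod n < n" using n by simp
  ultimately show "e \<in> (\<Union>c. edge_index n c ` {..<n})" by blast
next
  fix e assume "e \<in> (\<Union>c. edge_index n c ` {..<n})"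
  then obtain c i where "i < n" "e = edge_index n c i" by auto
  thus "e \<in> {..<3 * n}" by (cases c) (auto simp: edge_index_def)
qed

lemma edge_index_in_edges: "i < n \<Longrightarrow> edge_index n c i < 3 * n"
  using std_graph_edges[of n] by blast

text \<open>A coding of \<open>H\<close> and an isomorphism from a standard graph are the same data;
  \<open>iso_of_coding\<close> goes the other way.\<close>

lemma coding_of_iso:
  assumes n: "0 < n" and \<sigma>: "\<sigma> permutes {..<n}" and \<tau>: "\<tau> permutes {..<n}"
    and iso: "is_iso (std_graph n \<sigma> \<tau>) H f h"
  shows "coding n \<sigma> \<tau> H f (\<lambda>i. f (n + i)) (\<lambda>c i. h (edge_index n c i))"
proof -
  let ?pm = "col_perm \<sigma> \<tau>"
  have f: "bij_betw f {..<2 * n} (verts H)" and h: "bij_betw h {..<3 * n} (edges H)"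
    and wh: "\<And>x. x < 2 * n \<Longrightarrow> is_white H (f x) \<longleftrightarrow> x < n"
    and ed: "\<And>e. e < 3 * n \<Longrightarrow> wend H (h e) = f (e mod n) \<and>
       bend H (h e) = f (n + ?pm (col_of (e div n)) (e mod n)) \<and> ecol H (h e) = col_of (e div n)"
    using iso by (auto simp: is_iso_def std_graph_def)
  show ?thesis
  proof
    have "{..<2 * n} = {..<n} \<union> (\<lambda>i. n + i) ` {..<n}"
    proof (intro equalityI subsetI)
      fix x assume "x \<in> {..<2 * n}"
      hence "x < n \<or> (x = n + (x - n) \<and> x - n < n)" by auto
      thus "x \<in> {..<n} \<union> (\<lambda>i. n + i) ` {..<n}" by blast
    qed auto
    thus "verts H = f ` {..<n} \<union> (\<lambda>i. f (n + i)) ` {..<n}"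
      using f by (simp add: bij_betw_def image_Un image_image)
    show "inj_on f {..<n}" using f by (auto simp: bij_betw_def elim!: inj_on_subset)
    show "inj_on (\<lambda>i. f (n + i)) {..<n}"
    proof (rule inj_onI)
      fix i j assume "i \<in> {..<n}" "j \<in> {..<n}" "f (n + i) = f (n + j)"
      thus "i = j" using f inj_on_eq_iff[of f "{..<2 * n}" "n + i" "n + j"] by (auto simp: bij_betw_def)
    qed
    show "edges H = (\<Union>c. (\<lambda>i. h (edge_index n c i)) ` {..<n})"
      using h unfolding std_graph_edges by (simp add: bij_betw_def image_UN image_image)
    show "inj_on (\<lambda>i. h (edge_index n c i)) {..<n}" for c
    proof (rule inj_onI)
      fix i j assume a: "i \<in> {..<n}" "j \<in> {..<n}" "h (edge_index n c i) = h (edge_index n c j)"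
      hence "edge_index n c i = edge_index n c j"
        using h inj_on_eq_iff[of h "{..<3 * n}"] edge_index_in_edges by (auto simp: bij_betw_def)
      thus "i = j" by (simp add: edge_index_def)
    qed
  qed (use n \<sigma> \<tau> wh ed edge_index_in_edges in auto)
qed

lemma iso_of_coding:
  assumes "coding n \<sigma> \<tau> H W B E"
  shows "is_iso (std_graph n \<sigma> \<tau>) H (\<lambda>x. if x < n then W x else B (x - n))
    (\<lambda>e. E (col_of (e div n)) (e mod n))"
proof -
  interpret coding n \<sigma> \<tau> H W B E by (rule assms)
  let ?f = "\<lambda>x. if x < n then W x else B (x - n)"
  let ?h = "\<lambda>e. E (col_of (e div n)) (e mod n)"
  have "bij_betw ?f {..<2 * n} (verts H)"
    unfolding bij_betw_def
  proof
    show "inj_on ?f {..<2 * n}"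
    proof (rule inj_onI)
      fix x y assume a: "x \<in> {..<2 * n}" "y \<in> {..<2 * n}" "?f x = ?f y"
      show "x = y"
      proof (cases "x < n"; cases "y < n")
        assume "x < n" "y < n" thus ?thesis using a W_eq_iff by simp
      next
        assume "x < n" "\<not> y < n" thus ?thesis using a W_neq_B[of x "y - n"] by simp
      next
        assume "\<not> x < n" "y < n"
        moreover from this have "x - n < n" using a by auto
        ultimately show ?thesis using a W_neq_B[of y "x - n"] by simp
      next
        assume "\<not> x < n" "\<not> y < n" thus ?thesis using a B_eq_iff[of "x - n" "y - n"] by simp
      qed
    qed
    show "?f ` {..<2 * n} = verts H"
    proof (intro equalityI subsetI)
      fix y assume "y \<in> ?f ` {..<2 * n}"
      then obtain x where "x \<in> {..<2 * n}" "y = ?f x" by blast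
      thus "y \<in> verts H" by (cases "x < n") (auto simp: verts)
    next
      fix y assume "y \<in> verts H"
      then consider i where "i < n" "y = W i" | i where "i < n" "y = B i" by (auto simp: verts)
      thus "y \<in> ?f ` {..<2 * n}"
      proof cases
        case (1 i) thus ?thesis by (intro image_eqI[of _ _ i]) auto
      next
        case (2 i) thus ?thesis by (intro image_eqI[of _ _ "n + i"]) auto
      qed
    qed
  qed
  moreover have "bij_betw ?h {..<3 * n} (edges H)"
    unfolding bij_betw_def
  proof
    have cases: "\<exists>c i. i < n \<and> e = edge_index n c i" if "e \<in> {..<3 * n}" for e
      using that unfolding std_graph_edges by auto
    show "inj_on ?h {..<3 * n}"
    proof (rule inj_onI)
      fix e e' assume a: "e \<in> {..<3 * n}" "e' \<in> {..<3 * n}" "?h e = ?h e'"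
      obtain c i c' i' where c: "i < n" "e = edge_index n c i" "i' < n" "e' = edge_index n c' i'"
        using cases a by meson
      have eq: "E c i = E c' i'" using a(3) c by simp
      hence "c = c'" using ecol c by metis
      moreover have "i = i'" using eq wend c W_eq_iff by metis
      ultimately show "e = e'" by (simp add: c)
    qed
    show "?h ` {..<3 * n} = edges H"
      unfolding std_graph_edges edges image_UN image_image by simp
  qed
  moreover have "\<forall>x\<in>{..<2 * n}. is_white H (?f x) = (x < n)" using white black by auto
  moreover have "wend H (?h e) = ?f (e mod n) \<and> bend H (?h e) = ?f (n + pm (col_of (e div n)) (e mod n)) \<and>
      ecol H (?h e) = col_of (e div n)" for e
    using n_pos wend bend ecol by simp
  ultimately show ?thesis unfolding is_iso_def by (simp add: std_graph_def)
qed

text \<open>Every vertex has exactly one green edge, so \<open>\<phi>\<close> numbers the white and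
  the black vertices at once. Following colour \<open>c\<close> from white to black gives a self-map
  of the indices, injective because a black vertex has only one edge of that colour.\<close>

lemma belyi_coding:
  assumes G: "is_belyi G" and \<phi>: "bij_betw \<phi> {..<n} {e \<in> edges G. ecol G e = Green}"
  obtains \<sigma> \<tau> W B E where "coding n \<sigma> \<tau> G W B E" "\<And>i. i < n \<Longrightarrow> E Green i = \<phi> i"
proof -
  have ends: "\<And>e. e \<in> edges G \<Longrightarrow> wend G e \<in> verts G \<and> bend G e \<in> verts G \<and>
         is_white G (wend G e) \<and> \<not> is_white G (bend G e)"
    and ex: "\<And>x c. x \<in> verts G \<Longrightarrow> \<exists>!e. e \<in> edges G \<and> ecol G e = c \<and> (wend G e = x \<or> bend G e = x)"
    using G by (auto simp: is_belyi_def)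
  have uniq: "e = e'" if "e \<in> edges G" "e' \<in> edges G" "ecol G e = ecol G e'"
    "wend G e = wend G e' \<or> bend G e = bend G e'" for e e'
    using that(4)
  proof
    assume "wend G e = wend G e'"
    thus ?thesis using ex[of "wend G e" "ecol G e"] ends[OF that(1)] that(1-3) by metis
  next
    assume "bend G e = bend G e'"
    thus ?thesis using ex[of "bend G e" "ecol G e"] ends[OF that(1)] that(1-3) by metis
  qed
  have \<phi>_edge: "\<phi> i \<in> edges G" "ecol G (\<phi> i) = Green" if "i < n" for i
    using \<phi> that by (auto simp: bij_betw_def)
  have \<phi>_surj: "\<exists>i<n. e = \<phi> i" if "e \<in> edges G" "ecol G e = Green" for e
  proof -
    have "e \<in> \<phi> ` {..<n}" using \<phi> that by (simp add: bij_betw_def)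
    thus ?thesis by auto
  qed
  have \<phi>_inj: "\<phi> i = \<phi> j \<Longrightarrow> i < n \<Longrightarrow> j < n \<Longrightarrow> i = j" for i j
    using \<phi> by (auto simp: bij_betw_def dest: inj_onD)
  define W B where "W = (\<lambda>i. wend G (\<phi> i))" and "B = (\<lambda>i. bend G (\<phi> i))"
  define E where "E = (\<lambda>c i. THE e. e \<in> edges G \<and> ecol G e = c \<and> (wend G e = W i \<or> bend G e = W i))"
  have E: "E c i \<in> edges G \<and> ecol G (E c i) = c \<and> wend G (E c i) = W i" if "i < n" for c i
  proof -
    have W: "W i \<in> verts G" "is_white G (W i)" using ends[OF \<phi>_edge(1)[OF that]] by (auto simp: W_def)
    have e: "E c i \<in> edges G \<and> ecol G (E c i) = c \<and> (wend G (E c i) = W i \<or> bend G (E c i) = W i)"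
      unfolding E_def by (rule theI'[OF ex[OF W(1)]])
    hence "bend G (E c i) \<noteq> W i" using ends[of "E c i"] W(2) by auto
    thus ?thesis using e by simp
  qed
  have EG: "E Green i = \<phi> i" if "i < n" for i
    using uniq[of "E Green i" "\<phi> i"] E[OF that, of Green] \<phi>_edge[OF that] by (simp add: W_def)
  have vertex: "\<exists>i<n. x = W i \<or> x = B i" if x: "x \<in> verts G" for x
  proof -
    obtain e where e: "e \<in> edges G" "ecol G e = Green" "wend G e = x \<or> bend G e = x"
      using ex[OF x, of Green] by blast
    thus ?thesis using \<phi>_surj[of e] by (auto simp: W_def B_def)
  qed
  have injW: "i = j" if "W i = W j" "i < n" "j < n" for i j
  proof -
    have "\<phi> i = \<phi> j"
      by (rule uniq) (use that(1) \<phi>_edge[OF that(2)] \<phi>_edge[OF that(3)] in \<open>simp_all add: W_def\<close>)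
    thus ?thesis using that(2,3) by (rule \<phi>_inj)
  qed
  have injB: "i = j" if "B i = B j" "i < n" "j < n" for i j
  proof -
    have "\<phi> i = \<phi> j"
      by (rule uniq) (use that(1) \<phi>_edge[OF that(2)] \<phi>_edge[OF that(3)] in \<open>simp_all add: B_def\<close>)
    thus ?thesis using that(2,3) by (rule \<phi>_inj)
  qed
  have bend_B: "\<exists>j<n. bend G (E c i) = B j" if "i < n" for c i
  proof -
    have b: "bend G (E c i) \<in> verts G" "\<not> is_white G (bend G (E c i))"
      using E[OF that, of c] ends[of "E c i"] by simp_all
    obtain j where "j < n" "bend G (E c i) = W j \<or> bend G (E c i) = B j" using vertex[OF b(1)] by blast
    moreover have "bend G (E c i) \<noteq> W j" if "j < n" for j
      using b(2) ends[OF \<phi>_edge(1)[OF that]] by (auto simp: W_def)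
    ultimately show ?thesis by blast
  qed
  define g where "g = (\<lambda>c i. SOME j. j < n \<and> bend G (E c i) = B j)"
  have g: "g c i < n \<and> bend G (E c i) = B (g c i)" if "i < n" for c i
    unfolding g_def by (rule someI_ex[OF bend_B[OF that]])
  \<comment> \<open>Extended by the identity, as \<open>permutes\<close> demands outside the
    carrier.\<close>
  define p where "p = (\<lambda>c i. if i < n then g c i else i)"
  have p: "p c permutes {..<n}" for c
  proof (rule bij_imp_permutes)
    have "inj_on (p c) {..<n}"
    proof (rule inj_onI)
      fix i j assume a: "i \<in> {..<n}" "j \<in> {..<n}" "p c i = p c j"
      hence ij: "i < n" "j < n" by auto
      have "bend G (E c i) = bend G (E c j)" using a g by (simp add: p_def)
      hence "E c i = E c j" using uniq E[OF ij(1), of c] E[OF ij(2), of c] by metis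
      hence "W i = W j" using E[OF ij(1), of c] E[OF ij(2), of c] by metis
      thus "i = j" using injW ij by blast
    qed
    thus "bij_betw (p c) {..<n} {..<n}"
      using g by (intro bij_betw_imageI endo_inj_surj) (auto simp: p_def)
  qed (simp add: p_def)
  have pm: "col_perm (p Red) (p Blue) c i = g c i" if "i < n" for c i
  proof (cases c)
    case Green
    have "B (g Green i) = B i" using g[OF that, of Green] EG[OF that] by (simp add: B_def)
    hence "g Green i = i" using injB g[OF that, of Green] that by blast
    thus ?thesis by (simp add: Green)
  qed (use that in \<open>auto simp: p_def\<close>)
  have "coding n (p Red) (p Blue) G W B E"
  proof
    obtain x where "x \<in> verts G" using G by (auto simp: is_belyi_def)
    thus "0 < n" using vertex by fastforce
    show "verts G = W ` {..<n} \<union> B ` {..<n}"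
    proof (intro equalityI subsetI)
      fix x assume "x \<in> verts G" thus "x \<in> W ` {..<n} \<union> B ` {..<n}" using vertex by blast
    next
      fix x assume "x \<in> W ` {..<n} \<union> B ` {..<n}"
      thus "x \<in> verts G" using ends \<phi>_edge by (auto simp: W_def B_def)
    qed
    show "inj_on W {..<n}" "inj_on B {..<n}" using injW injB by (auto intro!: inj_onI)
    show "edges G = (\<Union>c. E c ` {..<n})"
    proof (intro equalityI subsetI)
      fix e assume e: "e \<in> edges G"
      obtain i where i: "i < n" "wend G e = W i \<or> wend G e = B i" using vertex ends[OF e] by blast
      have "wend G e \<noteq> B i" using ends[OF e] ends[OF \<phi>_edge(1)[OF i(1)]] by (auto simp: B_def)
      hence "e = E (ecol G e) i" using i uniq e E[OF i(1), of "ecol G e"] by metis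
      thus "e \<in> (\<Union>c. E c ` {..<n})" using i by blast
    next
      fix e assume "e \<in> (\<Union>c. E c ` {..<n})"
      thus "e \<in> edges G" using E by auto
    qed
    show "inj_on (E c) {..<n}" for c
    proof (rule inj_onI)
      fix i j assume "i \<in> {..<n}" "j \<in> {..<n}" "E c i = E c j"
      thus "i = j" using E[of i c] E[of j c] injW by auto
    qed
    show "is_white G (W i)" "\<not> is_white G (B i)" if "i < n" for i
      using ends[OF \<phi>_edge(1)[OF that]] by (auto simp: W_def B_def)
  qed (use p E g pm in auto)
  thus ?thesis using that EG by blast
qed

section \<open>Isomorphisms and their number\<close>

lemma is_iso_trans: "is_iso G H f h \<Longrightarrow> is_iso H K f' h' \<Longrightarrow> is_iso G K (f' \<circ> f) (h' \<circ> h)"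
  unfolding is_iso_def by (auto intro: bij_betw_trans simp: bij_betwE)

text \<open>\<open>is_iso\<close> controls the vertex map only on vertices. To invert it, or to
  change it elsewhere, the ends of edges must be vertices.\<close>

definition wf_graph :: "bgraph \<Rightarrow> bool" where
  "wf_graph G \<longleftrightarrow> (\<forall>e\<in>edges G. wend G e \<in> verts G \<and> bend G e \<in> verts G)"

lemma wf_graph_belyi: "is_belyi G \<Longrightarrow> wf_graph G"
  by (auto simp: is_belyi_def wf_graph_def)

lemma wf_graph_std: 
  assumes "\<sigma> permutes {..<n}" "\<tau> permutes {..<n}"
  shows "wf_graph (std_graph n \<sigma> \<tau>)"
proof -
  have "col_perm \<sigma> \<tau> c i < n" if "i < n" for c i
    using that assms permutes_in_image[OF assms(1), of i] permutes_in_image[OF assms(2), of i]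
    by (cases c) auto
  moreover have "e mod n < n" if "e < 3 * n" for e using that by (cases "n = 0") auto
  ultimately have "e mod n < 2 * n \<and> n + col_perm \<sigma> \<tau> (col_of (e div n)) (e mod n) < 2 * n"
    if "e < 3 * n" for e
    using that by (simp add: mult_2 trans_less_add1)
  thus ?thesis by (simp add: wf_graph_def std_graph_def)
qed

lemma is_iso_cong:
  assumes "wf_graph G" "is_iso G H f h" "\<And>x. x \<in> verts G \<Longrightarrow> f' x = f x" "\<And>e. e \<in> edges G \<Longrightarrow> h' e = h e"
  shows "is_iso G H f' h'"
proof -
  have "bij_betw f' (verts G) (verts H)" "bij_betw h' (edges G) (edges H)"
    using assms bij_betw_cong[of "verts G" f' f] bij_betw_cong[of "edges G" h' h] by (auto simp: is_iso_def)
  thus ?thesis using assms by (auto simp: is_iso_def wf_graph_def)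
qed

lemma is_iso_inv:
  assumes wf: "wf_graph G" and iso: "is_iso G H f h"
  shows "is_iso H G (inv_into (verts G) f) (inv_into (edges G) h)"
proof -
  let ?f = "inv_into (verts G) f" and ?h = "inv_into (edges G) h"
  have f: "bij_betw f (verts G) (verts H)" and h: "bij_betw h (edges G) (edges H)"
    using iso by (auto simp: is_iso_def)
  have "is_white G (?f y) = is_white H y" if "y \<in> verts H" for y
  proof -
    have "?f y \<in> verts G" "f (?f y) = y"
      using that bij_betwE[OF bij_betw_inv_into[OF f]] bij_betw_inv_into_right[OF f] by auto
    thus ?thesis using iso unfolding is_iso_def by metis
  qed
  moreover have "wend G (?h e) = ?f (wend H e) \<and> bend G (?h e) = ?f (bend H e) \<and> ecol G (?h e) = ecol H e"
    if "e \<in> edges H" for e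
  proof -
    have e: "?h e \<in> edges G" "h (?h e) = e"
      using that bij_betwE[OF bij_betw_inv_into[OF h]] bij_betw_inv_into_right[OF h] by auto
    have "wend H (h (?h e)) = f (wend G (?h e))" "bend H (h (?h e)) = f (bend G (?h e))"
      "ecol H (h (?h e)) = ecol G (?h e)"
      using iso e(1) by (auto simp: is_iso_def)
    moreover have "wend G (?h e) \<in> verts G" "bend G (?h e) \<in> verts G" using wf e(1) by (auto simp: wf_graph_def)
    ultimately show ?thesis using e(2) bij_betw_inv_into_left[OF f] by metis
  qed
  ultimately show ?thesis
    using bij_betw_inv_into[OF f] bij_betw_inv_into[OF h] by (simp add: is_iso_def)
qed

lemma isomorphic_refl: "isomorphic G G"
  unfolding isomorphic_def is_iso_def by (intro exI[of _ id]) (auto simp: bij_betw_def)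

lemma isomorphic_trans: "isomorphic G H \<Longrightarrow> isomorphic H K \<Longrightarrow> isomorphic G K"
  unfolding isomorphic_def using is_iso_trans by blast

lemma isomorphic_sym: "wf_graph G \<Longrightarrow> isomorphic G H \<Longrightarrow> isomorphic H G"
  unfolding isomorphic_def using is_iso_inv by blast

text \<open>As in \<open>Aut\<close>, values off the graph are fixed by extensionality, so each
  isomorphism is counted once.\<close>

definition isos :: "bgraph \<Rightarrow> bgraph \<Rightarrow> ((nat \<Rightarrow> nat) \<times> (nat \<Rightarrow> nat)) set" where
  "isos G H = {(f, h). f \<in> extensional (verts G) \<and> h \<in> extensional (edges G) \<and> is_iso G H f h}"

lemma Aut_eq_isos: "Aut G = isos G G"
  by (simp add: Aut_def isos_def)

text \<open>Precomposition with the inverse of the given isomorphism is a bijection, and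
  \<open>restrict\<close> keeps the results extensional. For \<open>H = G'\<close> there are as many
  isomorphisms onto \<open>G'\<close> as automorphisms of it.\<close>

lemma card_isos:
  assumes wf: "wf_graph G" "wf_graph G'" and iso: "is_iso G G' f0 h0"
  shows "card (isos G H) = card (isos G' H)"
proof -
  let ?f0 = "inv_into (verts G) f0" and ?h0 = "inv_into (edges G) h0"
  have f: "bij_betw f0 (verts G) (verts G')" and h: "bij_betw h0 (edges G) (edges G')"
    using iso by (auto simp: is_iso_def)
  have iso': "is_iso G' G ?f0 ?h0" by (rule is_iso_inv[OF wf(1) iso])
  define to where "to = (\<lambda>(a :: nat \<Rightarrow> nat, b :: nat \<Rightarrow> nat). (restrict (a \<circ> ?f0) (verts G'), restrict (b \<circ> ?h0) (edges G')))"
  define fro where "fro = (\<lambda>(a :: nat \<Rightarrow> nat, b :: nat \<Rightarrow> nat). (restrict (a \<circ> f0) (verts G), restrict (b \<circ> h0) (edges G)))"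
  have "bij_betw to (isos G H) (isos G' H)"
  proof (rule bij_betw_byWitness[of _ fro])
    show "\<forall>p\<in>isos G H. fro (to p) = p"
    proof
      fix p assume "p \<in> isos G H"
      then obtain a b where p: "p = (a, b)" "a \<in> extensional (verts G)" "b \<in> extensional (edges G)"
        by (auto simp: isos_def)
      have "restrict (restrict (a \<circ> ?f0) (verts G') \<circ> f0) (verts G) = a"
        using p(2) bij_betw_inv_into_left[OF f] bij_betwE[OF f]
        by (auto simp: fun_eq_iff restrict_def extensional_def)
      moreover have "restrict (restrict (b \<circ> ?h0) (edges G') \<circ> h0) (edges G) = b"
        using p(3) bij_betw_inv_into_left[OF h] bij_betwE[OF h]
        by (auto simp: fun_eq_iff restrict_def extensional_def)
      ultimately show "fro (to p) = p" by (simp add: fro_def to_def p(1))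
    qed
    show "\<forall>p\<in>isos G' H. to (fro p) = p"
    proof
      fix p assume "p \<in> isos G' H"
      then obtain a b where p: "p = (a, b)" "a \<in> extensional (verts G')" "b \<in> extensional (edges G')"
        by (auto simp: isos_def)
      have "restrict (restrict (a \<circ> f0) (verts G) \<circ> ?f0) (verts G') = a"
        using p(2) bij_betw_inv_into_right[OF f] bij_betwE[OF bij_betw_inv_into[OF f]]
        by (auto simp: fun_eq_iff restrict_def extensional_def)
      moreover have "restrict (restrict (b \<circ> h0) (edges G) \<circ> ?h0) (edges G') = b"
        using p(3) bij_betw_inv_into_right[OF h] bij_betwE[OF bij_betw_inv_into[OF h]]
        by (auto simp: fun_eq_iff restrict_def extensional_def)
      ultimately show "to (fro p) = p" by (simp add: fro_def to_def p(1))
    qed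
    show "to ` isos G H \<subseteq> isos G' H"
      using is_iso_cong[OF wf(2) is_iso_trans[OF iso']] by (auto simp: to_def isos_def)
    show "fro ` isos G' H \<subseteq> isos G H"
      using is_iso_cong[OF wf(1) is_iso_trans[OF iso]] by (auto simp: fro_def isos_def)
  qed
  thus ?thesis by (rule bij_betw_same_card)
qed

section \<open>Numberings of the green edges and the weighted count\<close>

definition codes :: "nat \<Rightarrow> bgraph \<Rightarrow> ((nat \<Rightarrow> nat) \<times> (nat \<Rightarrow> nat)) set" where
  "codes n G = {(\<sigma>, \<tau>) \<in> trans_perm_pairs {..<n}. isomorphic (std_graph n \<sigma> \<tau>) G}"

lemma trans_perm_pairsD: "(\<sigma>, \<tau>) \<in> trans_perm_pairs X \<Longrightarrow> \<sigma> permutes X \<and> \<tau> permutes X \<and> trans_on X \<sigma> \<tau>"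
  by (auto simp: trans_perm_pairs_def perm_pairs_def)

lemma finite_codes [simp]: "finite (codes n G)"
  by (rule finite_subset[of _ "trans_perm_pairs {..<n}"]) (auto simp: codes_def)

lemma bdegree_pos:
  assumes "is_belyi G"
  shows "0 < bdegree G"
proof -
  obtain x where "x \<in> verts G" using assms by (auto simp: is_belyi_def)
  hence "\<exists>!e. e \<in> edges G \<and> ecol G e = Green \<and> (wend G e = x \<or> bend G e = x)"
    using assms by (simp add: is_belyi_def)
  then obtain e where "e \<in> edges G" "ecol G e = Green" by blast
  moreover have "finite {e \<in> edges G. ecol G e = Green}" using assms by (simp add: is_belyi_def)
  ultimately show ?thesis unfolding bdegree_def by (metis (mono_tags, lifting) card_gt_0_iff emptyE mem_Collect_eq)
qed

text \<open>Double counting of the \<open>n!\<close> numberings of the green edges: a numbering is the same as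
  a code together with an isomorphism from the standard graph of that code.\<close>
lemma card_codes:
  assumes G: "is_belyi G" and n: "n = bdegree G"
  shows "card (codes n G) * card (Aut G) = fact n"
proof -
  let ?I = "\<lambda>(\<sigma>, \<tau>). isos (std_graph n \<sigma> \<tau>) G"
  let ?D = "SIGMA p:codes n G. ?I p"
  let ?gr = "{e \<in> edges G. ecol G e = Green}"
  have n_pos: "0 < n" using bdegree_pos[OF G] n by simp
  have "finite ?gr" using G by (simp add: is_belyi_def)
  then obtain \<phi> where \<phi>: "bij_betw \<phi> {..<n} ?gr"
    using bij_betw_iff_card[of "{..<n}" ?gr] n by (auto simp: bdegree_def)
  have coding: "coding n \<sigma> \<tau> G f (\<lambda>i. f (n + i)) (\<lambda>c i. h (edge_index n c i))"
    if "(\<sigma>, \<tau>) \<in> codes n G" "(f, h) \<in> isos (std_graph n \<sigma> \<tau>) G" for \<sigma> \<tau> f h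
    using that n_pos trans_perm_pairsD by (intro coding_of_iso) (auto simp: codes_def isos_def)
  have green: "edge_index n Green i = i" for i by (simp add: edge_index_def)
  have green_in: "h i \<in> ?gr" if "(\<sigma>, \<tau>) \<in> codes n G" "(f, h) \<in> isos (std_graph n \<sigma> \<tau>) G" "i < n" for \<sigma> \<tau> f h i
  proof -
    interpret coding n \<sigma> \<tau> G f "\<lambda>i. f (n + i)" "\<lambda>c i. h (edge_index n c i)"
      by (rule coding[OF that(1,2)])
    have "h (edge_index n Green i) \<in> edges G" using that(3) by (subst edge_cases) blast
    thus ?thesis using ecol[OF that(3), of Green] by (simp add: green)
  qed
  \<comment> \<open>Relative to the reference numbering \<open>\<phi>\<close>, the numbering by
    \<open>h\<close> of the green edges becomes a permutation of \<open>{..<n}\<close>; the green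
    edges of a standard graph are 0 to \<open>n - 1\<close>.\<close>
  define num :: "((nat \<Rightarrow> nat) \<times> (nat \<Rightarrow> nat)) \<times> ((nat \<Rightarrow> nat) \<times> (nat \<Rightarrow> nat)) \<Rightarrow> nat \<Rightarrow> nat"
    where "num = (\<lambda>(_, (_, h)) i. if i < n then inv_into {..<n} \<phi> (h i) else i)"
  have "bij_betw num ?D {\<pi>. \<pi> permutes {..<n}}"
    unfolding bij_betw_def
  proof
    show "inj_on num ?D"
    proof (rule inj_onI)
      fix p q assume a: "p \<in> ?D" "q \<in> ?D" "num p = num q"
      obtain \<sigma> \<tau> f h \<sigma>' \<tau>' f' h' where pq: "p = ((\<sigma>, \<tau>), (f, h))" "q = ((\<sigma>', \<tau>'), (f', h'))"
        by (metis prod.exhaust)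
      have p: "(\<sigma>, \<tau>) \<in> codes n G" "(f, h) \<in> isos (std_graph n \<sigma> \<tau>) G"
        and q: "(\<sigma>', \<tau>') \<in> codes n G" "(f', h') \<in> isos (std_graph n \<sigma>' \<tau>') G"
        using a(1,2) by (auto simp: pq)
      have hh: "h i = h' i" if "i < n" for i
      proof -
        have "inv_into {..<n} \<phi> (h i) = inv_into {..<n} \<phi> (h' i)"
          using fun_cong[OF a(3), of i] that by (simp add: num_def pq)
        moreover have "\<phi> (inv_into {..<n} \<phi> (h i)) = h i" "\<phi> (inv_into {..<n} \<phi> (h' i)) = h' i"
          using bij_betw_inv_into_right[OF \<phi>] green_in[OF p that] green_in[OF q that] by auto
        ultimately show ?thesis by metis
      qed
      \<comment> \<open>Equal numberings of the green edges force equal codes and equal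
        isomorphisms.\<close>
      note u = coding_unique[OF coding[OF p] coding[OF q], unfolded green, OF hh]
      have perms: "\<sigma> permutes {..<n}" "\<tau> permutes {..<n}" "\<sigma>' permutes {..<n}" "\<tau>' permutes {..<n}"
        using p(1) q(1) trans_perm_pairsD by (auto simp: codes_def)
      have "\<sigma> = \<sigma>'"
      proof
        fix i show "\<sigma> i = \<sigma>' i"
          using u(4)[of i Red] permutes_not_in[OF perms(1), of i] permutes_not_in[OF perms(3), of i]
          by (cases "i < n") auto
      qed
      moreover have "\<tau> = \<tau>'"
      proof
        fix i show "\<tau> i = \<tau>' i"
          using u(4)[of i Blue] permutes_not_in[OF perms(2), of i] permutes_not_in[OF perms(4), of i]
          by (cases "i < n") auto
      qed
      moreover have "f = f'"
      proof (rule extensionalityI[of _ "{..<2 * n}"])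
        show "f \<in> extensional {..<2 * n}" "f' \<in> extensional {..<2 * n}"
          using p(2) q(2) by (auto simp: isos_def std_graph_def)
        fix x assume x: "x \<in> {..<2 * n}"
        show "f x = f' x"
        proof (cases "x < n")
          case True thus ?thesis using u(1) by simp
        next
          case False
          thus ?thesis using u(2)[of "x - n"] x by simp
        qed
      qed
      moreover have "h = h'"
      proof (rule extensionalityI[of _ "{..<3 * n}"])
        show "h \<in> extensional {..<3 * n}" "h' \<in> extensional {..<3 * n}"
          using p(2) q(2) by (auto simp: isos_def std_graph_def)
        fix e assume "e \<in> {..<3 * n}"
        then obtain c i where "i < n" "e = edge_index n c i" unfolding std_graph_edges by auto
        thus "h e = h' e" using u(3)[of i c] by simp
      qed
      ultimately show "p = q" by (simp add: pq)
    qed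
    show "num ` ?D = {\<pi>. \<pi> permutes {..<n}}"
    proof (intro equalityI subsetI)
      fix \<pi> assume "\<pi> \<in> num ` ?D"
      then obtain \<sigma> \<tau> f h where p: "(\<sigma>, \<tau>) \<in> codes n G" "(f, h) \<in> isos (std_graph n \<sigma> \<tau>) G"
        and \<pi>: "\<pi> = num ((\<sigma>, \<tau>), (f, h))" by auto
      interpret coding n \<sigma> \<tau> G f "\<lambda>i. f (n + i)" "\<lambda>c i. h (edge_index n c i)"
        by (rule coding[OF p])
      have \<pi>_eq: "\<pi> i = inv_into {..<n} \<phi> (h i)" if "i < n" for i using that by (simp add: \<pi> num_def)
      have inv: "inv_into {..<n} \<phi> (h i) < n" "\<phi> (inv_into {..<n} \<phi> (h i)) = h i" if "i < n" for i
        using bij_betw_inv_into_right[OF \<phi>] bij_betwE[OF bij_betw_inv_into[OF \<phi>]] green_in[OF p that] by auto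
      have "inj_on \<pi> {..<n}"
      proof (rule inj_onI)
        fix i j assume a: "i \<in> {..<n}" "j \<in> {..<n}" "\<pi> i = \<pi> j"
        hence "h i = h j" using inv \<pi>_eq by (metis lessThan_iff)
        thus "i = j" using a inj_E[of Green] unfolding green by (auto dest: inj_onD)
      qed
      hence "bij_betw \<pi> {..<n} {..<n}"
        using inv \<pi>_eq by (intro bij_betw_imageI endo_inj_surj) auto
      hence "\<pi> permutes {..<n}" by (rule bij_imp_permutes) (simp add: \<pi> num_def)
      thus "\<pi> \<in> {\<pi>. \<pi> permutes {..<n}}" by simp
    next
      fix \<pi> assume "\<pi> \<in> {\<pi>. \<pi> permutes {..<n}}"
      hence \<pi>: "\<pi> permutes {..<n}" by simp
      \<comment> \<open>Surjectivity: the numbering \<open>\<phi> \<circ> \<pi>\<close> extends to a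
        coding, whose isomorphism is mapped to \<open>\<pi>\<close>.\<close>
      obtain \<sigma> \<tau> W B E where c: "coding n \<sigma> \<tau> G W B E" "\<And>i. i < n \<Longrightarrow> E Green i = (\<phi> \<circ> \<pi>) i"
        using belyi_coding[OF G bij_betw_trans[OF permutes_imp_bij[OF \<pi>] \<phi>]] by metis
      interpret coding n \<sigma> \<tau> G W B E by (rule c(1))
      define f where "f = restrict (\<lambda>x. if x < n then W x else B (x - n)) {..<2 * n}"
      define h where "h = restrict (\<lambda>e. E (col_of (e div n)) (e mod n)) {..<3 * n}"
      have iso: "is_iso (std_graph n \<sigma> \<tau>) G f h"
        by (rule is_iso_cong[OF wf_graph_std[OF \<sigma> \<tau>] iso_of_coding[OF c(1)]])
           (auto simp: f_def h_def std_graph_def)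
      have "(\<sigma>, \<tau>) \<in> codes n G"
        using iso G \<sigma> \<tau> is_belyi_iff by (auto simp: codes_def trans_perm_pairs_def perm_pairs_def isomorphic_def)
      moreover have "(f, h) \<in> isos (std_graph n \<sigma> \<tau>) G"
        using iso by (simp add: isos_def f_def h_def std_graph_def)
      moreover have "num ((\<sigma>, \<tau>), (f, h)) = \<pi>"
      proof
        fix i
        show "num ((\<sigma>, \<tau>), (f, h)) i = \<pi> i"
        proof (cases "i < n")
          case True
          have "h i = \<phi> (\<pi> i)" using True c(2)[OF True] by (simp add: h_def col_of_def)
          moreover have "\<pi> i < n" using True permutes_in_image[OF \<pi>, of i] by simp
          ultimately show ?thesis using True bij_betw_inv_into_left[OF \<phi>, of "\<pi> i"] by (simp add: num_def)
        next
          case False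
          thus ?thesis using permutes_not_in[OF \<pi>, of i] by (simp add: num_def)
        qed
      qed
      ultimately show "\<pi> \<in> num ` ?D" by (intro image_eqI[of _ _ "((\<sigma>, \<tau>), (f, h))"]) auto
    qed
  qed
  note bij = this
  \<comment> \<open>Finiteness of the sets of isomorphisms is inherited from the finite set of
    permutations through the bijection.\<close>
  have finD: "finite ?D" using bij bij_betw_finite finite_permutations[of "{..<n}"] by blast
  have "finite (?I p)" if "p \<in> codes n G" for p
  proof -
    have "Pair p ` ?I p \<subseteq> ?D" using that by auto
    hence "finite (Pair p ` ?I p)" using finD finite_subset by blast
    thus ?thesis by (rule finite_imageD) (simp add: inj_on_def)
  qed
  hence "card ?D = (\<Sum>p\<in>codes n G. card (?I p))" by (intro card_SigmaI) auto
  also have "\<dots> = (\<Sum>p\<in>codes n G. card (Aut G))"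
  proof (rule sum.cong[OF refl])
    fix p assume "p \<in> codes n G"
    then obtain \<sigma> \<tau> f h where p: "p = (\<sigma>, \<tau>)" "\<sigma> permutes {..<n}" "\<tau> permutes {..<n}"
      "is_iso (std_graph n \<sigma> \<tau>) G f h"
      using trans_perm_pairsD by (fastforce simp: codes_def isomorphic_def)
    show "card (?I p) = card (Aut G)"
      using card_isos[OF wf_graph_std[OF p(2,3)] wf_graph_belyi[OF G] p(4), of G] by (simp add: p(1) Aut_eq_isos)
  qed
  also have "\<dots> = card (codes n G) * card (Aut G)" by simp
  finally show ?thesis using bij_betw_same_card[OF bij] card_permutations[of "{..<n}" n] by simp
qed

definition pair_type :: "nat \<Rightarrow> (nat \<Rightarrow> nat) \<Rightarrow> (nat \<Rightarrow> nat) \<Rightarrow> nat \<times> nat \<times> (nat \<Rightarrow> nat)" where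
  "pair_type n \<sigma> \<tau> = (card (orbs \<sigma> {..<n}), card (orbs \<tau> {..<n}),
    (\<lambda>i. card {A \<in> orbs (\<tau> \<circ> inv \<sigma>) {..<n}. card A = i}))"

lemma isomorphic_std_graph:
  assumes "0 < n" "(\<sigma>, \<tau>) \<in> trans_perm_pairs {..<n}" "isomorphic (std_graph n \<sigma> \<tau>) H"
  shows "is_belyi H" "btype H = pair_type n \<sigma> \<tau>" "bdegree H = n"
proof -
  obtain f h where iso: "is_iso (std_graph n \<sigma> \<tau>) H f h" using assms(3) by (auto simp: isomorphic_def)
  have p: "\<sigma> permutes {..<n}" "\<tau> permutes {..<n}" "trans_on {..<n} \<sigma> \<tau>" using trans_perm_pairsD[OF assms(2)] by auto
  interpret coding n \<sigma> \<tau> H f "\<lambda>i. f (n + i)" "\<lambda>c i. h (edge_index n c i)"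
    by (rule coding_of_iso[OF assms(1) p(1,2) iso])
  show "is_belyi H" using is_belyi_iff p(3) by simp
  show "btype H = pair_type n \<sigma> \<tau>" by (simp add: btype_eq pair_type_def)
  have "{e \<in> edges H. ecol H e = Green} = (\<lambda>i. h (edge_index n Green i)) ` {..<n}"
    using ecol by (auto simp: edge_cases)
  thus "bdegree H = n" using card_image[OF inj_E[of Green]] by (simp add: bdegree_def)
qed

lemma belyi_code_exists:
  assumes "is_belyi G" "n = bdegree G"
  obtains \<sigma> \<tau> where "(\<sigma>, \<tau>) \<in> trans_perm_pairs {..<n}" "isomorphic (std_graph n \<sigma> \<tau>) G"
proof -
  \<comment> \<open>A product equal to \<open>fact n\<close> has no zero factor, so there is a
    code.\<close>
  have "card (codes n G) \<noteq> 0" using card_codes[OF assms] by (metis fact_nonzero mult_0)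
  hence "codes n G \<noteq> {}" by auto
  thus ?thesis using that by (auto simp: codes_def)
qed

lemma pair_type_degree:
  assumes "\<sigma> permutes {..<n}" "\<tau> permutes {..<n}"
  shows "Sum_any (\<lambda>i. i * snd (snd (pair_type n \<sigma> \<tau>)) i) = n"
proof -
  let ?f = "\<tau> \<circ> inv \<sigma>"
  define m where "m = (\<lambda>i. card {A \<in> orbs ?f {..<n}. card A = i})"
  have f: "?f permutes {..<n}" by (intro permutes_compose permutes_inv assms)
  \<comment> \<open>The number \<open>n\<close> serves as the outside point \<open>d\<close> of the
    insertion context.\<close>
  have fin: "finite {..<n}" and notin: "n \<notin> {..<n}" by auto
  have "m i = 0" if "i \<notin> {1..n}" for i
  proof -
    have "lk (cyc_mono ?f {..<n}) (T i) = 0"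
      using that by (intro multiplicity_eq_0[OF f fin notin]) (auto simp: lookup_cyc_mono_T)
    thus ?thesis unfolding lookup_cyc_mono_T[OF fin] m_def .
  qed
  hence "{i. i * m i \<noteq> 0} \<subseteq> {1..n}" by fastforce
  hence "Sum_any (\<lambda>i. i * m i) = (\<Sum>i\<in>{1..n}. i * m i)"
    by (intro Sum_any.expand_superset) auto
  moreover have "real (\<Sum>i\<in>{1..n}. i * m i) = (\<Sum>i\<in>{1..card {..<n}}. real i * real (m i) * 1)" by simp
  moreover have "\<dots> = (\<Sum>a\<in>{..<n}. 1)"
    \<comment> \<open>Points are counted cycle by cycle, with the constant weight 1.\<close>
    unfolding m_def by (rule sum_len[OF f fin notin, of "\<lambda>_. 1", symmetric])
  ultimately have "real (Sum_any (\<lambda>i. i * m i)) = real n" by simp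
  thus ?thesis by (simp add: pair_type_def m_def)
qed

definition type_pairs :: "nat \<Rightarrow> nat \<times> nat \<times> (nat \<Rightarrow> nat) \<Rightarrow> ((nat \<Rightarrow> nat) \<times> (nat \<Rightarrow> nat)) set" where
  "type_pairs n t = {(\<sigma>, \<tau>) \<in> trans_perm_pairs {..<n}. pair_type n \<sigma> \<tau> = t}"

text \<open>Pairs of the given type are grouped by the isomorphism class of their standard graph.
  The group of \<open>G\<close> is \<open>codes n G\<close>, of size \<open>n! / |Aut G|\<close> by
  \<open>card_codes\<close>, so after division by \<open>n!\<close> it contributes
  \<open>1 / |Aut G|\<close>.\<close>

lemma Ncount_eq:
  assumes n: "0 < n" "Sum_any (\<lambda>i. i * m i) = n"
  shows "Ncount k l m = real (card (type_pairs n (k, l, m))) / fact n"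
proof -
  let ?r = "{(G, H). isomorphic G H}"
  let ?rep = "\<lambda>X. SOME G. G \<in> X"
  let ?std = "\<lambda>(\<sigma>, \<tau>). std_graph n \<sigma> \<tau>"
  let ?T = "type_pairs n (k, l, m)"
  have fin: "finite ?T"
    by (rule finite_subset[of _ "trans_perm_pairs {..<n}"]) (auto simp: type_pairs_def)
  have cls: "?r `` {G} = {H. isomorphic G H}" for G by auto
  have std: "?std p \<in> belyi_of_type k l m" if "p \<in> ?T" for p
    using that isomorphic_std_graph[OF n(1) _ isomorphic_refl] by (auto simp: type_pairs_def belyi_of_type_def)
  have code: "\<exists>p\<in>?T. isomorphic (?std p) G" if "G \<in> belyi_of_type k l m" for G
  proof -
    have G: "is_belyi G" "btype G = (k, l, m)" using that by (auto simp: belyi_of_type_def)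
    obtain \<sigma> \<tau> where st: "(\<sigma>, \<tau>) \<in> trans_perm_pairs {..<bdegree G}" "isomorphic (std_graph (bdegree G) \<sigma> \<tau>) G"
      using belyi_code_exists[OF G(1) refl] by blast
    have t: "pair_type (bdegree G) \<sigma> \<tau> = (k, l, m)"
      using isomorphic_std_graph(2)[OF bdegree_pos[OF G(1)] st] G(2) by simp
    \<comment> \<open>The degree is recovered from the type, as the sum of the cycle lengths counted
      by \<open>m\<close>.\<close>
    have "bdegree G = n"
      using pair_type_degree[of \<sigma> "bdegree G" \<tau>] trans_perm_pairsD[OF st(1)] n(2) unfolding t by simp
    thus ?thesis using st t by (intro bexI[of _ "(\<sigma>, \<tau>)"]) (auto simp: type_pairs_def)
  qed
  have wf_std: "wf_graph (?std p)" if "p \<in> ?T" for p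
    using std[OF that] wf_graph_belyi by (auto simp: belyi_of_type_def)
  have rep: "?rep X \<in> belyi_of_type k l m \<and> X = {H. isomorphic (?rep X) H}" if X: "X \<in> belyi_classes k l m" for X
  proof -
    obtain G where G: "G \<in> belyi_of_type k l m" "X = {H. isomorphic G H}"
      using X unfolding belyi_classes_def quotient_def cls by auto
    have wfG: "wf_graph G" using G(1) wf_graph_belyi by (auto simp: belyi_of_type_def)
    have GX: "isomorphic G (?rep X)" using someI[of "\<lambda>H. H \<in> X" G] isomorphic_refl unfolding G(2) by simp
    obtain p where p: "p \<in> ?T" "isomorphic (?std p) G" using code[OF G(1)] by blast
    obtain \<sigma> \<tau> where st: "p = (\<sigma>, \<tau>)" "(\<sigma>, \<tau>) \<in> trans_perm_pairs {..<n}" "pair_type n \<sigma> \<tau> = (k, l, m)"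
      using p(1) by (auto simp: type_pairs_def)
    \<comment> \<open>The class consists of arbitrary \<open>bgraph\<close>s, and
      \<open>SOME\<close> may pick any of them. That the pick is a Belyi graph of the same type is
      read off from a code.\<close>
    have "isomorphic (std_graph n \<sigma> \<tau>) (?rep X)" using isomorphic_trans[OF p(2) GX] by (simp add: st(1))
    from isomorphic_std_graph[OF n(1) st(2) this] have r: "?rep X \<in> belyi_of_type k l m"
      by (simp add: belyi_of_type_def st(3))
    have "isomorphic (?rep X) G" by (rule isomorphic_sym[OF wfG GX])
    hence "X = {H. isomorphic (?rep X) H}"
      using GX isomorphic_trans unfolding G(2) by blast
    thus ?thesis using r by blast
  qed
  have codes_rep: "{p \<in> ?T. {H. isomorphic (?std p) H} = X} = codes n (?rep X)"
    and inv_Aut: "1 / real (card (Aut (?rep X))) = real (card (codes n (?rep X))) / fact n"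
    if X: "X \<in> belyi_classes k l m" for X
  proof -
    let ?G = "?rep X"
    have G: "?G \<in> belyi_of_type k l m" and Xeq: "X = {H. isomorphic ?G H}" using rep[OF X] by auto
    have wfG: "wf_graph ?G" and GB: "is_belyi ?G" "btype ?G = (k, l, m)"
      using G wf_graph_belyi by (auto simp: belyi_of_type_def)
    obtain p where p: "p \<in> ?T" "isomorphic (?std p) ?G" using code[OF G] by blast
    have deg: "bdegree ?G = n"
      using p isomorphic_std_graph(3)[OF n(1)] by (auto simp: type_pairs_def)
    show "{p \<in> ?T. {H. isomorphic (?std p) H} = X} = codes n ?G"
    proof (intro equalityI subsetI)
      fix q assume q: "q \<in> {p \<in> ?T. {H. isomorphic (?std p) H} = X}"
      have "?G \<in> X" using isomorphic_refl by (subst Xeq) simp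
      hence "isomorphic (?std q) ?G" using q by blast
      thus "q \<in> codes n ?G" using q by (auto simp: codes_def type_pairs_def)
    next
      fix q assume q: "q \<in> codes n ?G"
      then obtain \<sigma> \<tau> where st: "q = (\<sigma>, \<tau>)" "(\<sigma>, \<tau>) \<in> trans_perm_pairs {..<n}" "isomorphic (std_graph n \<sigma> \<tau>) ?G"
        by (auto simp: codes_def)
      have qT: "q \<in> ?T" using isomorphic_std_graph(2)[OF n(1) st(2,3)] GB(2) st by (simp add: type_pairs_def)
      have iso: "isomorphic (?std q) ?G" "isomorphic ?G (?std q)"
        using st isomorphic_sym[OF wf_std[OF qT]] by auto
      have "{H. isomorphic (?std q) H} = {H. isomorphic ?G H}"
        using iso isomorphic_trans by blast
      thus "q \<in> {p \<in> ?T. {H. isomorphic (?std p) H} = X}" using qT Xeq by simp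
    qed
    have "real (card (codes n ?G)) * real (card (Aut ?G)) = fact n"
      using card_codes[OF GB(1) deg[symmetric]] by (metis of_nat_fact of_nat_mult)
    moreover from this have "real (card (Aut ?G)) \<noteq> 0" by (metis fact_nonzero mult_zero_right)
    ultimately show "1 / real (card (Aut ?G)) = real (card (codes n ?G)) / fact n"
      by (simp add: field_simps)
  qed
  let ?c = "\<lambda>p. {H. isomorphic (?std p) H}"
  have "belyi_classes k l m = ?c ` ?T"
  proof (intro equalityI subsetI)
    fix X assume X: "X \<in> belyi_classes k l m"
    obtain p where p: "p \<in> ?T" "isomorphic (?std p) (?rep X)" using code rep[OF X] by blast
    hence "isomorphic (?rep X) (?std p)" using isomorphic_sym wf_std by blast
    hence "?c p = {H. isomorphic (?rep X) H}" using p(2) isomorphic_trans by blast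
    hence "?c p = X" using rep[OF X] by simp
    thus "X \<in> ?c ` ?T" using p(1) by blast
  next
    fix X assume "X \<in> ?c ` ?T"
    thus "X \<in> belyi_classes k l m" unfolding belyi_classes_def quotient_def cls using std by auto
  qed
  hence fin_cls: "finite (belyi_classes k l m)" and sub: "?c ` ?T \<subseteq> belyi_classes k l m" using fin by auto
  have "real (card ?T) = (\<Sum>p\<in>?T. 1)" by simp
  also have "\<dots> = (\<Sum>X\<in>belyi_classes k l m. \<Sum>p\<in>{p \<in> ?T. ?c p = X}. 1)"
    by (rule sum.group[OF fin fin_cls sub, symmetric])
  also have "\<dots> = (\<Sum>X\<in>belyi_classes k l m. real (card (codes n (?rep X))))"
    by (intro sum.cong refl) (simp add: codes_rep)
  finally show ?thesis
    unfolding Ncount_def by (simp add: inv_Aut sum_divide_distrib cong: sum.cong)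
qed

lemma trans_series_eq_card:
  assumes n: "n = lk \<alpha> S"
  shows "trans_series n \<alpha> = real (card (type_pairs n (lk \<alpha> U, lk \<alpha> V, \<lambda>i. lk \<alpha> (T i))))"
proof -
  have "fmon (wt {..<n} \<sigma> \<tau>) \<alpha> = (if pair_type n \<sigma> \<tau> = (lk \<alpha> U, lk \<alpha> V, \<lambda>i. lk \<alpha> (T i)) then 1 else 0)" for \<sigma> \<tau>
  proof -
    let ?w = "wt {..<n} \<sigma> \<tau>"
    have "\<alpha> = ?w \<longleftrightarrow> pair_type n \<sigma> \<tau> = (lk \<alpha> U, lk \<alpha> V, \<lambda>i. lk \<alpha> (T i))"
    proof
      assume "\<alpha> = ?w"
      thus "pair_type n \<sigma> \<tau> = (lk \<alpha> U, lk \<alpha> V, \<lambda>i. lk \<alpha> (T i))"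
        by (simp add: pair_type_def lookup_wt)
    next
      assume eq: "pair_type n \<sigma> \<tau> = (lk \<alpha> U, lk \<alpha> V, \<lambda>i. lk \<alpha> (T i))"
      show "\<alpha> = ?w"
      proof (rule poly_mapping_eqI)
        fix x show "lk \<alpha> x = lk ?w x"
          using eq n by (cases x) (auto simp: pair_type_def lookup_wt fun_eq_iff)
      qed
    qed
    thus ?thesis by (simp add: fmon_def)
  qed
  hence "trans_series n \<alpha> = (\<Sum>p\<in>trans_perm_pairs {..<n}. if p \<in> type_pairs n (lk \<alpha> U, lk \<alpha> V, \<lambda>i. lk \<alpha> (T i)) then 1 else 0)"
    unfolding trans_series_def trans_pairs_def by (intro sum.cong refl) (auto simp: type_pairs_def split: if_splits)
  also have "\<dots> = real (card (trans_perm_pairs {..<n} \<inter> type_pairs n (lk \<alpha> U, lk \<alpha> V, \<lambda>i. lk \<alpha> (T i))))"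
    by (simp add: sum.If_cases)
  also have "trans_perm_pairs {..<n} \<inter> type_pairs n (lk \<alpha> U, lk \<alpha> V, \<lambda>i. lk \<alpha> (T i))
      = type_pairs n (lk \<alpha> U, lk \<alpha> V, \<lambda>i. lk \<alpha> (T i))" by (auto simp: type_pairs_def)
  finally show ?thesis .
qed

text \<open>The side conditions in \<open>belyi_F_def\<close> hold for the monomial of any pair with
  \<open>n > 0\<close>: both permutations have a cycle, no cycle has length 0, and the lengths add
  up to \<open>n\<close>. Where a condition fails there is no pair, and both sides are 0.\<close>

lemma belyi_F_eq_F_pairs: "belyi_F = F_pairs"
proof
  fix \<alpha> :: mono
  define n where "n = lk \<alpha> S"
  define t where "t = (lk \<alpha> U, lk \<alpha> V, \<lambda>i. lk \<alpha> (T i))"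
  show "belyi_F \<alpha> = F_pairs \<alpha>"
  proof (cases "n = 0")
    case True
    thus ?thesis by (simp add: belyi_F_def F_pairs_def n_def)
  next
    case False
    have F: "F_pairs \<alpha> = real (card (type_pairs n t)) / fact n"
      using False trans_series_eq_card[OF n_def] by (simp add: F_pairs_def n_def t_def)
    let ?cond = "lk \<alpha> (T 0) = 0 \<and> 1 \<le> lk \<alpha> S \<and> 1 \<le> lk \<alpha> U \<and> 1 \<le> lk \<alpha> V \<and>
        Sum_any (\<lambda>i. i * lk \<alpha> (T i)) = lk \<alpha> S"
    show ?thesis
    proof (cases ?cond)
      case True
      thus ?thesis using Ncount_eq[of n "\<lambda>i. lk \<alpha> (T i)" "lk \<alpha> U" "lk \<alpha> V"] False
        by (simp add: belyi_F_def F t_def n_def)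
    next
      case no: False
      have "type_pairs n t = {}"
      proof (rule ccontr)
        assume "type_pairs n t \<noteq> {}"
        then obtain \<sigma> \<tau> where st: "(\<sigma>, \<tau>) \<in> trans_perm_pairs {..<n}" "pair_type n \<sigma> \<tau> = t"
          by (auto simp: type_pairs_def)
        have p: "\<sigma> permutes {..<n}" "\<tau> permutes {..<n}" using trans_perm_pairsD[OF st(1)] by auto
        have U: "lk \<alpha> U = card (orbs \<sigma> {..<n})" and V: "lk \<alpha> V = card (orbs \<tau> {..<n})"
          and T0: "lk \<alpha> (T 0) = card {A \<in> orbs (\<tau> \<circ> inv \<sigma>) {..<n}. card A = 0}"
          using st(2) by (auto simp: pair_type_def t_def fun_eq_iff)
        have ne: "1 \<le> card (orbs f {..<n})" for f
        proof -
          have "orbs f {..<n} \<noteq> {}" using False by (auto simp: orbs_def)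
          thus ?thesis by (simp add: Suc_le_eq card_gt_0_iff)
        qed
        have "card A \<noteq> 0" if "A \<in> orbs (\<tau> \<circ> inv \<sigma>) {..<n}" for A
        proof -
          have "permutation (\<tau> \<circ> inv \<sigma>)"
            by (rule permutes_permutation[of _ "{..<n}"]) (auto intro: permutes_compose permutes_inv p)
          thus ?thesis using that funpow_orbit_bij(3) by (fastforce simp: orbs_def)
        qed
        hence "{A \<in> orbs (\<tau> \<circ> inv \<sigma>) {..<n}. card A = 0} = {}" by blast
        hence "lk \<alpha> (T 0) = 0" unfolding T0 by (simp only: card.empty)
        moreover have "Sum_any (\<lambda>i. i * lk \<alpha> (T i)) = n"
          using pair_type_degree[OF p] unfolding st(2) t_def by simp
        ultimately show False using no ne U V False by (auto simp: n_def)
      qed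
      thus ?thesis using no by (auto simp: belyi_F_def F)
    qed
  qed
qed

theorem theorem2:
  shows "fderiv S belyi_F = cj_rhs belyi_F \<and>
         (\<forall>\<alpha>. Poly_Mapping.lookup \<alpha> S = 0 \<longrightarrow> belyi_F \<alpha> = 0) \<and>
         (\<forall>G. (\<forall>\<alpha>. Poly_Mapping.lookup \<alpha> (T 0) \<noteq> 0 \<longrightarrow> G \<alpha> = 0) \<and>
              (\<forall>\<alpha>. Poly_Mapping.lookup \<alpha> S = 0 \<longrightarrow> G \<alpha> = 0) \<and>
              fderiv S G = cj_rhs G \<longrightarrow> G = belyi_F) \<and>
         fexp belyi_F = exp_sA_one"
proof (intro conjI allI impI)
  show evo: "fderiv S belyi_F = cj_rhs belyi_F"
    by (simp add: belyi_F_eq_F_pairs F_pairs_evolution)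
  show init: "belyi_F \<alpha> = 0" if "lk \<alpha> S = 0" for \<alpha>
    using that by (simp add: belyi_F_eq_F_pairs F_pairs_S_0)
  show "G = belyi_F"
    if "(\<forall>\<alpha>. lk \<alpha> (T 0) \<noteq> 0 \<longrightarrow> G \<alpha> = 0) \<and> (\<forall>\<alpha>. lk \<alpha> S = 0 \<longrightarrow> G \<alpha> = 0) \<and> fderiv S G = cj_rhs G" for G
    using that evo init by (intro evolution_unique[of G cj_rhs belyi_F] agree_cj_rhs) auto
  show "fexp belyi_F = exp_sA_one"
    by (simp add: belyi_F_eq_F_pairs fexp_F_pairs exp_sA_one_eq_Z_pairs)
qed

end
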